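(* Let $c,d>0$ and let $(\mathcal{T}_1,\mathcal{T}_2)$ be a commuting 3-symmetric 2-tuple on a complex Hilbert space $H$, with coefficients $B_{j,k}$. Then $(\mathcal{T}_1,\mathcal{T}_2)$ lifts to a 2-tuple $(\mathcal{J}_1,\mathcal{J}_2)$ of the form $$\mathcal{J}_1=\begin{pmatrix}A_1&-ic&0\\0&A_1&0\\0&0&A_1\end{pmatrix},\qquad \mathcal{J}_2=\begin{pmatrix}A_2&0&-id\\0&A_2&0\\0&0&A_2\end{pmatrix},$$ where $A_1,A_2$ are commuting self-adjoint operators on some Hilbert space $F$ and the matrices act on $F\oplus F\oplus F$, if and only if the polynomial $$\hat{Q}_{\mathcal{T}}(\alpha,\beta)=I+\alpha B_{1,0}+\beta B_{0,1}+\alpha\beta B_{1,1}+\alpha^2B_{2,0}+\beta^2B_{0,2}-\frac1{c^2}B_{2,0}-\frac1{d^2}B_{0,2}\succeq 0$$ factors in the form $$\hat{Q}_{\mathcal{T}}(\alpha,\beta)=(V_0+\alpha V_1+\beta V_2)^*(V_0+\alpha V_1+\beta V_2)\qquad((\alpha,\beta)\in\mathbb{R}^2)$$ for some bounded operators $V_0,V_1,V_2$ on $H$.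
   Context: All operators are bounded. A commuting pair $\mathcal{T}=(\mathcal{T}_1,\mathcal{T}_2)$ of operators on a complex Hilbert space $H$ is a commuting 3-symmetric tuple if there exist bounded operators $B_{j,k}$ on $H$ such that $$\exp(is_2\mathcal{T}_2)^*\exp(is_1\mathcal{T}_1)^*\exp(is_1\mathcal{T}_1)\exp(is_2\mathcal{T}_2)=I+\sum_{0<j+k\le2}s_1^js_2^kB_{j,k}$$ for all $(s_1,s_2)\in\mathbb{R}^2$. A scalar entry in an operator matrix denotes that multiple of the identity. The pair $(\mathcal{T}_1,\mathcal{T}_2)$ lifts to $(\mathcal{J}_1,\mathcal{J}_2)$ on $K$ if there is an isometry $V:H\to K$ with $V\mathcal{T}_i=\mathcal{J}_iV$ for $i=1,2$. The notation $\succeq0$ means positive semidefinite (here for all $(\alpha,\beta)\in\mathbb{R}^2$). *)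

theory Defs
  imports "HOL-Analysis.Analysis"
begin

text \<open>
  Complex Hilbert spaces as a type class.  The complex inner product \<open>cinner\<close> is linear in its
  second argument; its real part is required to be the inner product of the class
  \<^class>\<open>real_inner\<close>, so that norm, topology and completeness are those of the library.
\<close>

class complex_inner = real_inner +
  fixes scaleC :: "complex \<Rightarrow> 'a \<Rightarrow> 'a" (infixr "*\<^sub>C" 75)
    and cinner :: "'a \<Rightarrow> 'a \<Rightarrow> complex"
  assumes scaleC_add_right: "a *\<^sub>C (x + y) = a *\<^sub>C x + a *\<^sub>C y"
    and scaleC_add_left: "(a + b) *\<^sub>C x = a *\<^sub>C x + b *\<^sub>C x"
    and scaleC_scaleC: "a *\<^sub>C (b *\<^sub>C x) = (a * b) *\<^sub>C x"
    and scaleR_eq_scaleC: "r *\<^sub>R x = complex_of_real r *\<^sub>C x"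
    and cinner_add_right: "cinner x (y + z) = cinner x y + cinner x z"
    and cinner_scaleC_right: "cinner x (a *\<^sub>C y) = a * cinner x y"
    and cinner_commute: "cinner x y = cnj (cinner y x)"
    and inner_eq_Re_cinner: "inner x y = Re (cinner x y)"

class chilbert_space = complex_inner + complete_space

instantiation complex :: chilbert_space
begin

definition "scaleC_complex (a::complex) (x::complex) = a * x"
definition "cinner_complex (x::complex) (y::complex) = cnj x * y"

instance
  by standard
    (auto simp: scaleC_complex_def cinner_complex_def algebra_simps scaleR_conv_of_real inner_complex_def)

end

instantiation prod :: (complex_inner, complex_inner) complex_inner
begin

definition "scaleC_prod a (x :: 'a \<times> 'b) = (a *\<^sub>C fst x, a *\<^sub>C snd x)"
definition "cinner_prod (x :: 'a \<times> 'b) (y :: 'a \<times> 'b) =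
  cinner (fst x) (fst y) + cinner (snd x) (snd y)"

instance
proof
  fix x y z :: "'a \<times> 'b" and a b :: complex and r :: real
  show "cinner x y = cnj (cinner y x)"
    unfolding cinner_prod_def complex_cnj_add by (metis cinner_commute)
qed (auto simp: scaleC_prod_def cinner_prod_def scaleC_add_right scaleC_add_left scaleC_scaleC
      scaleR_eq_scaleC cinner_add_right cinner_scaleC_right algebra_simps
      inner_prod_def inner_eq_Re_cinner prod_eq_iff)

end

instance prod :: (chilbert_space, chilbert_space) chilbert_space ..

text \<open>
  Hilbert spaces over which one has to quantify inside a formula are represented as closed
  complex subspaces of a type of class \<^class>\<open>chilbert_space\<close> (the whole type is one of them).
  Operators on such a subspace are functions of which only the values on the subspace matter.
\<close>

definition hilbert_subspace :: "'a::chilbert_space set \<Rightarrow> bool" where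
  "hilbert_subspace F \<longleftrightarrow>
     0 \<in> F \<and> (\<forall>x\<in>F. \<forall>y\<in>F. x + y \<in> F) \<and> (\<forall>a. \<forall>x\<in>F. a *\<^sub>C x \<in> F) \<and> closed F"

definition clinear_on :: "'a::complex_inner set \<Rightarrow> ('a \<Rightarrow> 'b::complex_inner) \<Rightarrow> bool" where
  "clinear_on F A \<longleftrightarrow>
     (\<forall>x\<in>F. \<forall>y\<in>F. A (x + y) = A x + A y) \<and> (\<forall>a. \<forall>x\<in>F. A (a *\<^sub>C x) = a *\<^sub>C A x)"

definition bounded_op_on :: "'a::complex_inner set \<Rightarrow> ('a \<Rightarrow> 'a) \<Rightarrow> bool" where
  "bounded_op_on F A \<longleftrightarrow>
     A \<in> F \<rightarrow> F \<and> clinear_on F A \<and> (\<exists>M. \<forall>x\<in>F. norm (A x) \<le> M * norm x)"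

abbreviation bounded_op :: "('a::complex_inner \<Rightarrow> 'a) \<Rightarrow> bool" where
  "bounded_op \<equiv> bounded_op_on UNIV"

lemma bounded_op_iff_bounded_linear:
  "bounded_op A \<longleftrightarrow> bounded_linear A \<and> (\<forall>a x. A (a *\<^sub>C x) = a *\<^sub>C A x)"
proof
  assume A: "bounded_op A"
  then obtain M where M: "\<And>x. norm (A x) \<le> norm x * M"
    unfolding bounded_op_on_def by (auto simp: mult.commute)
  from A have lin: "A (x + y) = A x + A y" "A (a *\<^sub>C x) = a *\<^sub>C A x" for a x y
    unfolding bounded_op_on_def clinear_on_def by auto
  have "bounded_linear A"
    by (rule bounded_linear_intro[where K = M]) (simp_all add: lin scaleR_eq_scaleC M)
  with lin show "bounded_linear A \<and> (\<forall>a x. A (a *\<^sub>C x) = a *\<^sub>C A x)"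
    by blast
next
  assume A: "bounded_linear A \<and> (\<forall>a x. A (a *\<^sub>C x) = a *\<^sub>C A x)"
  then obtain M where "\<And>x. norm (A x) \<le> norm x * M"
    using bounded_linear.bounded by blast
  then have "\<forall>x. norm (A x) \<le> M * norm x"
    by (simp add: mult.commute)
  moreover have "A (x + y) = A x + A y" for x y
    using A by (simp add: bounded_linear.linear linear_add)
  ultimately show "bounded_op A"
    unfolding bounded_op_on_def clinear_on_def using A by auto
qed

definition self_adjoint_on :: "'a::complex_inner set \<Rightarrow> ('a \<Rightarrow> 'a) \<Rightarrow> bool" where
  "self_adjoint_on F A \<longleftrightarrow> bounded_op_on F A \<and> (\<forall>x\<in>F. \<forall>y\<in>F. cinner (A x) y = cinner x (A y))"

definition cadjoint :: "('a::complex_inner \<Rightarrow> 'a) \<Rightarrow> 'a \<Rightarrow> 'a" where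
  "cadjoint A = (SOME A'. \<forall>x y. cinner (A x) y = cinner x (A' y))"

definition psd :: "('a::complex_inner \<Rightarrow> 'a) \<Rightarrow> bool" where
  "psd A \<longleftrightarrow> (\<forall>x. cinner x (A x) \<in> \<real> \<and> 0 \<le> Re (cinner x (A x)))"

definition op_exp :: "('a::chilbert_space \<Rightarrow> 'a) \<Rightarrow> 'a \<Rightarrow> 'a" where
  "op_exp A x = (\<Sum>n. (A ^^ n) x /\<^sub>R fact n)"

definition exp_i :: "real \<Rightarrow> ('a::chilbert_space \<Rightarrow> 'a) \<Rightarrow> 'a \<Rightarrow> 'a" where
  "exp_i s T = op_exp (\<lambda>x. (\<i> * complex_of_real s) *\<^sub>C T x)"

definition commuting_3_symmetric ::
  "('a::chilbert_space \<Rightarrow> 'a) \<Rightarrow> ('a \<Rightarrow> 'a) \<Rightarrow> (nat \<Rightarrow> nat \<Rightarrow> 'a \<Rightarrow> 'a) \<Rightarrow> bool" where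
  "commuting_3_symmetric T1 T2 B \<longleftrightarrow>
     bounded_op T1 \<and> bounded_op T2 \<and> T1 \<circ> T2 = T2 \<circ> T1 \<and>
     (\<forall>j k. 0 < j + k \<and> j + k \<le> 2 \<longrightarrow> bounded_op (B j k)) \<and>
     (\<forall>s1 s2 :: real.
        cadjoint (exp_i s2 T2) \<circ> cadjoint (exp_i s1 T1) \<circ> exp_i s1 T1 \<circ> exp_i s2 T2 =
        (\<lambda>x. x + (\<Sum>(j, k) \<in> {(j, k). 0 < j + k \<and> j + k \<le> 2}. (s1 ^ j * s2 ^ k) *\<^sub>R B j k x)))"

definition lifts_to ::
  "('h::chilbert_space \<Rightarrow> 'h) \<Rightarrow> ('h \<Rightarrow> 'h) \<Rightarrow>
   'k::chilbert_space set \<Rightarrow> ('k \<Rightarrow> 'k) \<Rightarrow> ('k \<Rightarrow> 'k) \<Rightarrow> bool" where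
  "lifts_to T1 T2 K J1 J2 \<longleftrightarrow>
     (\<exists>V. V \<in> UNIV \<rightarrow> K \<and> clinear_on UNIV V \<and> (\<forall>x. norm (V x) = norm x) \<and>
        (\<forall>x. V (T1 x) = J1 (V x)) \<and> (\<forall>x. V (T2 x) = J2 (V x)))"

definition model1 :: "real \<Rightarrow> ('f::complex_inner \<Rightarrow> 'f) \<Rightarrow> 'f \<times> 'f \<times> 'f \<Rightarrow> 'f \<times> 'f \<times> 'f" where
  "model1 c A = (\<lambda>(x, y, z). (A x + (- \<i> * complex_of_real c) *\<^sub>C y, A y, A z))"

definition model2 :: "real \<Rightarrow> ('f::complex_inner \<Rightarrow> 'f) \<Rightarrow> 'f \<times> 'f \<times> 'f \<Rightarrow> 'f \<times> 'f \<times> 'f" where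
  "model2 d A = (\<lambda>(x, y, z). (A x + (- \<i> * complex_of_real d) *\<^sub>C z, A y, A z))"

definition lifts_to_model ::
  "real \<Rightarrow> real \<Rightarrow> ('h::chilbert_space \<Rightarrow> 'h) \<Rightarrow> ('h \<Rightarrow> 'h) \<Rightarrow> 'f::chilbert_space set \<Rightarrow> bool" where
  "lifts_to_model c d T1 T2 F \<longleftrightarrow>
     (\<exists>A1 A2. self_adjoint_on F A1 \<and> self_adjoint_on F A2 \<and> (\<forall>x\<in>F. A1 (A2 x) = A2 (A1 x)) \<and>
        lifts_to T1 T2 (F \<times> F \<times> F) (model1 c A1) (model2 d A2))"

definition Q_hat ::
  "real \<Rightarrow> real \<Rightarrow> (nat \<Rightarrow> nat \<Rightarrow> 'a::complex_inner \<Rightarrow> 'a) \<Rightarrow> real \<Rightarrow> real \<Rightarrow> 'a \<Rightarrow> 'a" where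
  "Q_hat c d B \<alpha> \<beta> = (\<lambda>x.
     x + \<alpha> *\<^sub>R B 1 0 x + \<beta> *\<^sub>R B 0 1 x + (\<alpha> * \<beta>) *\<^sub>R B 1 1 x + \<alpha>\<^sup>2 *\<^sub>R B 2 0 x + \<beta>\<^sup>2 *\<^sub>R B 0 2 x
       - (1 / c\<^sup>2) *\<^sub>R B 2 0 x - (1 / d\<^sup>2) *\<^sub>R B 0 2 x)"

definition factors_linearly :: "(real \<Rightarrow> real \<Rightarrow> 'a::complex_inner \<Rightarrow> 'a) \<Rightarrow> bool" where
  "factors_linearly Q \<longleftrightarrow>
     (\<exists>V0 V1 V2. bounded_op V0 \<and> bounded_op V1 \<and> bounded_op V2 \<and>
        (\<forall>\<alpha> \<beta>. Q \<alpha> \<beta> =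
           cadjoint (\<lambda>x. V0 x + \<alpha> *\<^sub>R V1 x + \<beta> *\<^sub>R V2 x) \<circ> (\<lambda>x. V0 x + \<alpha> *\<^sub>R V1 x + \<beta> *\<^sub>R V2 x)))"

end

theory Submission
  imports Defs "HOL-Computational_Algebra.Formal_Power_Series"
begin

text \<open>
  Write \<open>Q(s) = I + \<Sum> s\<^sub>1\<^sup>j s\<^sub>2\<^sup>k B\<^sub>j\<^sub>k\<close> and \<open>z(t) = exp(\<i> t\<^sub>1 T\<^sub>1) exp(\<i> t\<^sub>2 T\<^sub>2)\<close>.  The group law gives
  \<open>Q(s + t) = z(t)\<^sup>* Q(s) z(t)\<close>.  Hence each \<open>B\<^sub>j\<^sub>k\<close> is obtained, up to a factor \<open>2\<close>, from the coefficients
  of lower order by the derivations \<open>X \<mapsto> \<i> (X T - T\<^sup>* X)\<close> with \<open>T = T\<^sub>1, T\<^sub>2\<close>, and since \<open>B\<^sub>2\<^sub>0\<close> and \<open>B\<^sub>0\<^sub>2\<close> are fixed by \<open>X \<mapsto> z(t)\<^sup>* X z(t)\<close>,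
  the polynomial of the theorem satisfies the same law as \<open>Q\<close>.

  A lifting with components \<open>a\<close>, \<open>b\<close>, \<open>e\<close> determines all \<open>B\<^sub>j\<^sub>k\<close> through the derivations, and the
  polynomial factors through \<open>L(\<alpha>, \<beta>) = a + \<alpha> c b + \<beta> d e\<close>
  (\<open>factorization_of_lifting\<close>).  These operators map \<open>H\<close> to the model space \<open>F\<close>, whereas the theorem asks
  for operators on \<open>H\<close>.  So the span of the three ranges has to embed isometrically into \<open>H\<close>
  (\<open>ranges_embed_isometrically\<close>).  In infinite dimension this is a count of Hilbert bases.  In finite
  dimension a count of this kind loses a factor \<open>3\<close>; here a trace argument shows that all three ranges
  lie in the range of \<open>a\<close> (\<open>range_subset_range_of_intertwining\<close>).

  Conversely, let \<open>(V\<^sub>0, V\<^sub>1, V\<^sub>2)\<close> be a factorization.  The required self-adjoint operators should satisfy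
  \<open>A\<^sub>1 V\<^sub>0 = V\<^sub>0 T\<^sub>1 + \<i> V\<^sub>1\<close>, \<open>A\<^sub>1 V\<^sub>1 = V\<^sub>1 T\<^sub>1\<close>, and so on; that is, explicit operators \<open>D\<^sub>1\<close>, \<open>D\<^sub>2\<close> on the
  threefold sum of \<open>H\<close> should be symmetric for the form \<open>(V\<^sub>i\<^sup>* V\<^sub>j)\<close>.  This can fail, since the
  polynomial determines that form only up to symmetrization, so the factorization is not unique.  But
  the forms that are compatible with the polynomial make up a convex set that is invariant under the
  commuting flows \<open>exp(\<i> t D\<^sub>1)\<close> and \<open>exp(\<i> t D\<^sub>2)\<close>, with bounded orbits.  Averaging over one flow and
  then over the other, with an invariant mean on the line, produces a fixed point
  (\<open>psd_form_average\<close>, \<open>symmetric_form_exists\<close>).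
  The averaged form is \<open>R\<^sup>* R\<close> for a bounded operator \<open>R\<close> on the threefold sum
  (\<open>psd_form_factors\<close>).  An operator that is symmetric for a bounded form is automatically bounded for its seminorm
  (\<open>symmetric_operator_form_bound\<close>), so \<open>D\<^sub>1\<close> and \<open>D\<^sub>2\<close> descend to the closure of the range of \<open>R\<close>, and the
  columns of \<open>R\<close> are the components of the lifting (\<open>lifting_of_factorization\<close>).
\<close>

section \<open>Complex inner product spaces\<close>

interpretation complex_vector: vector_space "scaleC :: complex \<Rightarrow> 'a::complex_inner \<Rightarrow> 'a"
  by standard (simp_all add: scaleC_add_right scaleC_add_left scaleC_scaleC
      scaleR_eq_scaleC[of 1, simplified, symmetric])

interpretation complex_vector: vector_space_pair
    "scaleC :: complex \<Rightarrow> 'a::complex_inner \<Rightarrow> 'a" "scaleC :: complex \<Rightarrow> 'b::complex_inner \<Rightarrow> 'b"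
  by standard

lemma hilbert_subspace_iff: "hilbert_subspace F \<longleftrightarrow> complex_vector.subspace F \<and> closed F"
  unfolding hilbert_subspace_def complex_vector.subspace_def by auto

text \<open>
  Positive semidefinite hermitian forms, linear in the second argument.  They are used for the
  inner product itself, for its pullbacks under operators and for averages of such pullbacks.
\<close>

definition psd_form :: "('a::complex_inner \<Rightarrow> 'a \<Rightarrow> complex) \<Rightarrow> bool" where
  "psd_form g \<longleftrightarrow>
     (\<forall>x y z. g x (y + z) = g x y + g x z) \<and> (\<forall>a x y. g x (a *\<^sub>C y) = a * g x y) \<and>
     (\<forall>x y. g x y = cnj (g y x)) \<and> (\<forall>x. 0 \<le> Re (g x x))"

lemma psd_formI:
  assumes "\<And>x y z. g x (y + z) = g x y + g x z" "\<And>a x y. g x (a *\<^sub>C y) = a * g x y"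
    and "\<And>x y. g x y = cnj (g y x)" "\<And>x. 0 \<le> Re (g x x)"
  shows "psd_form g"
  using assms unfolding psd_form_def by blast

context
  fixes g :: "'a::complex_inner \<Rightarrow> 'a \<Rightarrow> complex"
  assumes g: "psd_form g"
begin

lemma psd_form_add_right: "g x (y + z) = g x y + g x z"
  and psd_form_scaleC_right: "g x (a *\<^sub>C y) = a * g x y"
  and psd_form_commute: "g x y = cnj (g y x)"
  and psd_form_nonneg: "0 \<le> Re (g x x)"
  using g unfolding psd_form_def by blast+

lemma psd_form_add_left: "g (x + y) z = g x z + g y z"
  by (metis (no_types) psd_form_add_right psd_form_commute complex_cnj_add)

lemma psd_form_scaleC_left: "g (a *\<^sub>C x) y = cnj a * g x y"
  by (metis psd_form_commute psd_form_scaleC_right complex_cnj_mult)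

lemma psd_form_self: "g x x = complex_of_real (Re (g x x))"
  using arg_cong[OF psd_form_commute, of Im x x] by (simp add: complex_eq_iff)

lemma psd_form_minus_right: "g x (- y) = - g x y"
  using psd_form_scaleC_right[of x "-1" y] by simp

lemma psd_form_minus_left: "g (- x) y = - g x y"
  using psd_form_scaleC_left[of "-1" x y] by simp

lemma psd_form_diff_right: "g x (y - z) = g x y - g x z"
  using psd_form_add_right[of x y "- z"] by (simp add: psd_form_minus_right)

lemma psd_form_diff_left: "g (x - y) z = g x z - g y z"
  using psd_form_add_left[of x "- y" z] by (simp add: psd_form_minus_left)

lemma psd_form_zero_right: "g x 0 = 0"
  using psd_form_scaleC_right[of x 0 0] by simp

lemma psd_form_zero_left: "g 0 x = 0"
  using psd_form_scaleC_left[of 0 0 x] by simp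

lemma psd_form_scaleR_right: "g x (r *\<^sub>R y) = of_real r * g x y"
  by (simp add: scaleR_eq_scaleC psd_form_scaleC_right)

lemma psd_form_scaleR_left: "g (r *\<^sub>R x) y = of_real r * g x y"
  by (simp add: scaleR_eq_scaleC psd_form_scaleC_left)

lemmas psd_form_simps =
  psd_form_add_left psd_form_add_right psd_form_diff_left psd_form_diff_right
  psd_form_minus_left psd_form_minus_right psd_form_scaleC_left psd_form_scaleC_right
  psd_form_scaleR_left psd_form_scaleR_right psd_form_zero_left psd_form_zero_right

lemma psd_form_sum_right: "g x (\<Sum>i\<in>I. f i) = (\<Sum>i\<in>I. g x (f i))"
  by (induction I rule: infinite_finite_induct) (simp_all add: psd_form_simps)

lemma psd_form_sum_left: "g (\<Sum>i\<in>I. f i) x = (\<Sum>i\<in>I. g (f i) x)"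
  by (induction I rule: infinite_finite_induct) (simp_all add: psd_form_simps)

text \<open>
  The usual discriminant argument on the line through \<open>x\<close> in the direction of \<open>cnj (g x y)\<close> times \<open>y\<close>.
  The form may be degenerate, so \<open>g y y = 0\<close> is a case of its own.
\<close>

lemma psd_form_Cauchy_Schwarz: "(cmod (g x y))\<^sup>2 \<le> Re (g x x) * Re (g y y)"
proof -
  let ?b = "g x y"
  have *: "0 \<le> Re (g x x) - 2 * t * (cmod ?b)\<^sup>2 + t\<^sup>2 * (cmod ?b)\<^sup>2 * Re (g y y)" for t :: real
  proof -
    let ?l = "- of_real t * cnj ?b"
    have b: "?b * cnj ?b = of_real ((cmod ?b)\<^sup>2)"
      by (rule complex_norm_square[symmetric])
    have yx: "g y x = cnj ?b"
      by (rule psd_form_commute)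
    have "g (x + ?l *\<^sub>C y) (x + ?l *\<^sub>C y) = g x x - 2 * of_real t * (?b * cnj ?b)
        + of_real t * of_real t * (?b * cnj ?b) * g y y"
      by (simp add: psd_form_simps yx algebra_simps)
    also have "\<dots> = of_real (Re (g x x) - 2 * t * (cmod ?b)\<^sup>2 + t\<^sup>2 * (cmod ?b)\<^sup>2 * Re (g y y))"
      by (subst psd_form_self[of x], subst psd_form_self[of y]) (simp add: b power2_eq_square)
    finally show ?thesis
      using psd_form_nonneg[of "x + ?l *\<^sub>C y"] by simp
  qed
  show ?thesis
  proof (cases "Re (g y y) = 0")
    case True
    have "cmod ?b = 0"
    proof (rule ccontr)
      assume "cmod ?b \<noteq> 0"
      then have "(cmod ?b)\<^sup>2 > 0" by simp
      then show False
        using *[of "(Re (g x x) + 1) / (2 * (cmod ?b)\<^sup>2)"] True by (simp add: field_simps)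
    qed
    with True show ?thesis by simp
  next
    case False
    with psd_form_nonneg[of y] have "Re (g y y) > 0" by simp
    with *[of "1 / Re (g y y)"] show ?thesis
      by (simp add: field_simps power2_eq_square)
  qed
qed

lemma psd_form_triangle: "Re (g (x + y) (x + y)) \<le> 2 * (Re (g x x) + Re (g y y))"
  using psd_form_nonneg[of "x - y"] by (simp add: psd_form_simps)

end

lemma psd_form_norm_le:
  assumes g: "psd_form g" and C: "\<And>x. Re (g x x) \<le> C * (norm x)\<^sup>2" "C \<ge> 0"
  shows "cmod (g x y) \<le> C * norm x * norm y"
proof (rule power2_le_imp_le)
  have "(cmod (g x y))\<^sup>2 \<le> Re (g x x) * Re (g y y)"
    by (rule psd_form_Cauchy_Schwarz[OF g])
  also have "\<dots> \<le> (C * (norm x)\<^sup>2) * (C * (norm y)\<^sup>2)"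
    using C(2) by (intro mult_mono C psd_form_nonneg[OF g]) simp
  finally show "(cmod (g x y))\<^sup>2 \<le> (C * norm x * norm y)\<^sup>2"
    by (simp add: power2_eq_square mult_ac)
qed (use C(2) in simp)

lemma psd_form_cinner: "psd_form cinner"
  by (rule psd_formI)
    (auto simp: cinner_add_right cinner_scaleC_right inner_eq_Re_cinner[symmetric] intro: cinner_commute)

lemmas cinner_simps = psd_form_simps[OF psd_form_cinner]
lemmas cinner_sum_left = psd_form_sum_left[OF psd_form_cinner]
lemmas cinner_sum_right = psd_form_sum_right[OF psd_form_cinner]

lemma cinner_self: "cinner x x = complex_of_real ((norm x)\<^sup>2)"
  by (subst psd_form_self[OF psd_form_cinner]) (simp add: inner_eq_Re_cinner[symmetric] power2_norm_eq_inner)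

lemma Re_cinner_self: "Re (cinner x x) = (norm x)\<^sup>2"
  by (simp add: cinner_self)

lemma norm_scaleC: "norm (a *\<^sub>C x) = cmod a * norm x"
proof -
  have "cinner (a *\<^sub>C x) (a *\<^sub>C x) = (a * cnj a) * cinner x x"
    by (simp add: cinner_simps)
  also have "a * cnj a = of_real ((cmod a)\<^sup>2)"
    by (rule complex_norm_square[symmetric])
  finally have "(norm (a *\<^sub>C x))\<^sup>2 = (cmod a * norm x)\<^sup>2"
    unfolding cinner_self of_real_mult[symmetric] of_real_eq_iff by (simp add: power_mult_distrib)
  then show ?thesis by simp
qed

lemma norm_cinner_le: "cmod (cinner x y) \<le> norm x * norm y"
  using psd_form_Cauchy_Schwarz[OF psd_form_cinner, of x y]
  unfolding Re_cinner_self power_mult_distrib[symmetric] by (rule power2_le_imp_le) simp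

lemma bounded_bilinear_cinner: "bounded_bilinear (cinner :: 'a::complex_inner \<Rightarrow> 'a \<Rightarrow> complex)"
proof
  show "\<exists>K. \<forall>a b::'a. norm (cinner a b) \<le> norm a * norm b * K"
    using norm_cinner_le by (intro exI[of _ 1]) auto
qed (auto simp: cinner_simps scaleR_conv_of_real)

lemma bounded_bilinear_scaleC: "bounded_bilinear (scaleC :: complex \<Rightarrow> 'a::complex_inner \<Rightarrow> 'a)"
proof
  show "\<exists>K. \<forall>a (b::'a). norm (a *\<^sub>C b) \<le> norm a * norm b * K"
    by (intro exI[of _ 1]) (auto simp: norm_scaleC)
qed (auto simp: complex_vector.scale_left_distrib complex_vector.scale_right_distrib
      scaleR_conv_of_real scaleR_eq_scaleC[where ?'a = 'a])

lemmas tendsto_cinner = bounded_bilinear.tendsto[OF bounded_bilinear_cinner]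
lemmas tendsto_scaleC = bounded_bilinear.tendsto[OF bounded_bilinear_scaleC]
lemmas continuous_on_cinner = bounded_bilinear.continuous_on[OF bounded_bilinear_cinner]

lemma cinner_ext:
  assumes "\<And>x. cinner x y = cinner x z"
  shows "y = z"
proof -
  have "cinner (y - z) (y - z) = 0"
    using assms[of "y - z"] by (simp add: psd_form_diff_right[OF psd_form_cinner])
  then show ?thesis
    by (simp add: cinner_self)
qed

lemma scaleC_Pair: "a *\<^sub>C (x, y) = (a *\<^sub>C x, a *\<^sub>C y)"
  and cinner_Pair: "cinner (x, y) (x', y') = cinner x x' + cinner y y'"
  by (simp_all add: scaleC_prod_def cinner_prod_def)

lemma scaleR_scaleC_left_commute: "r *\<^sub>R a *\<^sub>C (x :: 'a::complex_inner) = a *\<^sub>C r *\<^sub>R x"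
  by (simp add: scaleR_eq_scaleC scaleC_scaleC mult.commute)

text \<open>The inner product is recovered from its real part because \<open>Im z = Re (- \<i> * z)\<close>.\<close>

lemma cinner_eqI_inner:
  assumes "inner x y = inner x' y'" and "inner (\<i> *\<^sub>C x) y = inner (\<i> *\<^sub>C x') y'"
  shows "cinner x y = cinner x' y'"
  using assms unfolding inner_eq_Re_cinner by (simp add: cinner_simps complex_eq_iff)

lemma clinear_onD:
  assumes "clinear_on S f"
  shows "\<And>x y. x \<in> S \<Longrightarrow> y \<in> S \<Longrightarrow> f (x + y) = f x + f y"
    and "\<And>a x. x \<in> S \<Longrightarrow> f (a *\<^sub>C x) = a *\<^sub>C f x"
  using assms unfolding clinear_on_def by auto

lemma clinear_on_more:
  assumes "clinear_on S f" "complex_vector.subspace S"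
  shows clinear_on_zero: "f 0 = 0"
    and clinear_on_diff: "\<And>x y. x \<in> S \<Longrightarrow> y \<in> S \<Longrightarrow> f (x - y) = f x - f y"
    and clinear_on_scaleR: "\<And>r x. x \<in> S \<Longrightarrow> f (r *\<^sub>R x) = r *\<^sub>R f x"
proof -
  note [simp] = clinear_onD[OF assms(1)] complex_vector.subspace_0[OF assms(2)]
    complex_vector.subspace_neg[OF assms(2)]
  show "f 0 = 0"
    using clinear_onD(2)[OF assms(1), of 0 0] by simp
  have m: "f (- x) = - f x" if "x \<in> S" for x
    using clinear_onD(2)[OF assms(1) that, of "-1"] by simp
  show "f (x - y) = f x - f y" if "x \<in> S" "y \<in> S" for x y
    using clinear_onD(1)[OF assms(1) that(1), of "- y"] that by (simp add: m)
  show "f (r *\<^sub>R x) = r *\<^sub>R f x" if "x \<in> S" for r x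
    using that by (simp add: scaleR_eq_scaleC)
qed

lemma clinear_on_sum:
  assumes "clinear_on S f" "complex_vector.subspace S" "\<And>i. i \<in> I \<Longrightarrow> u i \<in> S"
  shows "f (\<Sum>i\<in>I. u i) = (\<Sum>i\<in>I. f (u i))"
  using assms(3)
proof (induction I rule: infinite_finite_induct)
  case (insert i I)
  then show ?case
    by (simp add: clinear_onD(1)[OF assms(1)] complex_vector.subspace_sum[OF assms(2)])
qed (use clinear_on_zero[OF assms(1,2)] in simp_all)

lemma clinear_isometry_cinner:
  assumes "clinear_on S f" "complex_vector.subspace S" "\<And>x. x \<in> S \<Longrightarrow> norm (f x) = norm x"
    and "x \<in> S" "y \<in> S"
  shows "cinner (f x) (f y) = cinner x y"
proof -
  have *: "inner (f u) (f v) = inner u v" if "u \<in> S" "v \<in> S" for u v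
  proof -
    have "f u + f v = f (u + v)"
      using clinear_onD(1)[OF assms(1)] that by simp
    then show ?thesis
      using that assms(2,3) by (simp add: dot_norm complex_vector.subspace_add)
  qed
  show ?thesis
  proof (rule cinner_eqI_inner)
    have "\<i> *\<^sub>C f x = f (\<i> *\<^sub>C x)" "\<i> *\<^sub>C x \<in> S"
      using clinear_onD(2)[OF assms(1)] assms by (simp_all add: complex_vector.subspace_scale)
    then show "inner (\<i> *\<^sub>C f x) (f y) = inner (\<i> *\<^sub>C x) y"
      using *[of "\<i> *\<^sub>C x" y] assms by simp
  qed (use * assms in auto)
qed

lemma subspace_closure:
  assumes "complex_vector.subspace S"
  shows "complex_vector.subspace (closure S)"
  unfolding complex_vector.subspace_def
proof (intro conjI ballI allI)
  show "0 \<in> closure S"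
    using complex_vector.subspace_0[OF assms] closure_subset by blast
  show "x + y \<in> closure S" if xy: "x \<in> closure S" "y \<in> closure S" for x y
  proof -
    obtain u v where "\<And>n. u n \<in> S" "u \<longlonglongrightarrow> x" "\<And>n. v n \<in> S" "v \<longlonglongrightarrow> y"
      using xy unfolding closure_sequential by metis
    then show ?thesis
      unfolding closure_sequential
      by (intro exI[of _ "\<lambda>n. u n + v n"])
        (auto intro: tendsto_add complex_vector.subspace_add[OF assms])
  qed
  show "a *\<^sub>C x \<in> closure S" if x: "x \<in> closure S" for a x
  proof -
    obtain u where "\<And>n. u n \<in> S" "u \<longlonglongrightarrow> x"
      using x unfolding closure_sequential by metis
    then show ?thesis
      unfolding closure_sequential
      by (intro exI[of _ "\<lambda>n. a *\<^sub>C u n"])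
        (auto intro: tendsto_scaleC complex_vector.subspace_scale[OF assms])
  qed
qed

lemma clinear_extend_closure:
  fixes f :: "'a::complex_inner \<Rightarrow> 'b::chilbert_space"
  assumes S: "complex_vector.subspace S" and f: "clinear_on S f"
    and M: "\<And>x. x \<in> S \<Longrightarrow> norm (f x) \<le> M * norm x"
  obtains h where "clinear_on (closure S) h" "\<forall>x\<in>S. h x = f x"
    "continuous_on (closure S) h" "\<forall>x\<in>closure S. norm (h x) \<le> M * norm x"
proof -
  have "uniformly_continuous_on S f"
    unfolding uniformly_continuous_on_def
  proof (intro allI impI)
    fix e :: real assume "e > 0"
    have "dist (f x') (f x) < e" if "x \<in> S" "x' \<in> S" "dist x' x < e / (\<bar>M\<bar> + 1)" for x x'
    proof -
      have "dist (f x') (f x) = norm (f (x' - x))"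
        unfolding dist_norm by (subst clinear_on_diff[OF f S that(2,1)]) (rule refl)
      also have "\<dots> \<le> M * norm (x' - x)"
        using that by (intro M complex_vector.subspace_diff[OF S])
      also have "\<dots> \<le> (\<bar>M\<bar> + 1) * norm (x' - x)"
        by (intro mult_right_mono) auto
      also have "\<dots> < e"
        using that(3) by (simp add: dist_norm field_simps)
      finally show ?thesis .
    qed
    then show "\<exists>d>0. \<forall>x\<in>S. \<forall>x'\<in>S. dist x' x < d \<longrightarrow> dist (f x') (f x) < e"
      using \<open>e > 0\<close> by (intro exI[of _ "e / (\<bar>M\<bar> + 1)"]) auto
  qed
  then obtain h where uc: "uniformly_continuous_on (closure S) h" and h: "\<And>x. x \<in> S \<Longrightarrow> f x = h x"
  proof (rule uniformly_continuous_on_extension_on_closure)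
    fix h assume "uniformly_continuous_on (closure S) h" "\<And>x. x \<in> S \<Longrightarrow> f x = h x"
    then show thesis by (rule that)
  qed
  have cont: "continuous_on (closure S) h"
    by (rule uniformly_continuous_imp_continuous[OF uc])
  have lim: "(\<lambda>n. f (u n)) \<longlonglongrightarrow> h x" if "\<And>n. u n \<in> S" "u \<longlonglongrightarrow> x" "x \<in> closure S" for u x
  proof -
    have "(\<lambda>n. h (u n)) \<longlonglongrightarrow> h x"
      using subsetD[OF closure_subset that(1)]
      by (intro continuous_on_tendsto_compose[OF cont that(2,3)] always_eventually allI)
    then show ?thesis unfolding h[OF that(1)] .
  qed
  have "clinear_on (closure S) h"
    unfolding clinear_on_def
  proof (intro conjI ballI allI)
    show "h (x + y) = h x + h y" if xy: "x \<in> closure S" "y \<in> closure S" for x y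
    proof -
      obtain u v where uv: "\<And>n. u n \<in> S" "u \<longlonglongrightarrow> x" "\<And>n. v n \<in> S" "v \<longlonglongrightarrow> y"
        using xy unfolding closure_sequential by metis
      have "(\<lambda>n. f (u n + v n)) \<longlonglongrightarrow> h (x + y)"
        using uv xy S
        by (intro lim tendsto_add complex_vector.subspace_add subspace_closure) auto
      moreover have "(\<lambda>n. f (u n + v n)) \<longlonglongrightarrow> h x + h y"
        unfolding clinear_onD(1)[OF f uv(1,3)] using uv xy by (intro tendsto_add lim) auto
      ultimately show ?thesis by (rule LIMSEQ_unique)
    qed
    show "h (a *\<^sub>C x) = a *\<^sub>C h x" if x: "x \<in> closure S" for a x
    proof -
      obtain u where u: "\<And>n. u n \<in> S" "u \<longlonglongrightarrow> x"
        using x unfolding closure_sequential by metis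
      have "(\<lambda>n. f (a *\<^sub>C u n)) \<longlonglongrightarrow> h (a *\<^sub>C x)"
        using u x S
        by (intro lim tendsto_scaleC tendsto_const complex_vector.subspace_scale subspace_closure) auto
      moreover have "(\<lambda>n. f (a *\<^sub>C u n)) \<longlonglongrightarrow> a *\<^sub>C h x"
        unfolding clinear_onD(2)[OF f u(1)] using u x
        by (intro tendsto_scaleC tendsto_const lim) auto
      ultimately show ?thesis by (rule LIMSEQ_unique)
    qed
  qed
  moreover have "norm (h x) \<le> M * norm x" if x: "x \<in> closure S" for x
  proof -
    obtain u where u: "\<And>n. u n \<in> S" "u \<longlonglongrightarrow> x"
      using x unfolding closure_sequential by metis
    show ?thesis
    proof (rule LIMSEQ_le)
      show "(\<lambda>n. norm (f (u n))) \<longlonglongrightarrow> norm (h x)"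
        using u x by (intro tendsto_norm lim)
      show "(\<lambda>n. M * norm (u n)) \<longlonglongrightarrow> M * norm x"
        using u by (intro tendsto_mult tendsto_const tendsto_norm)
    qed (use M u in auto)
  qed
  ultimately show ?thesis
    by (intro that[of h] cont ballI h[symmetric])
qed

section \<open>Riesz representation and adjoints\<close>

text \<open>
  The representing vector minimizes \<open>(norm y)\<^sup>2 - 2 * \<phi> y\<close> on the subspace: by the parallelogram law
  every minimizing sequence is Cauchy, and the derivative at the minimum in direction \<open>y\<close> is
  \<open>2 * (inner w y - \<phi> y)\<close>.
\<close>

lemma riesz_real:
  fixes S :: "'a::chilbert_space set"
  assumes S: "hilbert_subspace S"
    and add: "\<And>x y. x \<in> S \<Longrightarrow> y \<in> S \<Longrightarrow> \<phi> (x + y) = \<phi> x + \<phi> y"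
    and scale: "\<And>r x. x \<in> S \<Longrightarrow> \<phi> (r *\<^sub>R x) = r * \<phi> x"
    and bound: "\<And>x. x \<in> S \<Longrightarrow> \<bar>\<phi> x\<bar> \<le> M * norm x"
  obtains w where "w \<in> S" "\<And>y. y \<in> S \<Longrightarrow> \<phi> y = inner w y"
proof -
  have sub: "complex_vector.subspace S" and cl: "closed S"
    using S by (simp_all add: hilbert_subspace_iff)
  have scR: "r *\<^sub>R x \<in> S" if "x \<in> S" for r x
    using complex_vector.subspace_scale[OF sub that] by (simp add: scaleR_eq_scaleC)
  have plus: "x + y \<in> S" if "x \<in> S" "y \<in> S" for x y
    using complex_vector.subspace_add[OF sub that] .
  have diff: "\<phi> (x - y) = \<phi> x - \<phi> y" if "x \<in> S" "y \<in> S" for x y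
    using add[OF that(1) scR[OF that(2), of "-1"]] scale[OF that(2), of "-1"] by simp
  define J where "J y = (norm y)\<^sup>2 - 2 * \<phi> y" for y
  have J_bound: "- M\<^sup>2 \<le> J y" if "y \<in> S" for y
  proof -
    have "0 \<le> (norm y - M)\<^sup>2" by simp
    then have "2 * (M * norm y) - M\<^sup>2 \<le> (norm y)\<^sup>2"
      by (simp add: power2_diff algebra_simps)
    then show ?thesis
      using bound[OF that] unfolding J_def by linarith
  qed
  have bdd: "bdd_below (J ` S)"
    using J_bound by (intro bdd_belowI[of _ "- M\<^sup>2"]) blast
  have ne: "J ` S \<noteq> {}"
    using complex_vector.subspace_0[OF sub] by blast
  define m where "m = Inf (J ` S)"
  have m: "m \<le> J y" if "y \<in> S" for y
    unfolding m_def by (rule cInf_lower[OF imageI[OF that] bdd])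
  have "\<exists>y\<in>S. J y < m + inverse (real (Suc n))" for n
  proof -
    have "Inf (J ` S) < m + inverse (real (Suc n))"
      unfolding m_def by simp
    then show ?thesis
      using cInf_less_iff[OF ne bdd] by auto
  qed
  then obtain u where uS: "\<And>n. u n \<in> S" and u: "\<And>n. J (u n) < m + inverse (real (Suc n))"
    by metis
  have par: "(norm (y - z))\<^sup>2 \<le> 2 * J y + 2 * J z - 4 * m" if "y \<in> S" "z \<in> S" for y z
  proof -
    have "\<phi> ((1/2) *\<^sub>R (y + z)) = (\<phi> y + \<phi> z) / 2"
      using that scale[OF plus[OF that], of "1/2"] by (simp add: add)
    moreover have "(norm (y - z))\<^sup>2 + (norm (y + z))\<^sup>2 = 2 * (norm y)\<^sup>2 + 2 * (norm z)\<^sup>2"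
      by (simp add: power2_norm_eq_inner inner_add inner_diff inner_commute)
    moreover have "(norm ((1/2) *\<^sub>R (y + z)))\<^sup>2 = (norm (y + z))\<^sup>2 / 4"
      by (simp add: power_divide)
    ultimately have "(norm (y - z))\<^sup>2 = 2 * J y + 2 * J z - 4 * J ((1/2) *\<^sub>R (y + z))"
      unfolding J_def by simp
    moreover have "m \<le> J ((1/2) *\<^sub>R (y + z))"
      by (intro m scR plus that)
    ultimately show ?thesis by linarith
  qed
  have "Cauchy u"
  proof (rule metric_CauchyI)
    fix e :: real assume "e > 0"
    then have "e\<^sup>2 / 4 > 0" by simp
    then obtain N where N: "inverse (real (Suc N)) < e\<^sup>2 / 4"
      using reals_Archimedean by blast
    have "dist (u p) (u q) < e" if "p \<ge> N" "q \<ge> N" for p q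
    proof -
      have *: "J (u k) < m + e\<^sup>2 / 4" if "k \<ge> N" for k
      proof -
        have "inverse (real (Suc k)) \<le> inverse (real (Suc N))"
          using that by (intro le_imp_inverse_le) auto
        then show ?thesis using u[of k] N by linarith
      qed
      have "(norm (u p - u q))\<^sup>2 < e\<^sup>2"
        using par[OF uS uS, of p q] *[OF that(1)] *[OF that(2)] by linarith
      then show ?thesis
        using \<open>e > 0\<close> by (simp add: dist_norm power2_less_imp_less)
    qed
    then show "\<exists>N. \<forall>p\<ge>N. \<forall>q\<ge>N. dist (u p) (u q) < e" by blast
  qed
  then obtain w where w: "u \<longlonglongrightarrow> w"
    using Cauchy_convergent convergent_def by blast
  have wS: "w \<in> S"
    using cl uS w closed_sequentially by blast
  have "(\<lambda>n. \<phi> (u n) - \<phi> w) \<longlonglongrightarrow> 0"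
  proof (rule Lim_null_comparison)
    have "norm (\<phi> (u n) - \<phi> w) \<le> M * norm (u n - w)" for n
      using bound[OF complex_vector.subspace_diff[OF sub uS wS]] by (simp add: diff uS wS)
    then show "\<forall>\<^sub>F n in sequentially. norm (\<phi> (u n) - \<phi> w) \<le> M * norm (u n - w)"
      by simp
    have "(\<lambda>n. M * norm (u n - w)) \<longlonglongrightarrow> M * norm (w - w)"
      by (intro tendsto_intros w)
    then show "(\<lambda>n. M * norm (u n - w)) \<longlonglongrightarrow> 0" by simp
  qed
  then have "(\<lambda>n. \<phi> (u n)) \<longlonglongrightarrow> \<phi> w"
    by (simp add: LIM_zero_iff)
  then have Jlim: "(\<lambda>n. J (u n)) \<longlonglongrightarrow> J w"
    unfolding J_def by (intro tendsto_intros w)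
  have "J w \<le> m + 0"
  proof (rule LIMSEQ_le[OF Jlim])
    show "(\<lambda>n. m + inverse (real (Suc n))) \<longlonglongrightarrow> m + 0"
      by (intro tendsto_intros LIMSEQ_inverse_real_of_nat)
  qed (use u less_imp_le in blast)
  then have Jw: "J w \<le> J y" if "y \<in> S" for y
    using m[OF that] by linarith
  have "\<phi> y = inner w y" if y: "y \<in> S" for y
  proof -
    define b where "b = inner w y - \<phi> y"
    have *: "0 \<le> 2 * t * b + t\<^sup>2 * (norm y)\<^sup>2" for t
    proof -
      have "J (w + t *\<^sub>R y) = J w + 2 * t * b + t\<^sup>2 * (norm y)\<^sup>2"
        using wS scR[OF y, of t] scale[OF y, of t] unfolding J_def b_def
        by (simp add: add power2_norm_eq_inner inner_add_left inner_add_right inner_commute[of y w]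
            algebra_simps power2_eq_square[of t])
      then show ?thesis
        using Jw[OF plus[OF wS scR[OF y]], of t] by linarith
    qed
    have "b = 0"
    proof (rule ccontr)
      assume "b \<noteq> 0"
      \<comment> \<open>At \<open>t = - b / p\<close> the quadratic polynomial is negative, also in the case \<open>y = 0\<close>.\<close>
      define p where "p = (norm y)\<^sup>2 + 1"
      have p: "p > 0" "(norm y)\<^sup>2 = p - 1"
        by (simp_all add: p_def add_nonneg_pos)
      have "2 * (- b / p) * b + (- b / p)\<^sup>2 * (p - 1) = - (b\<^sup>2 / p) - (b / p)\<^sup>2"
        using p(1) by (simp add: field_simps power2_eq_square)
      moreover have "b\<^sup>2 / p > 0"
        using p(1) \<open>b \<noteq> 0\<close> by simp
      moreover have "(b / p)\<^sup>2 \<ge> 0" by simp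
      ultimately show False
        using *[of "- b / p"] unfolding p(2) by linarith
    qed
    then show ?thesis unfolding b_def by simp
  qed
  with wS show ?thesis by (rule that)
qed

lemma riesz_complex:
  fixes S :: "'a::chilbert_space set"
  assumes S: "hilbert_subspace S"
    and add: "\<And>x y. x \<in> S \<Longrightarrow> y \<in> S \<Longrightarrow> \<phi> (x + y) = \<phi> x + \<phi> y"
    and scale: "\<And>a x. x \<in> S \<Longrightarrow> \<phi> (a *\<^sub>C x) = a * \<phi> x"
    and bound: "\<And>x. x \<in> S \<Longrightarrow> cmod (\<phi> x) \<le> M * norm x"
  obtains w where "w \<in> S" "\<And>y. y \<in> S \<Longrightarrow> \<phi> y = cinner w y"
proof -
  obtain w where wS: "w \<in> S" and w: "\<And>y. y \<in> S \<Longrightarrow> Re (\<phi> y) = inner w y"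
  proof (rule riesz_real[OF S, of "\<lambda>x. Re (\<phi> x)" M])
    show "\<bar>Re (\<phi> x)\<bar> \<le> M * norm x" if "x \<in> S" for x
      using abs_Re_le_cmod[of "\<phi> x"] bound[OF that] by linarith
  qed (simp_all add: add scale scaleR_eq_scaleC)
  have "\<phi> y = cinner w y" if y: "y \<in> S" for y
  proof (rule complex_eqI)
    show "Re (\<phi> y) = Re (cinner w y)"
      using w[OF y] by (simp add: inner_eq_Re_cinner)
    have "\<i> *\<^sub>C y \<in> S"
      using S y by (simp add: hilbert_subspace_def)
    from w[OF this] show "Im (\<phi> y) = Im (cinner w y)"
      by (simp add: scale[OF y] inner_eq_Re_cinner cinner_scaleC_right)
  qed
  with wS show ?thesis by (rule that)
qed

lemma hilbert_subspace_UNIV: "hilbert_subspace UNIV"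
  by (simp add: hilbert_subspace_def)

lemma bounded_opD:
  assumes "bounded_op A"
  shows bounded_op_add: "A (x + y) = A x + A y"
    and bounded_op_scaleC: "A (a *\<^sub>C x) = a *\<^sub>C A x"
    and bounded_op_bounded_linear: "bounded_linear A"
  using assms unfolding bounded_op_iff_bounded_linear
  by (auto simp: bounded_linear.linear linear_add)

lemma bounded_op_bound:
  assumes "bounded_op A"
  obtains M where "M > 0" "\<And>x. norm (A x) \<le> M * norm x"
  using bounded_linear.pos_bounded[OF bounded_op_bounded_linear[OF assms]] by (metis mult.commute)

text \<open>The constant \<^const>\<open>cadjoint\<close> is a choice; Riesz representation supplies something to choose.\<close>

lemma cadjoint:
  fixes A :: "'a::chilbert_space \<Rightarrow> 'a"
  assumes A: "bounded_op A"
  shows "cinner (A x) y = cinner x (cadjoint A y)"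
proof -
  obtain M where M: "\<And>x. norm (A x) \<le> M * norm x"
    using bounded_op_bound[OF A] by blast
  have "\<exists>w. \<forall>x. cinner y (A x) = cinner w x" for y
  proof (rule riesz_complex[OF hilbert_subspace_UNIV, of "\<lambda>x. cinner y (A x)" "norm y * M"])
    show "cmod (cinner y (A x)) \<le> norm y * M * norm x" for x
      using norm_cinner_le[of y "A x"] mult_left_mono[OF M, of "norm y" x] by (simp add: mult.assoc)
  qed (auto simp: bounded_opD[OF A] cinner_simps)
  then obtain A' where A': "\<And>x y. cinner y (A x) = cinner (A' y) x"
    by metis
  have "cinner (A x) y = cinner x (A' y)" for x y
    by (subst (1 2) cinner_commute) (simp add: A')
  then have "\<exists>A'. \<forall>x y. cinner (A x) y = cinner x (A' y)"
    by blast
  from someI_ex[OF this] show ?thesis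
    unfolding cadjoint_def by blast
qed

lemma orthogonal_projection:
  fixes S :: "'a::chilbert_space set"
  assumes "hilbert_subspace S"
  obtains p where "p \<in> S" "\<And>y. y \<in> S \<Longrightarrow> cinner (x - p) y = 0"
proof (rule riesz_complex[OF assms, of "cinner x" "norm x"])
  fix w assume "w \<in> S" "\<And>y. y \<in> S \<Longrightarrow> cinner x y = cinner w y"
  then show thesis
    by (intro that[of w]) (simp_all add: cinner_simps)
qed (auto simp: cinner_simps norm_cinner_le)

section \<open>Orthonormal bases\<close>

definition orthonormal :: "'a::complex_inner set \<Rightarrow> bool" where
  "orthonormal E \<longleftrightarrow> (\<forall>e\<in>E. \<forall>f\<in>E. cinner e f = (if e = f then 1 else 0))"

lemma orthonormal_cinner_sum:
  assumes "orthonormal E" "finite F" "F \<subseteq> E" "e \<in> E"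
  shows "cinner e (\<Sum>f\<in>F. u f *\<^sub>C f) = (if e \<in> F then u e else 0)"
proof -
  have "cinner e (\<Sum>f\<in>F. u f *\<^sub>C f) = (\<Sum>f\<in>F. if f = e then u f else 0)"
    unfolding cinner_sum_right using assms unfolding orthonormal_def
    by (intro sum.cong) (auto simp: cinner_simps)
  then show ?thesis
    using assms(2) by simp
qed

lemma orthonormal_independent:
  assumes "orthonormal E"
  shows "complex_vector.independent E"
  unfolding complex_vector.independent_explicit_finite_subsets
proof (intro allI impI ballI)
  fix F u v assume *: "F \<subseteq> E" "finite F" "(\<Sum>f\<in>F. u f *\<^sub>C f) = 0" "v \<in> F"
  then have "cinner v (\<Sum>f\<in>F. u f *\<^sub>C f) = u v"
    by (subst orthonormal_cinner_sum[OF assms]) auto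
  with * show "u v = 0"
    by (simp add: cinner_simps)
qed

text \<open>
  The subspace need not be closed: the two kinds of bases below come from a closed subspace and from
  a subspace of finite dimension.
\<close>

lemma maximal_orthonormal_subset:
  assumes S: "complex_vector.subspace S"
  obtains E where "E \<subseteq> S" "orthonormal E" "\<And>x. x \<in> S \<Longrightarrow> (\<And>e. e \<in> E \<Longrightarrow> cinner e x = 0) \<Longrightarrow> x = 0"
proof -
  let ?A = "{E. E \<subseteq> S \<and> orthonormal E}"
  have "\<exists>M\<in>?A. \<forall>X\<in>?A. M \<subseteq> X \<longrightarrow> X = M"
  proof (rule subset_Zorn')
    fix C assume C: "subset.chain ?A C"
    have "cinner e f = (if e = f then 1 else 0)" if ef: "e \<in> \<Union>C" "f \<in> \<Union>C" for e f
    proof -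
      obtain X Y where XY: "X \<in> C" "e \<in> X" "Y \<in> C" "f \<in> Y"
        using ef by blast
      have "X \<subseteq> Y \<or> Y \<subseteq> X"
        using C XY unfolding subset.chain_def by blast
      then obtain Z where "Z \<in> C" "e \<in> Z" "f \<in> Z"
        using XY by blast
      moreover have "orthonormal Z"
        using C \<open>Z \<in> C\<close> unfolding subset.chain_def by blast
      ultimately show ?thesis
        unfolding orthonormal_def by blast
    qed
    moreover have "\<Union>C \<subseteq> S"
      using C unfolding subset.chain_def by blast
    ultimately show "\<Union>C \<in> ?A"
      unfolding orthonormal_def by simp
  qed
  then obtain E where E: "E \<subseteq> S" "orthonormal E"
    and max: "\<And>X. X \<subseteq> S \<Longrightarrow> orthonormal X \<Longrightarrow> E \<subseteq> X \<Longrightarrow> X = E"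
    by auto
  have "x = 0" if x: "x \<in> S" and orth: "\<And>e. e \<in> E \<Longrightarrow> cinner e x = 0" for x
  proof (rule ccontr)
    assume "x \<noteq> 0"
    define f where "f = (1 / of_real (norm x)) *\<^sub>C x"
    have ff: "cinner f f = 1"
      using \<open>x \<noteq> 0\<close> unfolding cinner_self f_def norm_scaleC by (simp add: norm_divide)
    have ef: "cinner e f = 0" if "e \<in> E" for e
      using orth[OF that] by (simp add: f_def cinner_simps)
    have fe: "cinner f e = 0" if "e \<in> E" for e
      using ef[OF that] by (subst cinner_commute) simp
    have "orthonormal (insert f E)"
      using E(2) ff ef fe unfolding orthonormal_def by auto
    moreover have "f \<in> S"
      unfolding f_def by (rule complex_vector.subspace_scale[OF S x])
    ultimately have "insert f E = E"
      using E(1) by (intro max) auto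
    then have "f \<in> E" by blast
    from ef[OF this] ff show False by simp
  qed
  with E show ?thesis by (rule that)
qed

lemma hilbert_basis_exists:
  fixes S :: "'a::chilbert_space set"
  assumes S: "hilbert_subspace S"
  obtains E where "orthonormal E" "closure (complex_vector.span E) = S"
proof -
  have sub: "complex_vector.subspace S" and cl: "closed S"
    using S by (simp_all add: hilbert_subspace_iff)
  obtain E where E: "E \<subseteq> S" "orthonormal E"
    and max: "\<And>x. x \<in> S \<Longrightarrow> (\<And>e. e \<in> E \<Longrightarrow> cinner e x = 0) \<Longrightarrow> x = 0"
    by (rule maximal_orthonormal_subset[OF sub]) blast
  let ?W = "closure (complex_vector.span E)"
  have W: "hilbert_subspace ?W"
    by (simp add: hilbert_subspace_iff subspace_closure complex_vector.subspace_span)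
  have sub_W: "?W \<subseteq> S"
    using E(1) by (intro closure_minimal cl complex_vector.span_minimal sub)
  have "x \<in> ?W" if x: "x \<in> S" for x
  proof -
    obtain p where p: "p \<in> ?W" "\<And>y. y \<in> ?W \<Longrightarrow> cinner (x - p) y = 0"
      using orthogonal_projection[OF W] by blast
    have "cinner e (x - p) = 0" if "e \<in> E" for e
    proof -
      have "e \<in> ?W"
        using complex_vector.span_base[OF that] closure_subset by blast
      from p(2)[OF this] show ?thesis
        by (subst cinner_commute) simp
    qed
    then have "x - p = 0"
      using p(1) sub_W x by (intro max complex_vector.subspace_diff[OF sub]) auto
    with p(1) show ?thesis by simp
  qed
  with sub_W E(2) show ?thesis
    by (intro that[of E]) auto
qed

lemma finite_orthonormal_basis_exists:
  assumes S: "complex_vector.subspace S" and T: "finite T" "S \<subseteq> complex_vector.span T"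
  obtains E where "finite E" "E \<subseteq> S" "orthonormal E" "\<forall>x\<in>S. x = (\<Sum>e\<in>E. cinner e x *\<^sub>C e)"
proof -
  obtain E where E: "E \<subseteq> S" "orthonormal E"
    and max: "\<And>x. x \<in> S \<Longrightarrow> (\<And>e. e \<in> E \<Longrightarrow> cinner e x = 0) \<Longrightarrow> x = 0"
    by (rule maximal_orthonormal_subset[OF S]) blast
  have fin: "finite E"
    using complex_vector.independent_span_bound[OF T(1) orthonormal_independent[OF E(2)]] E(1) T(2)
    by blast
  have "x - (\<Sum>e\<in>E. cinner e x *\<^sub>C e) = 0" if x: "x \<in> S" for x
  proof (rule max)
    show "x - (\<Sum>e\<in>E. cinner e x *\<^sub>C e) \<in> S"
      using E(1) x
      by (intro complex_vector.subspace_diff complex_vector.subspace_sum complex_vector.subspace_scale S)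
        auto
    show "cinner e (x - (\<Sum>e\<in>E. cinner e x *\<^sub>C e)) = 0" if "e \<in> E" for e
      using that by (simp add: cinner_simps orthonormal_cinner_sum[OF E(2) fin order_refl])
  qed
  with fin E show ?thesis
    by (intro that[of E]) auto
qed

lemma subspace_kernel_cinner: "complex_vector.subspace {y. cinner x y = 0}"
  by (simp add: complex_vector.subspace_def cinner_simps)

lemma cinner_eq_0_closure_span:
  assumes "\<And>t. t \<in> T \<Longrightarrow> cinner x t = 0" "y \<in> closure (complex_vector.span T)"
  shows "cinner x y = 0"
proof -
  have "closed {y. cinner x y = 0}"
    by (intro closed_Collect_eq continuous_on_cinner continuous_on_const continuous_on_id)
  then have "closure (complex_vector.span T) \<subseteq> {y. cinner x y = 0}"
    using assms(1)
    by (intro closure_minimal complex_vector.span_minimal subspace_kernel_cinner) auto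
  with assms(2) show ?thesis by blast
qed

text \<open>
  A vector is the limit of a sequence of finite combinations of basis vectors, so only countably
  many basis vectors fail to be orthogonal to it.
\<close>

lemma countable_non_orthogonal:
  assumes E: "orthonormal E" and x: "x \<in> closure (complex_vector.span E)"
  shows "countable {e \<in> E. cinner e x \<noteq> 0}"
proof -
  obtain u where u: "\<And>n. u n \<in> complex_vector.span E" "u \<longlonglongrightarrow> x"
    using x unfolding closure_sequential by metis
  have "\<exists>F. finite F \<and> F \<subseteq> E \<and> u n \<in> complex_vector.span F" for n
    using u(1)[of n] unfolding complex_vector.span_explicit by blast
  then obtain F where F: "\<And>n. finite (F n)" "\<And>n. F n \<subseteq> E" "\<And>n. u n \<in> complex_vector.span (F n)"
    by metis
  have "e \<in> (\<Union>n. F n)" if e: "e \<in> E" "cinner e x \<noteq> 0" for e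
  proof (rule ccontr)
    assume notin: "e \<notin> (\<Union>n. F n)"
    have "cinner e (u n) = 0" for n
    proof (rule cinner_eq_0_closure_span)
      show "u n \<in> closure (complex_vector.span (F n))"
        by (rule subsetD[OF closure_subset F(3)])
      show "cinner e f = 0" if "f \<in> F n" for f
      proof -
        have "f \<in> E" "f \<noteq> e"
          using that F(2) notin by auto
        then show ?thesis
          using E e(1) unfolding orthonormal_def by simp
      qed
    qed
    moreover have "(\<lambda>n. cinner e (u n)) \<longlonglongrightarrow> cinner e x"
      by (intro tendsto_cinner tendsto_const u)
    ultimately have "cinner e x = 0"
      by (simp add: LIMSEQ_const_iff)
    with e(2) show False by blast
  qed
  then have "{e \<in> E. cinner e x \<noteq> 0} \<subseteq> (\<Union>n. F n)"
    by blast
  moreover have "countable (\<Union>n. F n)"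
    using F(1) by (simp add: countable_finite)
  ultimately show ?thesis
    by (rule countable_subset)
qed

context
  includes cardinal_syntax
begin

text \<open>
  Every element of \<open>E\<close> is non-orthogonal to some element of \<open>T\<close>, and each element of \<open>T\<close> accounts for
  countably many elements of \<open>E\<close>.
\<close>

lemma card_hilbert_basis_le:
  assumes E: "orthonormal E"
    and ET: "closure (complex_vector.span E) = closure (complex_vector.span T)"
    and inf: "infinite B" and card: "|T| \<le>o |B|"
  shows "|E| \<le>o |B|"
proof -
  let ?N = "\<lambda>t. {e \<in> E. cinner e t \<noteq> 0}"
  have "E \<subseteq> (\<Union>t\<in>T. ?N t)"
  proof
    fix e assume e: "e \<in> E"
    show "e \<in> (\<Union>t\<in>T. ?N t)"
    proof (rule ccontr)
      assume "e \<notin> (\<Union>t\<in>T. ?N t)"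
      then have "\<And>t. t \<in> T \<Longrightarrow> cinner e t = 0"
        using e by blast
      moreover have "e \<in> closure (complex_vector.span T)"
        using ET complex_vector.span_base[OF e] closure_subset by blast
      ultimately have "cinner e e = 0"
        by (rule cinner_eq_0_closure_span)
      with E e show False
        unfolding orthonormal_def by simp
    qed
  qed
  then have "|E| \<le>o |\<Union>t\<in>T. ?N t|"
    by (rule card_of_mono1)
  also have "|\<Union>t\<in>T. ?N t| \<le>o |B|"
  proof (rule card_of_UNION_ordLeq_infinite[OF inf card], intro ballI)
    fix t assume t: "t \<in> T"
    have "countable (?N t)"
      using complex_vector.span_base[OF t] closure_subset ET
      by (intro countable_non_orthogonal[OF E]) blast
    then have "|?N t| \<le>o |UNIV :: nat set|"
      unfolding countable_def by (auto simp: card_of_ordLeq[symmetric])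
    also have "|UNIV :: nat set| \<le>o |B|"
      using inf infinite_iff_card_of_nat by blast
    finally show "|?N t| \<le>o |B|" .
  qed
  finally show ?thesis .
qed

end

lemma isometry_of_hilbert_bases:
  fixes E :: "'a::complex_inner set" and E' :: "'b::chilbert_space set"
  assumes E: "orthonormal E" and E': "orthonormal E'" and j: "inj_on j E" "j ` E \<subseteq> E'"
  obtains h :: "'a \<Rightarrow> 'b" where "clinear_on (closure (complex_vector.span E)) h"
    "\<forall>x\<in>closure (complex_vector.span E). norm (h x) = norm x"
proof -
  let ?S = "complex_vector.span E"
  define f where "f = complex_vector.construct E j"
  have lin: "Vector_Spaces.linear scaleC scaleC f"
    unfolding f_def by (rule complex_vector.linear_construct[OF orthonormal_independent[OF E]])
  interpret f: Vector_Spaces.linear scaleC scaleC f by (rule lin)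
  have fj: "f e = j e" if "e \<in> E" for e
    unfolding f_def by (rule complex_vector.construct_basis[OF orthonormal_independent[OF E] that])
  have base: "cinner (f e) (f e') = cinner e e'" if "e \<in> E" "e' \<in> E" for e e'
  proof -
    have "j e \<in> E'" "j e' \<in> E'" "j e = j e' \<longleftrightarrow> e = e'"
      using that j by (auto simp: inj_on_eq_iff)
    then show ?thesis
      using that E E' unfolding orthonormal_def by (simp add: fj)
  qed
  have sub1: "complex_vector.subspace {y. cinner (f x) (f y) = cinner x y}" for x
    by (auto simp: complex_vector.subspace_def cinner_simps f.add f.scale)
  have sub2: "complex_vector.subspace {x. cinner (f x) (f y) = cinner x y}" for y
    by (auto simp: complex_vector.subspace_def cinner_simps f.add f.scale)
  have "?S \<subseteq> {y. cinner (f e) (f y) = cinner e y}" if "e \<in> E" for e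
    using base[OF that] by (intro complex_vector.span_minimal sub1) auto
  then have "?S \<subseteq> {x. cinner (f x) (f y) = cinner x y}" if "y \<in> ?S" for y
    using that by (intro complex_vector.span_minimal sub2) auto
  then have iso: "norm (f x) = norm x" if "x \<in> ?S" for x
    using that by (simp add: norm_eq_sqrt_inner inner_eq_Re_cinner subset_eq)
  have lin_f: "clinear_on ?S f"
    unfolding clinear_on_def by (auto simp: f.add f.scale)
  have bound: "norm (f x) \<le> 1 * norm x" if "x \<in> ?S" for x
    by (simp add: iso[OF that])
  obtain h where lin_h: "clinear_on (closure ?S) h" and h: "\<forall>x\<in>?S. h x = f x"
    and cont: "continuous_on (closure ?S) h" and "\<forall>x\<in>closure ?S. norm (h x) \<le> 1 * norm x"
    by (rule clinear_extend_closure[OF complex_vector.subspace_span lin_f bound])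
  have "norm (h x) = norm x" if x: "x \<in> closure ?S" for x
  proof -
    have "norm (h x) - norm x = 0"
    proof (rule continuous_constant_on_closure[OF _ _ x])
      show "continuous_on (closure ?S) (\<lambda>x. norm (h x) - norm x)"
        by (intro continuous_intros cont)
    qed (simp add: h iso)
    then show ?thesis by simp
  qed
  then show ?thesis
    by (intro that[of h] lin_h ballI)
qed

section \<open>Compressing the model space into the given space\<close>

lemma subspace_range:
  assumes "clinear_on UNIV f"
  shows "complex_vector.subspace (range f)"
proof (rule complex_vector.subspaceI)
  note f = clinear_onD[OF assms UNIV_I]
  show "0 \<in> range f"
    using clinear_on_zero[OF assms complex_vector.subspace_UNIV] by (metis rangeI)
  show "x + y \<in> range f" if xy: "x \<in> range f" "y \<in> range f" for x y
  proof -
    obtain u v where "x = f u" "y = f v"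
      using xy by blast
    then have "x + y = f (u + v)"
      by (simp add: f)
    then show ?thesis by simp
  qed
  show "s *\<^sub>C x \<in> range f" if x: "x \<in> range f" for s x
  proof -
    obtain u where "x = f u"
      using x by blast
    then have "s *\<^sub>C x = f (s *\<^sub>C u)"
      by (simp add: f)
    then show ?thesis by simp
  qed
qed

lemma image_span_subset:
  assumes f: "clinear_on UNIV f"
  shows "f ` complex_vector.span T \<subseteq> complex_vector.span (f ` T)"
proof -
  note lin = clinear_onD[OF f UNIV_I]
  have "complex_vector.span T \<subseteq> {x. f x \<in> complex_vector.span (f ` T)}"
  proof (rule complex_vector.span_minimal)
    show "complex_vector.subspace {x. f x \<in> complex_vector.span (f ` T)}"
      using lin clinear_on_zero[OF f complex_vector.subspace_UNIV]
      by (auto simp: complex_vector.subspace_def complex_vector.span_zero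
          complex_vector.span_add complex_vector.span_scale)
  qed (auto intro: complex_vector.span_base)
  then show ?thesis
    by blast
qed

lemma range_subset_span:
  assumes "clinear_on UNIV f" "complex_vector.span T = UNIV"
  shows "range f \<subseteq> complex_vector.span (f ` T)"
  using image_span_subset[OF assms(1), of T] unfolding assms(2) .

lemma range_subset_closure_span:
  fixes f :: "'a::complex_inner \<Rightarrow> 'b::complex_inner"
  assumes f: "clinear_on UNIV f" "continuous_on UNIV f" and T: "closure (complex_vector.span T) = UNIV"
  shows "range f \<subseteq> closure (complex_vector.span (f ` T))"
proof -
  have "f ` complex_vector.span T \<subseteq> closure (complex_vector.span (f ` T))"
    by (rule subset_trans[OF image_span_subset[OF f(1)] closure_subset])
  then have "f ` closure (complex_vector.span T) \<subseteq> closure (complex_vector.span (f ` T))"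
    by (intro image_closure_subset) (use f(2) T in auto)
  then show ?thesis
    unfolding T .
qed

lemma finite_orthonormal_span_closed:
  assumes E: "orthonormal E" "finite E" and x: "x \<in> closure (complex_vector.span E)"
  shows "x \<in> complex_vector.span E"
proof -
  let ?p = "\<Sum>e\<in>E. cinner e x *\<^sub>C e"
  have p: "?p \<in> complex_vector.span E"
    by (intro complex_vector.span_sum complex_vector.span_scale complex_vector.span_base)
  have W: "complex_vector.subspace (closure (complex_vector.span E))"
    by (intro subspace_closure complex_vector.subspace_span)
  have "cinner (x - ?p) e = 0" if "e \<in> E" for e
  proof -
    have "cinner e (x - ?p) = 0"
      using that by (simp add: cinner_simps orthonormal_cinner_sum[OF E order_refl])
    then show ?thesis
      by (subst cinner_commute) simp
  qed
  then have "cinner (x - ?p) (x - ?p) = 0"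
    by (rule cinner_eq_0_closure_span[of E])
      (assumption, rule complex_vector.subspace_diff[OF W x subsetD[OF closure_subset p]])
  then show ?thesis
    using p by (simp add: cinner_self)
qed

text \<open>
  In finite dimension the relations \<open>a T = A a - \<i> c b\<close> and \<open>b T = A b\<close> force the range of \<open>b\<close> into
  that of \<open>a\<close>.  Modulo \<open>X = a (ker b)\<close>, the map \<open>b x \<mapsto> a x\<close> is well defined on the range of \<open>b\<close>
  and its commutator with the self-adjoint operator \<open>A\<close> is \<open>\<i> c\<close> times the projection
  orthogonal to \<open>X\<close>.  A commutator with \<open>A\<close> is orthogonal in the trace inner product to every
  map that commutes with \<open>A\<close>, in particular to this projection, so the projection vanishes on the
  range of \<open>b\<close>.
\<close>

lemma range_subset_range_of_intertwining:
  fixes a b :: "'h::chilbert_space \<Rightarrow> 'f::chilbert_space"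
  assumes T: "finite D" "complex_vector.span D = (UNIV :: 'h set)"
    and a: "clinear_on UNIV a" "range a \<subseteq> F" and b: "clinear_on UNIV b" "range b \<subseteq> F"
    and F: "hilbert_subspace F" and A: "self_adjoint_on F A" and c: "c \<noteq> (0::real)"
    and aT: "\<And>x. a (T x) = A (a x) + (- \<i> * of_real c) *\<^sub>C b x" and bT: "\<And>x. b (T x) = A (b x)"
  shows "range b \<subseteq> range a"
proof -
  note aD = clinear_onD[OF a(1) UNIV_I] and bD = clinear_onD[OF b(1) UNIV_I]
  have F': "complex_vector.subspace F"
    using F by (simp add: hilbert_subspace_iff)
  have sub: "complex_vector.subspace (UNIV :: 'h set)"
    by simp
  have lin: "clinear_on F A" and sa: "\<And>x y. x \<in> F \<Longrightarrow> y \<in> F \<Longrightarrow> cinner (A x) y = cinner x (A y)"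
    using A unfolding self_adjoint_on_def bounded_op_on_def by auto
  \<comment> \<open>\<open>X\<close> is invariant under \<open>A\<close>, so the projection \<open>y \<mapsto> y - p y\<close> orthogonal to \<open>X\<close> commutes with \<open>A\<close>.\<close>
  define X where "X = a ` {g. b g = 0}"
  have memX: "a g \<in> X" if "b g = 0" for g
    unfolding X_def using that by blast
  have X: "complex_vector.subspace X"
  proof (rule complex_vector.subspaceI)
    show "0 \<in> X"
      using memX[of 0] clinear_on_zero[OF a(1) sub] clinear_on_zero[OF b(1) sub] by simp
    show "x + y \<in> X" if xy: "x \<in> X" "y \<in> X" for x y
    proof -
      obtain g g' where "b g = 0" "x = a g" "b g' = 0" "y = a g'"
        using xy unfolding X_def by blast
      then show ?thesis
        using memX[of "g + g'"] by (simp add: aD(1) bD(1))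
    qed
    show "s *\<^sub>C x \<in> X" if x: "x \<in> X" for s x
    proof -
      obtain g where "b g = 0" "x = a g"
        using x unfolding X_def by blast
      then show ?thesis
        using memX[of "s *\<^sub>C g"] by (simp add: aD(2) bD(2))
    qed
  qed
  have XF: "X \<subseteq> F"
    using a(2) unfolding X_def by auto
  have AX: "A x \<in> X" if x: "x \<in> X" for x
  proof -
    obtain g where g: "b g = 0" "x = a g"
      using x unfolding X_def by blast
    have "b (T g) = 0"
      using bT[of g] g(1) clinear_on_zero[OF lin F'] by simp
    moreover have "A x = a (T g)"
      using aT[of g] g by simp
    ultimately show ?thesis
      unfolding X_def by blast
  qed
  have XD: "X \<subseteq> complex_vector.span (a ` D)"
    using range_subset_span[OF a(1) T(2)] unfolding X_def by blast
  obtain G where G: "finite G" "G \<subseteq> X" "orthonormal G" "\<forall>x\<in>X. x = (\<Sum>g\<in>G. cinner g x *\<^sub>C g)"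
    by (rule finite_orthonormal_basis_exists[OF X finite_imageI[OF T(1)] XD])
  obtain E where E: "finite E" "E \<subseteq> range b" "orthonormal E"
    and exp: "\<forall>x\<in>range b. x = (\<Sum>e\<in>E. cinner e x *\<^sub>C e)"
    by (rule finite_orthonormal_basis_exists[OF subspace_range[OF b(1)]
          finite_imageI[OF T(1), of b] range_subset_span[OF b(1) T(2)]])
  have EF: "e \<in> F" if "e \<in> E" for e
    using that E(2) b(2) by blast
  define p where "p y = (\<Sum>g\<in>G. cinner g y *\<^sub>C g)" for y
  have pX: "p y \<in> X" for y
    unfolding p_def using G(2)
    by (intro complex_vector.subspace_sum complex_vector.subspace_scale X) auto
  have porth: "cinner x (y - p y) = 0" if x: "x \<in> X" for x y
  proof -
    have "cinner g (y - p y) = 0" if "g \<in> G" for g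
      using that unfolding p_def by (simp add: cinner_simps orthonormal_cinner_sum[OF G(3,1) order_refl])
    then show ?thesis
      by (subst bspec[OF G(4) x]) (simp add: cinner_sum_left cinner_simps)
  qed
  have p_unique: "y - p y = u" if "y - u \<in> X" "\<And>x. x \<in> X \<Longrightarrow> cinner x u = 0" for y u
  proof -
    let ?z = "(y - p y) - u"
    have "(y - u) - p y \<in> X"
      by (intro complex_vector.subspace_diff[OF X] that pX)
    moreover have "(y - u) - p y = ?z"
      by simp
    ultimately have "?z \<in> X"
      by simp
    then have "cinner ?z (y - p y) - cinner ?z u = 0"
      using porth[of ?z y] that(2)[of ?z] by simp
    then have "cinner ?z ?z = 0"
      by (simp only: psd_form_diff_right[OF psd_form_cinner, of ?z "y - p y" u, symmetric])
    then show ?thesis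
      by (simp add: cinner_self)
  qed
  define w where "w e = e - p e" for e
  define h where "h e = (SOME x. b x = e)" for e
  have bh: "b (h e) = e" if "e \<in> E" for e
    unfolding h_def using E(2) that by (intro someI_ex[of "\<lambda>x. b x = e"]) auto
  \<comment> \<open>\<open>m\<close> is the matrix of \<open>A\<close> on the range of \<open>b\<close>; as it is hermitian, the two traces below cancel.\<close>
  define m where "m f e = cinner f (A e)" for f e
  have wF: "w e \<in> F" if "e \<in> E" for e
    unfolding w_def using EF[OF that] pX XF by (intro complex_vector.subspace_diff[OF F']) auto
  have orthw: "cinner x (w e) = 0" if "x \<in> X" for x e
    unfolding w_def by (rule porth[OF that])
  have orthw': "cinner (w e) x = 0" if "x \<in> X" for x e
    using orthw[OF that, of e] by (subst cinner_commute) simp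
  have Ae: "A e = (\<Sum>f\<in>E. m f e *\<^sub>C f)" if "e \<in> E" for e
    unfolding m_def using bT[of "h e"] bh[OF that] by (intro bspec[OF exp]) (metis rangeI)
  have Aw: "A (w e) = (\<Sum>f\<in>E. m f e *\<^sub>C w f)" if e: "e \<in> E" for e
  proof -
    have "A e - p (A e) = A (w e)"
    proof (rule p_unique)
      have "A (w e) = A e - A (p e)"
        unfolding w_def using EF[OF e] pX XF by (intro clinear_on_diff[OF lin F']) auto
      then show "A e - A (w e) \<in> X"
        using AX[OF pX] by simp
      show "cinner x (A (w e)) = 0" if "x \<in> X" for x
        using sa[of x "w e"] AX[OF that] orthw that XF wF[OF e] by auto
    qed
    moreover have "p (A e) = (\<Sum>f\<in>E. m f e *\<^sub>C p f)"
    proof -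
      have "p (A e) = (\<Sum>g\<in>G. \<Sum>f\<in>E. (m f e * cinner g f) *\<^sub>C g)"
        unfolding Ae[OF e] p_def
        by (simp add: cinner_sum_right cinner_simps complex_vector.scale_sum_left)
      also have "\<dots> = (\<Sum>f\<in>E. \<Sum>g\<in>G. (m f e * cinner g f) *\<^sub>C g)"
        by (rule sum.swap)
      finally show ?thesis
        unfolding p_def by (simp add: complex_vector.scale_sum_right)
    qed
    ultimately have "A (w e) = (\<Sum>f\<in>E. m f e *\<^sub>C f) - (\<Sum>f\<in>E. m f e *\<^sub>C p f)"
      using Ae[OF e] by simp
    then show ?thesis
      unfolding w_def by (simp add: sum_subtractf complex_vector.scale_right_diff_distrib)
  qed
  have aTh: "cinner (w e) (a (T (h e))) = (\<Sum>f\<in>E. m f e * cinner (w e) (a (h f)))" if e: "e \<in> E" for e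
  proof -
    let ?s = "\<Sum>f\<in>E. m f e *\<^sub>C h f"
    have "b (T (h e) - ?s) = b (T (h e)) - (\<Sum>f\<in>E. m f e *\<^sub>C b (h f))"
      by (simp add: clinear_on_diff[OF b(1) sub] clinear_on_sum[OF b(1) sub] bD)
    also have "\<dots> = A e - (\<Sum>f\<in>E. m f e *\<^sub>C f)"
      using bh e by (simp add: bT)
    finally have "b (T (h e) - ?s) = 0"
      using Ae[OF e] by simp
    then have "cinner (w e) (a (T (h e) - ?s)) = 0"
      by (intro orthw') (auto simp: X_def)
    moreover have "a (T (h e) - ?s) = a (T (h e)) - (\<Sum>f\<in>E. m f e *\<^sub>C a (h f))"
      by (simp add: clinear_on_diff[OF a(1) sub] clinear_on_sum[OF a(1) sub] aD)
    ultimately show ?thesis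
      by (simp add: cinner_simps cinner_sum_right)
  qed
  have Aah: "cinner (w e) (A (a (h e))) = (\<Sum>f\<in>E. m e f * cinner (w f) (a (h e)))" if e: "e \<in> E" for e
  proof -
    have "cinner (w e) (A (a (h e))) = cinner (A (w e)) (a (h e))"
      by (rule sa[OF wF[OF e], symmetric]) (use a(2) in blast)
    also have "\<dots> = (\<Sum>f\<in>E. cnj (m f e) * cinner (w f) (a (h e)))"
      unfolding Aw[OF e] by (simp add: cinner_sum_left cinner_simps)
    also have "\<dots> = (\<Sum>f\<in>E. m e f * cinner (w f) (a (h e)))"
    proof (rule sum.cong[OF refl])
      fix f assume f: "f \<in> E"
      have "cnj (m f e) = cinner (A e) f"
        unfolding m_def by (subst cinner_commute) simp
      also have "\<dots> = m e f"
        unfolding m_def using sa EF e f by blast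
      finally show "cnj (m f e) * cinner (w f) (a (h e)) = m e f * cinner (w f) (a (h e))"
        by simp
    qed
    finally show ?thesis .
  qed
  have "\<i> * of_real c * of_real ((norm (w e))\<^sup>2)
      = cinner (w e) (A (a (h e))) - cinner (w e) (a (T (h e)))" if e: "e \<in> E" for e
  proof -
    have "cinner (w e) e = cinner (w e) (w e) + cinner (w e) (p e)"
      unfolding w_def by (simp add: cinner_simps)
    then have "cinner (w e) e = of_real ((norm (w e))\<^sup>2)"
      by (simp add: orthw'[OF pX] cinner_self)
    then show ?thesis
      by (simp add: aT bh[OF e] cinner_simps)
  qed
  then have "(\<Sum>e\<in>E. \<i> * of_real c * of_real ((norm (w e))\<^sup>2))
      = (\<Sum>e\<in>E. \<Sum>f\<in>E. m e f * cinner (w f) (a (h e))) - (\<Sum>e\<in>E. \<Sum>f\<in>E. m f e * cinner (w e) (a (h f)))"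
    by (simp add: Aah aTh sum_subtractf)
  also have "\<dots> = 0"
    by (subst sum.swap) simp
  finally have "\<i> * of_real c * of_real (\<Sum>e\<in>E. (norm (w e))\<^sup>2) = 0"
    by (simp add: sum_distrib_left)
  then have "(\<Sum>e\<in>E. (norm (w e))\<^sup>2) = 0"
    using c by (simp only: mult_eq_0_iff of_real_eq_0_iff) simp
  then have "w e = 0" if "e \<in> E" for e
    using that E(1) by (simp add: sum_nonneg_eq_0_iff)
  then have "e \<in> X" if "e \<in> E" for e
    using pX[of e] that unfolding w_def by simp
  then have "e \<in> range a" if "e \<in> E" for e
    using that unfolding X_def by blast
  then have "(\<Sum>e\<in>E. cinner e x *\<^sub>C e) \<in> range a" for x
    by (intro complex_vector.subspace_sum complex_vector.subspace_scale subspace_range[OF a(1)])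
  then show ?thesis
    using exp by (metis (no_types, lifting) subsetI)
qed

text \<open>
  The ranges of three operators from \<open>H\<close> generate a space of Hilbert dimension at most three times
  that of \<open>H\<close>.  In infinite dimension this is the dimension of \<open>H\<close>; in finite dimension the
  relations put all three ranges into that of \<open>a\<close>.
\<close>

lemma ranges_embed_isometrically:
  fixes a b e :: "'h::chilbert_space \<Rightarrow> 'f::chilbert_space"
  assumes a: "clinear_on UNIV a" "continuous_on UNIV a" "range a \<subseteq> F"
    and b: "clinear_on UNIV b" "continuous_on UNIV b" "range b \<subseteq> F"
    and e: "clinear_on UNIV e" "continuous_on UNIV e" "range e \<subseteq> F"
    and F: "hilbert_subspace F" and A: "self_adjoint_on F A1" "self_adjoint_on F A2"
    and cd: "c \<noteq> (0::real)" "d \<noteq> (0::real)"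
    and rel1: "\<And>x. a (T1 x) = A1 (a x) + (- \<i> * of_real c) *\<^sub>C b x" "\<And>x. b (T1 x) = A1 (b x)"
    and rel2: "\<And>x. a (T2 x) = A2 (a x) + (- \<i> * of_real d) *\<^sub>C e x" "\<And>x. e (T2 x) = A2 (e x)"
  obtains W and h :: "'f \<Rightarrow> 'h" where "complex_vector.subspace W" "range a \<union> range b \<union> range e \<subseteq> W"
    "clinear_on W h" "\<forall>x\<in>W. norm (h x) = norm x"
proof -
  include cardinal_syntax
  obtain B where B: "orthonormal B" "closure (complex_vector.span B) = (UNIV :: 'h set)"
    by (rule hilbert_basis_exists[OF hilbert_subspace_UNIV])
  have "\<exists>E :: 'f set. orthonormal E \<and> range a \<union> range b \<union> range e \<subseteq> closure (complex_vector.span E) \<and> |E| \<le>o |B|"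
  proof (cases "finite B")
    case True
    have span: "complex_vector.span B = UNIV"
      using finite_orthonormal_span_closed[OF B(1) True] unfolding B(2) by blast
    obtain E where E: "finite E" "E \<subseteq> range a" "orthonormal E"
      and exp: "\<forall>x\<in>range a. x = (\<Sum>f\<in>E. cinner f x *\<^sub>C f)"
      by (rule finite_orthonormal_basis_exists[OF subspace_range[OF a(1)]
            finite_imageI[OF True, of a] range_subset_span[OF a(1) span]])
    have "range a \<subseteq> complex_vector.span E"
    proof
      fix x assume x: "x \<in> range a"
      show "x \<in> complex_vector.span E"
        by (subst bspec[OF exp x]) (intro complex_vector.span_sum complex_vector.span_scale complex_vector.span_base)
    qed
    moreover have "range b \<subseteq> range a"
      by (rule range_subset_range_of_intertwining[OF True span a(1,3) b(1,3) F A(1) cd(1) rel1])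
    moreover have "range e \<subseteq> range a"
      by (rule range_subset_range_of_intertwining[OF True span a(1,3) e(1,3) F A(2) cd(2) rel2])
    ultimately have sub: "range a \<union> range b \<union> range e \<subseteq> closure (complex_vector.span E)"
      using closure_subset[of "complex_vector.span E"] by blast
    have "|E| \<le>o |B|"
    proof -
      have "E \<subseteq> complex_vector.span (a ` B)"
        using E(2) range_subset_span[OF a(1) span] by (rule subset_trans)
      then have "card E \<le> card (a ` B)"
        using complex_vector.independent_span_bound[OF finite_imageI[OF True] orthonormal_independent[OF E(3)]]
        by (rule_tac conjunct2)
      also have "\<dots> \<le> card B"
        by (rule card_image_le[OF True])
      finally show ?thesis
        using inj_on_iff_card_le[OF E(1) True] unfolding card_of_ordLeq[symmetric] by blast
    qed
    with E(3) sub show ?thesis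
      by (intro exI[of _ E] conjI)
  next
    case False
    define D where "D = a ` B \<union> b ` B \<union> e ` B"
    have "hilbert_subspace (closure (complex_vector.span D))"
      by (simp add: hilbert_subspace_iff subspace_closure complex_vector.subspace_span)
    then obtain E where E: "orthonormal E" "closure (complex_vector.span E) = closure (complex_vector.span D)"
      by (rule hilbert_basis_exists)
    have "|D| \<le>o |B|"
    proof -
      have "|{a, b, e}| \<le>o |B|"
        using False by (intro ordLess_imp_ordLeq finite_ordLess_infinite card_of_Well_order)
          (simp_all add: Field_card_of)
      then have "|\<Union>f\<in>{a, b, e}. f ` B| \<le>o |B|"
        by (intro card_of_UNION_ordLeq_infinite[OF False] ballI card_of_image)
      then show ?thesis
        unfolding D_def by (simp add: Un_assoc)
    qed
    then have "|E| \<le>o |B|"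
      by (rule card_hilbert_basis_le[OF E False])
    have "range f \<subseteq> closure (complex_vector.span D)"
      if f: "clinear_on UNIV f" "continuous_on UNIV f" "f ` B \<subseteq> D" for f :: "'h \<Rightarrow> 'f"
      by (rule subset_trans[OF range_subset_closure_span[OF f(1,2) B(2)]
            closure_mono[OF complex_vector.span_mono[OF f(3)]]])
    from this[OF a(1,2)] this[OF b(1,2)] this[OF e(1,2)]
    have "range a \<union> range b \<union> range e \<subseteq> closure (complex_vector.span E)"
      unfolding E(2) D_def by blast
    with E(1) \<open>|E| \<le>o |B|\<close> show ?thesis
      by (intro exI[of _ E] conjI)
  qed
  then obtain E :: "'f set" where E: "orthonormal E"
      "range a \<union> range b \<union> range e \<subseteq> closure (complex_vector.span E)"
    and card: "|E| \<le>o |B|"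
    by (elim exE conjE) (rule that)
  obtain j where j: "inj_on j E" "j ` E \<subseteq> B"
    using card unfolding card_of_ordLeq[symmetric] by (elim exE conjE) (rule that)
  obtain h :: "'f \<Rightarrow> 'h" where h: "clinear_on (closure (complex_vector.span E)) h"
    "\<forall>x\<in>closure (complex_vector.span E). norm (h x) = norm x"
    by (rule isometry_of_hilbert_bases[OF E(1) B(1) j])
  show ?thesis
    by (rule that[OF subspace_closure[OF complex_vector.subspace_span] E(2) h])
qed

section \<open>Power series in a bounded operator\<close>

instance chilbert_space \<subseteq> banach ..

definition op_series :: "(nat \<Rightarrow> complex) \<Rightarrow> ('a::chilbert_space \<Rightarrow> 'a) \<Rightarrow> 'a \<Rightarrow> 'a" where
  "op_series p X x = (\<Sum>n. p n *\<^sub>C (X ^^ n) x)"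

lemma bounded_op_linear:
  assumes "bounded_op A"
  shows bounded_op_zero: "A 0 = 0"
    and bounded_op_diff: "A (x - y) = A x - A y"
    and bounded_op_scaleR: "A (r *\<^sub>R x) = r *\<^sub>R A x"
    and bounded_op_sum: "A (\<Sum>i\<in>I. f i) = (\<Sum>i\<in>I. A (f i))"
  using bounded_op_bounded_linear[OF assms, THEN bounded_linear.linear]
  by (auto simp: linear_0 linear_diff linear_scale linear_sum)

lemma bounded_opI:
  assumes "\<And>x y. A (x + y) = A x + A y" "\<And>a x. A (a *\<^sub>C x) = a *\<^sub>C A x"
    and "\<And>x. norm (A x) \<le> M * norm x"
  shows "bounded_op A"
  using assms unfolding bounded_op_on_def clinear_on_def by blast

lemma bounded_op_plus:
  assumes "bounded_op f" "bounded_op g"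
  shows "bounded_op (\<lambda>x. f x + g x)"
  using assms unfolding bounded_op_iff_bounded_linear
  by (auto intro: bounded_linear_add simp: scaleC_add_right)

lemma bounded_op_scaled:
  assumes "bounded_op f"
  shows "bounded_op (\<lambda>x. r *\<^sub>R f x)"
proof -
  have "r *\<^sub>R a *\<^sub>C y = a *\<^sub>C r *\<^sub>R y" for a and y :: 'a
    by (simp add: scaleR_eq_scaleC scaleC_scaleC mult.commute)
  with assms show ?thesis
    unfolding bounded_op_iff_bounded_linear by (auto intro: bounded_linear_const_scaleR)
qed

lemma bounded_op_funpow: "bounded_op A \<Longrightarrow> bounded_op (A ^^ n)"
proof (induction n)
  case 0
  then show ?case
    by (intro bounded_opI[where M = 1]) auto
next
  case (Suc n)
  note IH = Suc.IH[OF Suc.prems]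
  obtain M where M: "M > 0" "\<And>x. norm (A x) \<le> M * norm x"
    using bounded_op_bound[OF Suc.prems] by blast
  obtain N where N: "N > 0" "\<And>x. norm ((A ^^ n) x) \<le> N * norm x"
    using bounded_op_bound[OF IH] by blast
  show ?case
  proof (rule bounded_opI)
    show "norm ((A ^^ Suc n) x) \<le> M * N * norm x" for x
      using order_trans[OF M(2) mult_left_mono[OF N(2), of M]] M(1) by (simp add: mult.assoc)
  qed (simp_all add: bounded_opD(1,2)[OF Suc.prems] bounded_opD(1,2)[OF IH])
qed

lemma norm_funpow_le:
  fixes X :: "'a::real_normed_vector \<Rightarrow> 'a"
  assumes "\<And>x. norm (X x) \<le> M * norm x" "M \<ge> 0"
  shows "norm ((X ^^ n) x) \<le> M ^ n * norm x"
proof (induction n)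
  case (Suc n)
  have "norm (X ((X ^^ n) x)) \<le> M * (M ^ n * norm x)"
    using assms(1)[of "(X ^^ n) x"] mult_left_mono[OF Suc assms(2)] by linarith
  then show ?case by (simp add: mult.assoc)
qed simp

locale op_power_series =
  fixes X :: "'a::chilbert_space \<Rightarrow> 'a" and M :: real
  assumes X: "bounded_op X" and M: "norm (X x) \<le> M * norm x" and M_nonneg: "M \<ge> 0"
begin

lemma norm_term_le: "norm (p n *\<^sub>C (X ^^ n) x) \<le> cmod (p n) * M ^ n * norm x"
  using mult_left_mono[OF norm_funpow_le[OF M M_nonneg], of "cmod (p n)" n x]
  by (simp add: norm_scaleC mult.assoc)

lemma summable_norm_terms:
  assumes "summable (\<lambda>n. cmod (p n) * M ^ n)"
  shows "summable (\<lambda>n. norm (p n *\<^sub>C (X ^^ n) x))"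
  by (rule summable_comparison_test'[OF summable_mult2[OF assms, of "norm x"], of 0])
    (use norm_term_le in simp)

lemma summable_terms:
  assumes "summable (\<lambda>n. cmod (p n) * M ^ n)"
  shows "summable (\<lambda>n. p n *\<^sub>C (X ^^ n) x)"
  by (rule summable_norm_cancel[OF summable_norm_terms[OF assms]])

lemma norm_op_series_le:
  assumes "summable (\<lambda>n. cmod (p n) * M ^ n)"
  shows "norm (op_series p X x) \<le> (\<Sum>n. cmod (p n) * M ^ n) * norm x"
proof -
  have "norm (op_series p X x) \<le> (\<Sum>n. cmod (p n) * M ^ n * norm x)"
    unfolding op_series_def
    by (rule norm_suminf_le[OF norm_term_le[where p = p and x = x] summable_mult2[OF assms]])
  also have "\<dots> = (\<Sum>n. cmod (p n) * M ^ n) * norm x"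
    by (rule suminf_mult2[OF assms, symmetric])
  finally show ?thesis .
qed

lemma bounded_op_op_series:
  assumes "summable (\<lambda>n. cmod (p n) * M ^ n)"
  shows "bounded_op (op_series p X)"
proof (rule bounded_opI[OF _ _ norm_op_series_le[OF assms]])
  note s = summable_terms[OF assms]
  show "op_series p X (x + y) = op_series p X x + op_series p X y" for x y
    unfolding op_series_def suminf_add[OF s s]
    by (simp add: bounded_op_add[OF bounded_op_funpow[OF X]] scaleC_add_right)
  show "op_series p X (a *\<^sub>C x) = a *\<^sub>C op_series p X x" for a x
    unfolding op_series_def
      bounded_linear.suminf[OF bounded_bilinear.bounded_linear_right[OF bounded_bilinear_scaleC] s]
    by (simp add: bounded_op_scaleC[OF bounded_op_funpow[OF X]] scaleC_scaleC mult.commute)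
qed

lemma op_series_commute:
  assumes "summable (\<lambda>n. cmod (p n) * M ^ n)" and A: "bounded_op A" "\<And>x. A (X x) = X (A x)"
  shows "A (op_series p X x) = op_series p X (A x)"
proof -
  have "A ((X ^^ n) x) = (X ^^ n) (A x)" for n
    by (induction n) (simp_all add: A(2))
  then show ?thesis
    unfolding op_series_def
      bounded_linear.suminf[OF bounded_op_bounded_linear[OF A(1)] summable_terms[OF assms(1)]]
    by (simp add: bounded_op_scaleC[OF A(1)])
qed

text \<open>
  Mertens' theorem for operators: the square and the triangular partial sums of the double
  series differ by at most the corresponding difference for the real series of norms.
\<close>

lemma op_series_compose:
  assumes p: "summable (\<lambda>n. cmod (p n) * M ^ n)" and q: "summable (\<lambda>n. cmod (q n) * M ^ n)"
  shows "op_series p X (op_series q X x) = op_series (\<lambda>n. \<Sum>i\<le>n. p i * q (n - i)) X x"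
proof -
  define a where "a n = cmod (p n) * M ^ n" for n
  define b where "b n = cmod (q n) * M ^ n * norm x" for n
  define P where "P N y = (\<Sum>i<N. p i *\<^sub>C (X ^^ i) y)" for N y
  define Q where "Q N = (\<Sum>j<N. q j *\<^sub>C (X ^^ j) x)" for N
  define r where "r n = (\<Sum>i\<le>n. p i * q (n - i))" for n
  define g where "g i j = (p i * q j) *\<^sub>C (X ^^ (i + j)) x" for i j
  have a: "summable a" and b: "summable b"
    unfolding a_def b_def by (intro p q summable_mult2)+
  have a0: "a n \<ge> 0" and b0: "b n \<ge> 0" for n
    unfolding a_def b_def using M_nonneg by simp_all
  have lim_P: "(\<lambda>N. P N y) \<longlonglongrightarrow> op_series p X y" for y
    unfolding P_def op_series_def by (rule summable_LIMSEQ[OF summable_terms[OF p]])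
  have lim_Q: "Q \<longlonglongrightarrow> op_series q X x"
    unfolding Q_def op_series_def by (rule summable_LIMSEQ[OF summable_terms[OF q]])
  have norm_P: "norm (P N y) \<le> suminf a * norm y" for N y
  proof -
    have "norm (P N y) \<le> (\<Sum>i<N. a i * norm y)"
      unfolding P_def a_def by (intro sum_norm_le norm_term_le)
    also have "\<dots> \<le> suminf a * norm y"
      unfolding sum_distrib_right[symmetric] by (intro mult_right_mono sum_le_suminf a) (auto simp: a0)
    finally show ?thesis .
  qed
  have P_diff: "P N (y - z) = P N y - P N z" for N y z
    unfolding P_def by (simp add: bounded_op_diff[OF bounded_op_funpow[OF X]]
        complex_vector.scale_right_diff_distrib sum_subtractf)
  have "(\<lambda>N. P N (op_series q X x - Q N)) \<longlonglongrightarrow> 0"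
  proof (rule Lim_null_comparison)
    show "\<forall>\<^sub>F N in sequentially. norm (P N (op_series q X x - Q N)) \<le> suminf a * norm (op_series q X x - Q N)"
      by (simp add: norm_P)
    have "(\<lambda>N. suminf a * norm (op_series q X x - Q N)) \<longlonglongrightarrow> suminf a * norm (op_series q X x - op_series q X x)"
      by (intro tendsto_intros lim_Q)
    then show "(\<lambda>N. suminf a * norm (op_series q X x - Q N)) \<longlonglongrightarrow> 0"
      by simp
  qed
  then have "(\<lambda>N. P N (op_series q X x) - P N (op_series q X x - Q N)) \<longlonglongrightarrow> op_series p X (op_series q X x) - 0"
    by (intro tendsto_diff lim_P)
  then have lim1: "(\<lambda>N. P N (Q N)) \<longlonglongrightarrow> op_series p X (op_series q X x)"
    unfolding P_diff by simp
  have PQ: "P N (Q N) = (\<Sum>(i, j)\<in>{..<N} \<times> {..<N}. g i j)" for N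
    unfolding P_def Q_def g_def sum.cartesian_product[symmetric]
    by (simp add: bounded_op_sum[OF bounded_op_funpow[OF X]] complex_vector.scale_sum_right
        bounded_op_scaleC[OF bounded_op_funpow[OF X]] scaleC_scaleC funpow_add)
  have R: "(\<Sum>k<N. r k *\<^sub>C (X ^^ k) x) = (\<Sum>(i, j)\<in>{(i, j). i + j < N}. g i j)" for N
    unfolding sum.triangle_reindex r_def g_def
    by (intro sum.cong) (simp_all add: complex_vector.scale_sum_left)
  have sub: "{(i, j). i + j < N} \<subseteq> {..<N} \<times> {..<N}" for N :: nat
    by auto
  have "(\<lambda>N. P N (Q N) - (\<Sum>k<N. r k *\<^sub>C (X ^^ k) x)) \<longlonglongrightarrow> 0"
  proof (rule Lim_null_comparison)
    show "\<forall>\<^sub>F N in sequentially. norm (P N (Q N) - (\<Sum>k<N. r k *\<^sub>C (X ^^ k) x))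
        \<le> (\<Sum>i<N. a i) * (\<Sum>j<N. b j) - (\<Sum>k<N. \<Sum>i\<le>k. a i * b (k - i))"
    proof (intro always_eventually allI)
      fix N :: nat
      let ?D = "{..<N} \<times> {..<N} - {(i, j). i + j < N}"
      have "norm (P N (Q N) - (\<Sum>k<N. r k *\<^sub>C (X ^^ k) x)) = norm (\<Sum>(i, j)\<in>?D. g i j)"
        unfolding PQ R by (simp only: sum_diff[OF finite_cartesian_product[OF finite_lessThan finite_lessThan] sub])
      also have "\<dots> \<le> (\<Sum>(i, j)\<in>?D. a i * b j)"
      proof (rule sum_norm_le)
        fix ij :: "nat \<times> nat"
        obtain i j where ij: "ij = (i, j)"
          by fastforce
        have "norm (g i j) \<le> cmod (p i * q j) * M ^ (i + j) * norm x"
          unfolding g_def by (rule norm_term_le[of "\<lambda>_. p i * q j"])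
        then show "norm (case ij of (i, j) \<Rightarrow> g i j) \<le> (case ij of (i, j) \<Rightarrow> a i * b j)"
          unfolding a_def b_def ij by (simp add: norm_mult power_add mult_ac)
      qed
      also have "\<dots> = (\<Sum>(i, j)\<in>{..<N} \<times> {..<N}. a i * b j) - (\<Sum>(i, j)\<in>{(i, j). i + j < N}. a i * b j)"
        by (rule sum_diff[OF finite_cartesian_product[OF finite_lessThan finite_lessThan] sub])
      also have "\<dots> = (\<Sum>i<N. a i) * (\<Sum>j<N. b j) - (\<Sum>k<N. \<Sum>i\<le>k. a i * b (k - i))"
        unfolding sum.triangle_reindex by (simp add: sum_product sum.cartesian_product)
      finally show "norm (P N (Q N) - (\<Sum>k<N. r k *\<^sub>C (X ^^ k) x))
        \<le> (\<Sum>i<N. a i) * (\<Sum>j<N. b j) - (\<Sum>k<N. \<Sum>i\<le>k. a i * b (k - i))" .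
    qed
    have "(\<lambda>k. \<Sum>i\<le>k. a i * b (k - i)) sums (suminf a * suminf b)"
      using a b a0 b0 by (intro Cauchy_product_sums) simp_all
    then have "(\<lambda>N. (\<Sum>i<N. a i) * (\<Sum>j<N. b j) - (\<Sum>k<N. \<Sum>i\<le>k. a i * b (k - i)))
        \<longlonglongrightarrow> suminf a * suminf b - suminf a * suminf b"
      unfolding sums_def by (intro tendsto_diff tendsto_mult summable_LIMSEQ a b)
    then show "(\<lambda>N. (\<Sum>i<N. a i) * (\<Sum>j<N. b j) - (\<Sum>k<N. \<Sum>i\<le>k. a i * b (k - i))) \<longlonglongrightarrow> 0"
      by simp
  qed
  from tendsto_diff[OF lim1 this]
  have "(\<lambda>k. r k *\<^sub>C (X ^^ k) x) sums op_series p X (op_series q X x)"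
    unfolding sums_def by simp
  then show ?thesis
    unfolding op_series_def r_def by (rule sums_unique)
qed

end

section \<open>Exponentials\<close>

lemma op_power_series_exists:
  assumes "bounded_op X"
  obtains M where "op_power_series X M"
  using bounded_op_bound[OF assms] assms unfolding op_power_series_def by (metis less_imp_le)

definition exp_coeff :: "real \<Rightarrow> nat \<Rightarrow> complex" where
  "exp_coeff s n = (\<i> * of_real s) ^ n /\<^sub>R fact n"

lemma exp_i_eq_op_series:
  assumes T: "bounded_op T"
  shows "exp_i s T = op_series (exp_coeff s) T"
proof
  fix x
  let ?a = "\<i> * complex_of_real s"
  have "((\<lambda>x. ?a *\<^sub>C T x) ^^ n) x = ?a ^ n *\<^sub>C (T ^^ n) x" for n
    by (induction n) (simp_all add: bounded_op_scaleC[OF T] scaleC_scaleC)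
  then show "exp_i s T x = op_series (exp_coeff s) T x"
    unfolding exp_i_def op_exp_def op_series_def exp_coeff_def
    by (simp add: scaleR_eq_scaleC[where ?'a = 'a] scaleC_scaleC scaleR_conv_of_real)
qed

lemma norm_exp_coeff: "cmod (exp_coeff s n) * M ^ n = (\<bar>s\<bar> * M) ^ n /\<^sub>R fact n"
  unfolding exp_coeff_def by (simp add: norm_mult norm_power power_mult_distrib)

lemma summable_exp_coeff: "summable (\<lambda>n. cmod (exp_coeff s n) * M ^ n)"
  unfolding norm_exp_coeff by (rule summable_exp_generic)

lemma bounded_op_exp_i:
  assumes T: "bounded_op T"
  shows "bounded_op (exp_i s T)"
proof -
  obtain M where "op_power_series T M"
    using op_power_series_exists[OF T] .
  then interpret op_power_series T M .
  show ?thesis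
    unfolding exp_i_eq_op_series[OF T] by (rule bounded_op_op_series[OF summable_exp_coeff])
qed

lemma exp_i_commute:
  assumes T: "bounded_op T" and A: "bounded_op A" "\<And>x. A (T x) = T (A x)"
  shows "A (exp_i s T x) = exp_i s T (A x)"
proof -
  obtain M where "op_power_series T M"
    using op_power_series_exists[OF T] .
  then interpret op_power_series T M .
  show ?thesis
    unfolding exp_i_eq_op_series[OF T] by (rule op_series_commute[OF summable_exp_coeff A])
qed

lemma exp_i_add:
  assumes T: "bounded_op T"
  shows "exp_i (s + t) T x = exp_i s T (exp_i t T x)"
proof -
  obtain M where "op_power_series T M"
    using op_power_series_exists[OF T] .
  then interpret op_power_series T M .
  have "exp_coeff (s + t) = (\<lambda>n. \<Sum>i\<le>n. exp_coeff s i * exp_coeff t (n - i))"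
    unfolding exp_coeff_def
    using exp_series_add_commuting[of "\<i> * of_real s" "\<i> * of_real t"]
    by (simp add: fun_eq_iff algebra_simps)
  then show ?thesis
    unfolding exp_i_eq_op_series[OF T]
    by (simp add: op_series_compose[OF summable_exp_coeff summable_exp_coeff])
qed

lemma exp_i_zero:
  assumes T: "bounded_op T"
  shows "exp_i 0 T x = x"
proof -
  have "exp_coeff 0 n *\<^sub>C (T ^^ n) x = (if n = 0 then x else 0)" for n
    unfolding exp_coeff_def by (simp add: power_0_left)
  then show ?thesis
    unfolding exp_i_eq_op_series[OF T] op_series_def
    using sums_unique[OF sums_single[of 0 "\<lambda>_. x"]] by simp
qed

text \<open>
  At \<open>0\<close> the remainder of order two is dominated by the tail of the real exponential series; the group
  law moves the derivative to any other point.
\<close>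

lemma exp_i_derivative:
  assumes T: "bounded_op T"
  shows "((\<lambda>t. exp_i t T x) has_vector_derivative exp_i t T (\<i> *\<^sub>C T x)) (at t)"
proof -
  obtain M where "op_power_series T M"
    using op_power_series_exists[OF T] .
  then interpret op_power_series T M .
  have est: "norm (exp_i h T x - x - h *\<^sub>R (\<i> *\<^sub>C T x)) \<le> (\<bar>h\<bar> * M)\<^sup>2 * norm x" if h: "\<bar>h\<bar> * M \<le> 1" for h
  proof -
    let ?f = "\<lambda>n. exp_coeff h n *\<^sub>C (T ^^ n) x"
    let ?g = "\<lambda>n. (\<bar>h\<bar> * M) ^ n /\<^sub>R fact n"
    have sf: "summable ?f" and sg: "summable ?g"
      by (rule summable_terms[OF summable_exp_coeff], rule summable_exp_generic)
    have "exp_i h T x = (\<Sum>n. ?f (n + 2)) + (\<Sum>n<2. ?f n)"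
      unfolding exp_i_eq_op_series[OF T] op_series_def by (rule suminf_split_initial_segment[OF sf])
    also have "(\<Sum>n<2. ?f n) = x + h *\<^sub>R (\<i> *\<^sub>C T x)"
      unfolding exp_coeff_def
      by (simp add: numeral_2_eq_2 scaleR_eq_scaleC[where ?'a = 'a] scaleC_scaleC mult.commute)
    finally have "norm (exp_i h T x - x - h *\<^sub>R (\<i> *\<^sub>C T x)) = norm (\<Sum>n. ?f (n + 2))"
      by simp
    also have "\<dots> \<le> (\<Sum>n. ?g (n + 2) * norm x)"
    proof (rule norm_suminf_le)
      show "norm (?f (n + 2)) \<le> ?g (n + 2) * norm x" for n
        using norm_term_le[of "exp_coeff h" "n + 2" x] unfolding norm_exp_coeff .
      show "summable (\<lambda>n. ?g (n + 2) * norm x)"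
        by (intro summable_mult2 summable_ignore_initial_segment sg)
    qed
    also have "\<dots> = (\<Sum>n. ?g (n + 2)) * norm x"
      by (rule suminf_mult2[OF summable_ignore_initial_segment[OF sg], symmetric])
    also have "(\<Sum>n. ?g (n + 2)) = exp (\<bar>h\<bar> * M) - 1 - \<bar>h\<bar> * M"
      using suminf_split_initial_segment[OF sg, of 2] unfolding exp_def by (simp add: numeral_2_eq_2)
    also have "\<dots> \<le> (\<bar>h\<bar> * M)\<^sup>2"
      using exp_bound[of "\<bar>h\<bar> * M"] h M_nonneg by simp
    finally show ?thesis
      by (simp add: mult_right_mono)
  qed
  have "((\<lambda>h. exp_i h T x) has_vector_derivative \<i> *\<^sub>C T x) (at 0)"
    unfolding has_vector_derivative_def has_derivative_at
  proof (intro conjI)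
    show "bounded_linear (\<lambda>h. h *\<^sub>R (\<i> *\<^sub>C T x))"
      by (rule bounded_linear_scaleR_left)
    show "(\<lambda>h. norm (exp_i (0 + h) T x - exp_i 0 T x - h *\<^sub>R (\<i> *\<^sub>C T x)) / norm h) \<midarrow>0\<rightarrow> 0"
    proof (rule Lim_null_comparison)
      have "((\<lambda>h. \<bar>h\<bar> * M) \<longlongrightarrow> \<bar>0\<bar> * M) (at 0)"
        by (intro tendsto_intros)
      then have "\<forall>\<^sub>F h in at 0. \<bar>h\<bar> * M < 1"
        by (rule order_tendstoD) simp
      then show "\<forall>\<^sub>F h in at 0. norm (norm (exp_i (0 + h) T x - exp_i 0 T x - h *\<^sub>R (\<i> *\<^sub>C T x)) / norm h)
          \<le> \<bar>h\<bar> * (M\<^sup>2 * norm x)"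
      proof (rule eventually_mono)
        fix h :: real assume h: "\<bar>h\<bar> * M < 1"
        have "norm (exp_i h T x - x - h *\<^sub>R (\<i> *\<^sub>C T x)) \<le> \<bar>h\<bar> * (\<bar>h\<bar> * (M\<^sup>2 * norm x))"
          using est[of h] h by (simp add: power_mult_distrib power2_eq_square mult_ac)
        then show "norm (norm (exp_i (0 + h) T x - exp_i 0 T x - h *\<^sub>R (\<i> *\<^sub>C T x)) / norm h)
            \<le> \<bar>h\<bar> * (M\<^sup>2 * norm x)"
          by (cases "h = 0") (simp_all add: exp_i_zero[OF T] divide_le_eq mult_ac)
      qed
      have "((\<lambda>h. \<bar>h\<bar> * (M\<^sup>2 * norm x)) \<longlongrightarrow> \<bar>0\<bar> * (M\<^sup>2 * norm x)) (at 0)"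
        by (intro tendsto_intros)
      then show "((\<lambda>h. \<bar>h\<bar> * (M\<^sup>2 * norm x)) \<longlongrightarrow> 0) (at 0)"
        by simp
    qed
  qed
  then have "((\<lambda>h. exp_i t T (exp_i h T x)) has_vector_derivative exp_i t T (\<i> *\<^sub>C T x)) (at (t - t))"
    by (intro bounded_linear.has_vector_derivative[OF bounded_op_bounded_linear[OF bounded_op_exp_i[OF T]]]) simp
  then have "((\<lambda>s. exp_i t T (exp_i (s - t) T x)) has_vector_derivative exp_i t T (\<i> *\<^sub>C T x)) (at t)"
    unfolding has_vector_derivative_def
    by (rule has_derivative_compose[where f = "\<lambda>s. s - t", rotated]) (auto intro!: derivative_eq_intros)
  then show ?thesis
    by (simp add: exp_i_add[OF T, symmetric])
qed

section \<open>Factoring a bounded positive semidefinite form\<close>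

text \<open>The Taylor coefficients of \<open>sqrt (1 - z)\<close>.\<close>

definition sqrt_coeff :: "nat \<Rightarrow> real" where
  "sqrt_coeff n = (- 1) ^ n * ((1/2) gchoose n)"

lemma sqrt_coeff_Suc: "sqrt_coeff (Suc n) = sqrt_coeff n * ((real n - 1/2) / real (Suc n))"
proof -
  have "real (Suc n) * (1/2 gchoose Suc n) = (1/2 - real n) * (1/2 gchoose n)"
    by (simp only: gbinomial_absorption gbinomial_absorb_comp)
  then have "(1/2 gchoose Suc n) = (1/2 gchoose n) * ((1/2 - real n) / real (Suc n))"
    by (simp add: eq_divide_eq mult.commute del: of_nat_Suc)
  moreover have "(1/2 - real n) / real (Suc n) = - ((real n - 1/2) / real (Suc n))"
    by (simp add: minus_divide_left del: of_nat_Suc)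
  ultimately show ?thesis
    unfolding sqrt_coeff_def by (simp del: of_nat_Suc)
qed

lemma sqrt_coeff_nonpos: "sqrt_coeff (Suc n) \<le> 0"
proof (induction n)
  case 0
  then show ?case by (simp add: sqrt_coeff_def)
next
  case (Suc n)
  then show ?case
    unfolding sqrt_coeff_Suc[of "Suc n"] by (intro mult_nonpos_nonneg) auto
qed

text \<open>The partial sums are the Taylor coefficients of \<open>1 / sqrt (1 - z)\<close>, which are positive.\<close>

lemma sum_sqrt_coeff_nonneg: "0 \<le> (\<Sum>k\<le>n. sqrt_coeff k)"
proof -
  have "(\<Sum>k\<le>n. sqrt_coeff k) = (- 1) ^ n * ((- 1/2 :: real) gchoose n)"
    using gbinomial_sum_lower_neg[of "1/2 :: real" n] unfolding sqrt_coeff_def by (simp add: mult.commute)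
  also have "\<dots> = pochhammer (1/2) n / fact n"
    unfolding gbinomial_pochhammer by simp
  also have "\<dots> \<ge> 0"
    by (intro divide_nonneg_pos pochhammer_nonneg) simp_all
  finally show ?thesis .
qed

lemma summable_abs_sqrt_coeff: "summable (\<lambda>n. \<bar>sqrt_coeff n\<bar>)"
proof -
  have "(\<Sum>k<n. \<bar>sqrt_coeff (Suc k)\<bar>) \<le> 1" for n
  proof -
    have "(\<Sum>k<n. \<bar>sqrt_coeff (Suc k)\<bar>) = - (\<Sum>k<n. sqrt_coeff (Suc k))"
      using sqrt_coeff_nonpos by (simp add: sum_negf[symmetric] abs_of_nonpos)
    also have "\<dots> = sqrt_coeff 0 - (\<Sum>k\<le>n. sqrt_coeff k)"
      by (simp add: sum.atMost_shift)
    also have "\<dots> \<le> 1"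
      using sum_sqrt_coeff_nonneg[of n] by (simp add: sqrt_coeff_def)
    finally show ?thesis .
  qed
  then have "summable (\<lambda>n. \<bar>sqrt_coeff (Suc n)\<bar>)"
    by (intro summableI_nonneg_bounded[where x = 1]) auto
  then show ?thesis
    using summable_Suc_iff[of "\<lambda>n. \<bar>sqrt_coeff n\<bar>"] by simp
qed

lemma sqrt_coeff_convolution:
  "(\<Sum>i\<le>n. sqrt_coeff i * sqrt_coeff (n - i)) = (if n = 0 then 1 else if n = 1 then - 1 else 0)"
proof -
  have "(\<Sum>i\<le>n. sqrt_coeff i * sqrt_coeff (n - i))
      = (\<Sum>i\<in>{0..n}. (- 1) ^ n * (((1/2) gchoose i) * ((1/2) gchoose (n - i))))"
    unfolding sqrt_coeff_def atMost_atLeast0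
  proof (intro sum.cong refl)
    fix i assume "i \<in> {0..n}"
    then have "(- 1) ^ i * (- 1) ^ (n - i) = ((- 1) ^ n :: real)"
      by (simp flip: power_add)
    then show "(- 1) ^ i * ((1/2 :: real) gchoose i) * ((- 1) ^ (n - i) * ((1/2) gchoose (n - i)))
        = (- 1) ^ n * (((1/2) gchoose i) * ((1/2) gchoose (n - i)))"
      by (metis mult.assoc mult.left_commute)
  qed
  also have "\<dots> = (- 1) ^ n * ((1/2 + 1/2 :: real) gchoose n)"
    unfolding sum_distrib_left[symmetric] gbinomial_Vandermonde ..
  also have "\<dots> = (- 1) ^ n * of_nat (1 choose n)"
    using binomial_gbinomial[of 1 n, where ?'a = real] by simp
  also have "\<dots> = (if n = 0 then 1 else if n = 1 then - 1 else 0)"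
    by (cases n) (auto simp: binomial_eq_0)
  finally show ?thesis .
qed

text \<open>
  If \<open>G\<close> represents the form, then \<open>X = 1 - G / C\<close> is a contraction by the Cauchy-Schwarz inequality
  for the form of \<open>X\<close>.  The Taylor series of \<open>sqrt (1 - X)\<close> therefore converges in norm, and
  \<open>sqrt C\<close> times its sum is a self-adjoint square root of \<open>G\<close>.
\<close>

lemma psd_form_factors:
  fixes g :: "'a::chilbert_space \<Rightarrow> 'a \<Rightarrow> complex"
  assumes g: "psd_form g" and C: "\<And>x. Re (g x x) \<le> C * (norm x)\<^sup>2" and C_pos: "C > 0"
  obtains R where "bounded_op R" "\<And>x y. g x y = cinner (R x) (R y)"
proof -
  note gs = psd_form_simps[OF g]
  note bound = psd_form_norm_le[OF g C less_imp_le[OF C_pos]]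
  have "\<exists>w. \<forall>y. g x y = cinner w y" for x
    by (rule riesz_complex[OF hilbert_subspace_UNIV, of "g x" "C * norm x"]) (auto simp: gs bound)
  then obtain G where G: "\<And>x y. g x y = cinner (G x) y"
    by metis
  have G_add: "G (x + y) = G x + G y" for x y
  proof (rule cinner_ext)
    fix z show "cinner z (G (x + y)) = cinner z (G x + G y)"
      by (subst (1 2) cinner_commute) (simp add: cinner_simps G[symmetric] gs)
  qed
  have G_scale: "G (a *\<^sub>C x) = a *\<^sub>C G x" for a x
  proof (rule cinner_ext)
    fix z show "cinner z (G (a *\<^sub>C x)) = cinner z (a *\<^sub>C G x)"
      by (subst (1 2) cinner_commute) (simp add: cinner_simps G[symmetric] gs)
  qed
  define X where "X x = x - (1 / C) *\<^sub>R G x" for x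
  define k where "k x y = cinner (X x) y" for x y
  have k: "k x y = cinner x y - g x y / of_real C" for x y
    unfolding k_def X_def by (simp add: cinner_simps G)
  have psd_k: "psd_form k"
  proof (rule psd_formI)
    show "k x y = cnj (k y x)" for x y
      unfolding k by (simp add: cinner_commute[of y x] psd_form_commute[OF g, of y x])
    show "0 \<le> Re (k x x)" for x
      unfolding k using C[of x] C_pos by (simp add: Re_cinner_self field_simps)
  qed (simp_all add: k gs cinner_simps add_divide_distrib right_diff_distrib)
  have k_le: "Re (k x x) \<le> (norm x)\<^sup>2" for x
    unfolding k using psd_form_nonneg[OF g, of x] C_pos by (simp add: Re_cinner_self)
  have X_le: "norm (X x) \<le> 1 * norm x" for x
  proof -
    have "((norm (X x))\<^sup>2)\<^sup>2 = (cmod (k x (X x)))\<^sup>2"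
      unfolding k_def cinner_self by (simp add: norm_power)
    also have "\<dots> \<le> Re (k x x) * Re (k (X x) (X x))"
      by (rule psd_form_Cauchy_Schwarz[OF psd_k])
    also have "\<dots> \<le> (norm x)\<^sup>2 * (norm (X x))\<^sup>2"
      by (intro mult_mono k_le psd_form_nonneg[OF psd_k]) simp
    finally have *: "(norm (X x))\<^sup>2 * (norm (X x))\<^sup>2 \<le> (norm x)\<^sup>2 * (norm (X x))\<^sup>2"
      by (simp only: power2_eq_square[of "(norm (X x))\<^sup>2"])
    show ?thesis
    proof (cases "X x = 0")
      case False
      then have "(norm (X x))\<^sup>2 \<le> (norm x)\<^sup>2"
        by (intro mult_right_le_imp_le[OF *]) simp
      then show ?thesis
        by simp
    qed simp
  qed
  have X: "bounded_op X"
    by (rule bounded_opI[OF _ _ X_le])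
      (simp_all add: X_def G_add G_scale algebra_simps complex_vector.scale_right_diff_distrib
        scaleR_eq_scaleC[where ?'a = 'a] scaleC_scaleC mult.commute)
  interpret op_power_series X 1
    by standard (use X X_le in auto)
  have X_sym: "cinner (X x) y = cinner x (X y)" for x y
    using psd_form_commute[OF psd_k, of x y] cinner_commute[of x "X y"] unfolding k_def by simp
  have sym_pow: "cinner ((X ^^ n) x) y = cinner x ((X ^^ n) y)" for n x y
    by (induction n arbitrary: x y) (simp_all add: X_sym funpow_swap1)
  define c where "c n = complex_of_real (sqrt_coeff n)" for n
  have c: "summable (\<lambda>n. cmod (c n) * 1 ^ n)"
    unfolding c_def using summable_abs_sqrt_coeff by simp
  define S where "S = op_series c X"
  have S_op: "bounded_op S"
    unfolding S_def by (rule bounded_op_op_series[OF c])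
  have "S (S y) = y - X y" for y
  proof -
    have "(\<Sum>i\<le>n. c i * c (n - i)) = (if n = 0 then 1 else if n = 1 then - 1 else 0)" for n
      unfolding c_def of_real_mult[symmetric] of_real_sum[symmetric] sqrt_coeff_convolution by simp
    then have "S (S y) = (\<Sum>n. (if n = 0 then 1 else if n = 1 then - 1 else 0) *\<^sub>C (X ^^ n) y)"
      unfolding S_def op_series_compose[OF c c] by (simp add: op_series_def)
    also have "\<dots> = (\<Sum>n\<in>{0, 1}. (if n = 0 then 1 else if n = 1 then - 1 else 0) *\<^sub>C (X ^^ n) y)"
      by (rule suminf_finite) auto
    finally show ?thesis by simp
  qed
  moreover have "cinner (S x) y = cinner x (S y)" for x y
  proof -
    have "cinner (S x) y = (\<Sum>n. cinner (c n *\<^sub>C (X ^^ n) x) y)"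
      unfolding S_def op_series_def
      by (rule bounded_linear.suminf[OF bounded_bilinear.bounded_linear_left[OF bounded_bilinear_cinner]
            summable_terms[OF c]])
    also have "\<dots> = (\<Sum>n. cinner x (c n *\<^sub>C (X ^^ n) y))"
      by (simp add: cinner_simps sym_pow c_def)
    also have "\<dots> = cinner x (S y)"
      unfolding S_def op_series_def
      by (rule bounded_linear.suminf[OF bounded_bilinear.bounded_linear_right[OF bounded_bilinear_cinner]
            summable_terms[OF c], symmetric])
    finally show ?thesis .
  qed
  ultimately have SS: "cinner (S x) (S y) = cinner x (y - X y)" for x y
    by simp
  define R where "R x = sqrt C *\<^sub>R S x" for x
  have "bounded_op R"
    unfolding bounded_op_iff_bounded_linear
  proof (intro conjI allI)
    show "bounded_linear R"
      unfolding R_def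
      by (rule bounded_linear_compose[OF bounded_linear_scaleR_right bounded_op_bounded_linear[OF S_op]])
    show "R (a *\<^sub>C x) = a *\<^sub>C R x" for a x
      unfolding R_def by (simp add: bounded_op_scaleC[OF S_op] scaleR_eq_scaleC[where ?'a = 'a]
          scaleC_scaleC mult.commute)
  qed
  moreover have "g x y = cinner (R x) (R y)" for x y
  proof -
    have "sqrt C * sqrt C = C"
      using C_pos by simp
    then have "cinner (R x) (R y) = of_real C * cinner (S x) (S y)"
      unfolding R_def by (simp add: cinner_simps mult.assoc[symmetric] flip: of_real_mult)
    moreover have "cinner (S x) (S y) = cinner x y - k x y"
      unfolding SS k_def X_sym by (rule psd_form_diff_right[OF psd_form_cinner])
    ultimately show ?thesis
      using C_pos by (simp add: k)
  qed
  ultimately show ?thesis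
    by (rule that)
qed

section \<open>An invariant mean on the line\<close>

text \<open>
  All bounded sequences of complex numbers converge along a common filter finer than
  \<^term>\<open>sequentially\<close>: by Tychonoff's theorem the evaluation functionals at the natural numbers
  cluster in a product of compact sets, one factor for each bounded sequence.
\<close>

lemma filter_bounded_sequences_converge:
  obtains U :: "nat filter" where "U \<noteq> bot" "U \<le> sequentially"
    "\<forall>f :: nat \<Rightarrow> complex. bounded (range f) \<longrightarrow> (\<exists>l. (f \<longlongrightarrow> l) U)"
proof -
  define E :: "nat \<Rightarrow> (nat \<Rightarrow> complex) \<Rightarrow> complex"
    where "E n f = (if bounded (range f) then f n else 0)" for n f
  define K where "K = PiE UNIV (\<lambda>f. closure (range (\<lambda>n. E n f)))"
  have "compact (closure (range (\<lambda>n. E n f)))" for f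
  proof -
    have "bounded (range (\<lambda>n. E n f))"
      by (cases "bounded (range f)") (simp_all add: E_def)
    then show ?thesis
      by (simp add: compact_closure)
  qed
  then have "compactin (product_topology (\<lambda>_. euclidean) UNIV) K"
    unfolding K_def compactin_PiE by (simp add: compactin_euclidean_iff)
  then have K: "compact K"
    by (simp add: euclidean_product_topology compactin_euclidean_iff)
  let ?F = "filtermap E sequentially"
  have "?F \<noteq> bot"
    by (simp add: filtermap_bot_iff)
  moreover have "eventually (\<lambda>x. x \<in> K) ?F"
    unfolding eventually_filtermap
  proof (intro always_eventually allI)
    fix n
    show "E n \<in> K"
      unfolding K_def using closure_subset by fastforce
  qed
  ultimately obtain \<phi> where \<phi>: "inf (nhds \<phi>) ?F \<noteq> bot"
    using K unfolding compact_filter by blast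
  define U where "U = inf sequentially (filtercomap E (nhds \<phi>))"
  have "U \<noteq> bot"
  proof
    assume "U = bot"
    then have "eventually (\<lambda>_. False) U"
      by simp
    then obtain P Q where P: "eventually P sequentially" and Q: "eventually Q (filtercomap E (nhds \<phi>))"
      and PQ: "\<And>n. P n \<Longrightarrow> Q n \<Longrightarrow> False"
      unfolding U_def eventually_inf by blast
    obtain N where N: "eventually N (nhds \<phi>)" "\<And>n. N (E n) \<Longrightarrow> Q n"
      using Q unfolding eventually_filtercomap by blast
    have "eventually (\<lambda>x. \<not> N x) ?F"
      unfolding eventually_filtermap using P by (rule eventually_mono) (use N(2) PQ in blast)
    with N(1) have "eventually (\<lambda>_. False) (inf (nhds \<phi>) ?F)"
      unfolding eventually_inf by blast
    with \<phi> show False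
      by (simp add: eventually_False)
  qed
  moreover have "U \<le> sequentially"
    unfolding U_def by simp
  moreover have "\<exists>l. (f \<longlongrightarrow> l) U" if f: "bounded (range f)" for f :: "nat \<Rightarrow> complex"
  proof -
    have "filterlim E (nhds \<phi>) U"
      unfolding U_def by (rule filterlim_mono[OF filterlim_filtercomap order_refl]) simp
    moreover have "continuous_on UNIV (\<lambda>x :: (nat \<Rightarrow> complex) \<Rightarrow> complex. x f)"
      by (rule continuous_on_product_coordinates)
    ultimately have "((\<lambda>n. E n f) \<longlongrightarrow> \<phi> f) U"
      using continuous_on_tendsto_compose[of UNIV "\<lambda>x. x f" E \<phi> U] by simp
    then show ?thesis
      using f unfolding E_def by auto
  qed
  ultimately show ?thesis
    by (intro that[of U]) auto
qed

definition bounded_continuous :: "(real \<Rightarrow> complex) \<Rightarrow> bool" where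
  "bounded_continuous f \<longleftrightarrow> continuous_on UNIV f \<and> bounded (range f)"

text \<open>
  Invariance under translations enters in infinitesimal form: the mean of a derivative vanishes.
\<close>

definition invariant_mean :: "((real \<Rightarrow> complex) \<Rightarrow> complex) \<Rightarrow> bool" where
  "invariant_mean \<Lambda> \<longleftrightarrow>
     (\<forall>f h. bounded_continuous f \<longrightarrow> bounded_continuous h \<longrightarrow> \<Lambda> (\<lambda>t. f t + h t) = \<Lambda> f + \<Lambda> h) \<and>
     (\<forall>f a. bounded_continuous f \<longrightarrow> \<Lambda> (\<lambda>t. a * f t) = a * \<Lambda> f) \<and>
     (\<forall>f. bounded_continuous f \<longrightarrow> \<Lambda> (\<lambda>t. cnj (f t)) = cnj (\<Lambda> f)) \<and>
     (\<forall>f. bounded_continuous f \<longrightarrow> (\<forall>t. 0 \<le> Re (f t)) \<longrightarrow> 0 \<le> Re (\<Lambda> f)) \<and>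
     (\<forall>a. \<Lambda> (\<lambda>_. a) = a) \<and>
     (\<forall>f f'. bounded_continuous f \<longrightarrow> bounded_continuous f' \<longrightarrow>
        (\<forall>t. (f has_vector_derivative f' t) (at t)) \<longrightarrow> \<Lambda> f' = 0)"

lemma bounded_continuousD:
  assumes "bounded_continuous f"
  obtains M where "M > 0" "\<forall>t. cmod (f t) \<le> M"
  using assms unfolding bounded_continuous_def bounded_pos by auto

lemma bounded_continuousI:
  assumes "continuous_on UNIV f" "\<And>t. cmod (f t) \<le> M"
  shows "bounded_continuous f"
  using assms unfolding bounded_continuous_def bounded_iff by auto

text \<open>The mean is a limit of \<open>1/n \<integral>\<^sub>0\<^sup>n f\<close>; on a derivative this is \<open>(f n - f 0) / n\<close>.\<close>

lemma invariant_mean_exists: "\<exists>\<Lambda>. invariant_mean \<Lambda>"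
proof -
  obtain U :: "nat filter" where U: "U \<noteq> bot" "U \<le> sequentially"
    and conv: "\<forall>f :: nat \<Rightarrow> complex. bounded (range f) \<longrightarrow> (\<exists>l. (f \<longlongrightarrow> l) U)"
    by (rule filter_bounded_sequences_converge)
  define av where "av f n = integral {0..real (Suc n)} f /\<^sub>R real (Suc n)"
    for f :: "real \<Rightarrow> complex" and n
  define \<Lambda> where "\<Lambda> f = Lim U (av f)" for f
  have int: "f integrable_on {0..b}" if "bounded_continuous f" for f b
    using that unfolding bounded_continuous_def
    by (intro integrable_continuous_real) (metis continuous_on_subset subset_UNIV)
  have lim: "(av f \<longlongrightarrow> \<Lambda> f) U" if f: "bounded_continuous f" for f
  proof -
    obtain M where M: "\<forall>t. cmod (f t) \<le> M"
      using bounded_continuousD[OF f] by blast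
    have "cmod (av f n) \<le> M" for n
    proof -
      have "continuous_on {0..real (Suc n)} f"
        using f unfolding bounded_continuous_def by (metis continuous_on_subset subset_UNIV)
      then have "cmod (integral {0..real (Suc n)} f) \<le> M * (real (Suc n) - 0)"
        using M by (intro integral_bound) auto
      then show ?thesis
        unfolding av_def by (simp add: field_simps del: of_nat_Suc)
    qed
    then have "bounded (range (av f))"
      unfolding bounded_iff by blast
    then obtain l where l: "(av f \<longlongrightarrow> l) U"
      using conv by blast
    then show ?thesis
      unfolding \<Lambda>_def tendsto_Lim[OF U(1) l] .
  qed
  have eqI: "\<Lambda> f = l" if "(av f \<longlongrightarrow> l) U" for f l
    unfolding \<Lambda>_def using tendsto_Lim[OF U(1) that] .
  have add: "\<Lambda> (\<lambda>t. f t + h t) = \<Lambda> f + \<Lambda> h" if "bounded_continuous f" "bounded_continuous h" for f h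
  proof (rule eqI)
    have "av (\<lambda>t. f t + h t) = (\<lambda>n. av f n + av h n)"
      unfolding av_def by (simp add: integral_add[OF int[OF that(1)] int[OF that(2)]] scaleR_add_right)
    then show "(av (\<lambda>t. f t + h t) \<longlongrightarrow> \<Lambda> f + \<Lambda> h) U"
      using tendsto_add[OF lim[OF that(1)] lim[OF that(2)]] by simp
  qed
  have scale: "\<Lambda> (\<lambda>t. a * f t) = a * \<Lambda> f" if "bounded_continuous f" for f a
  proof (rule eqI)
    have "av (\<lambda>t. a * f t) = (\<lambda>n. a * av f n)"
      unfolding av_def by simp
    then show "(av (\<lambda>t. a * f t) \<longlongrightarrow> a * \<Lambda> f) U"
      using tendsto_mult[OF tendsto_const lim[OF that]] by simp
  qed
  have cnj: "\<Lambda> (\<lambda>t. cnj (f t)) = cnj (\<Lambda> f)" if "bounded_continuous f" for f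
  proof (rule eqI)
    have "av (\<lambda>t. cnj (f t)) = (\<lambda>n. cnj (av f n))"
      unfolding av_def using integral_linear[OF int[OF that] bounded_linear_cnj] by (simp add: o_def)
    then show "(av (\<lambda>t. cnj (f t)) \<longlongrightarrow> cnj (\<Lambda> f)) U"
      using tendsto_cnj[OF lim[OF that]] by simp
  qed
  have pos: "0 \<le> Re (\<Lambda> f)" if f: "bounded_continuous f" and nonneg: "\<forall>t. 0 \<le> Re (f t)" for f
  proof (rule tendsto_lowerbound[OF tendsto_Re[OF lim[OF f]] _ U(1)])
    have "0 \<le> Re (av f n)" for n
    proof -
      have "Re (integral {0..real (Suc n)} f) = integral {0..real (Suc n)} (\<lambda>t. Re (f t))"
        using integral_linear[OF int[OF f] bounded_linear_Re] by (simp add: o_def)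
      also have "\<dots> \<ge> 0"
        using nonneg integrable_linear[OF int[OF f] bounded_linear_Re]
        by (intro integral_nonneg) (auto simp: o_def)
      finally show ?thesis
        unfolding av_def by simp
    qed
    then show "\<forall>\<^sub>F n in U. 0 \<le> Re (av f n)"
      by simp
  qed
  have const: "\<Lambda> (\<lambda>_. a) = a" for a
  proof (rule eqI)
    have "av (\<lambda>_. a) = (\<lambda>_. a)"
      unfolding av_def by (rule ext) (simp del: of_nat_Suc)
    then show "(av (\<lambda>_. a) \<longlongrightarrow> a) U"
      by simp
  qed
  have derivative: "\<Lambda> f' = 0" if f: "bounded_continuous f" and f': "bounded_continuous f'"
    and deriv: "\<forall>t. (f has_vector_derivative f' t) (at t)" for f f'
  proof (rule eqI)
    obtain M where M: "\<forall>t. cmod (f t) \<le> M"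
      using bounded_continuousD[OF f] by blast
    have "cmod (av f' n) \<le> 2 * M * inverse (real (Suc n))" for n
    proof -
      have "(f' has_integral f (real (Suc n)) - f 0) {0..real (Suc n)}"
        using deriv by (intro fundamental_theorem_of_calculus) (auto intro: has_vector_derivative_at_within)
      then have eq: "integral {0..real (Suc n)} f' = f (real (Suc n)) - f 0"
        by (rule integral_unique)
      have "cmod (f (real (Suc n)) - f 0) \<le> M + M"
        using M by (intro order_trans[OF norm_triangle_ineq4] add_mono) auto
      then have "inverse (real (Suc n)) * cmod (f (real (Suc n)) - f 0) \<le> inverse (real (Suc n)) * (M + M)"
        by (rule mult_left_mono) simp
      then show ?thesis
        unfolding av_def eq norm_scaleR by (simp del: of_nat_Suc)
    qed
    then have "\<forall>\<^sub>F n in sequentially. cmod (av f' n) \<le> 2 * M * inverse (real (Suc n))"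
      by (intro always_eventually allI)
    moreover have "(\<lambda>n. 2 * M * inverse (real (Suc n))) \<longlonglongrightarrow> 2 * M * 0"
      by (intro tendsto_mult tendsto_const LIMSEQ_inverse_real_of_nat)
    ultimately have "av f' \<longlonglongrightarrow> 0"
      unfolding mult_zero_right by (rule Lim_null_comparison)
    then show "(av f' \<longlongrightarrow> 0) U"
      by (rule tendsto_mono[OF U(2)])
  qed
  show ?thesis
    unfolding invariant_mean_def
    by (intro exI[of _ \<Lambda>] conjI allI impI add scale cnj pos const;
        (assumption | erule spec | rule derivative; assumption))
qed

section \<open>Averaging a form over a flow\<close>

lemma bounded_bilinear_psd_form:
  assumes g: "psd_form g" and C: "\<And>x y. cmod (g x y) \<le> C * norm x * norm y"
  shows "bounded_bilinear g"
proof
  show "\<exists>K. \<forall>a b. norm (g a b) \<le> norm a * norm b * K"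
    using C by (intro exI[of _ C]) (simp add: mult_ac)
qed (simp_all add: psd_form_simps[OF g] scaleR_conv_of_real)

text \<open>
  The average \<open>g\<close> of a form \<open>g0\<close> over the flow \<open>e t\<close> with generator \<open>\<i> D\<close> is invariant under the
  flow, so \<open>D\<close> is symmetric for \<open>g\<close>.  Every identity between values of \<open>g0\<close> that holds along the
  whole flow is inherited by \<open>g\<close>.
\<close>

lemma psd_form_average:
  fixes g0 :: "'a::complex_inner \<Rightarrow> 'a \<Rightarrow> complex" and e :: "real \<Rightarrow> 'a \<Rightarrow> 'a"
  assumes g0: "psd_form g0" and C: "\<And>x. Re (g0 x x) \<le> C * (norm x)\<^sup>2" "C \<ge> 0"
    and e_add: "\<And>t x y. e t (x + y) = e t x + e t y" and e_scale: "\<And>t a x. e t (a *\<^sub>C x) = a *\<^sub>C e t x"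
    and deriv: "\<And>t x. ((\<lambda>t. e t x) has_vector_derivative e t (\<i> *\<^sub>C D x)) (at t)"
    and bound: "\<And>x. \<exists>M. \<forall>t. Re (g0 (e t x) (e t x)) \<le> M"
  obtains g where "psd_form g" "\<forall>x y. g (D x) y = g x (D y)"
    "\<forall>x y x' y'. (\<forall>t. g0 (e t x) (e t y) = g0 (e t x') (e t y')) \<longrightarrow> g x y = g x' y'"
    "\<forall>x y a. (\<forall>t. g0 (e t x) (e t y) = a) \<longrightarrow> g x y = a"
proof -
  obtain \<Lambda> where \<Lambda>: "invariant_mean \<Lambda>"
    using invariant_mean_exists by blast
  define F where "F x y t = g0 (e t x) (e t y)" for x y t
  define g where "g x y = \<Lambda> (F x y)" for x y
  note gs = psd_form_simps[OF g0]
  interpret bounded_bilinear g0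
    by (rule bounded_bilinear_psd_form[OF g0 psd_form_norm_le[OF g0 C]])
  have F_deriv: "(F x y has_vector_derivative \<i> * F x (D y) t + - \<i> * F (D x) y t) (at t)" for x y t
    unfolding F_def
    using has_vector_derivative[OF deriv[where x = x and t = t] deriv[where x = y and t = t]]
    by (simp add: e_scale gs)
  have cont: "continuous_on UNIV (F x y)" for x y
    by (intro continuous_at_imp_continuous_on ballI has_vector_derivative_continuous[OF F_deriv])
  have bc: "bounded_continuous (F x y)" for x y
  proof -
    obtain M N where M: "\<And>t. Re (g0 (e t x) (e t x)) \<le> M" and N: "\<And>t. Re (g0 (e t y) (e t y)) \<le> N"
      using bound by metis
    have M0: "M \<ge> 0"
      using M[of 0] psd_form_nonneg[OF g0, of "e 0 x"] by linarith
    have "cmod (F x y t) \<le> sqrt (M * N)" for t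
    proof (rule real_le_rsqrt)
      have "(cmod (F x y t))\<^sup>2 \<le> Re (g0 (e t x) (e t x)) * Re (g0 (e t y) (e t y))"
        unfolding F_def by (rule psd_form_Cauchy_Schwarz[OF g0])
      also have "\<dots> \<le> M * N"
        by (intro mult_mono M N M0 psd_form_nonneg[OF g0])
      finally show "(cmod (F x y t))\<^sup>2 \<le> M * N" .
    qed
    then show ?thesis
      by (rule bounded_continuousI[OF cont])
  qed
  have bc_scale: "bounded_continuous (\<lambda>t. a * F x y t)" for a x y
  proof -
    obtain M where "\<forall>t. cmod (F x y t) \<le> M"
      using bounded_continuousD[OF bc] by blast
    then have "cmod (a * F x y t) \<le> cmod a * M" for t
      by (simp add: norm_mult mult_left_mono)
    then show ?thesis
      by (intro bounded_continuousI[where M = "cmod a * M"] continuous_on_mult continuous_on_const cont)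
  qed
  have bc_sum: "bounded_continuous (\<lambda>t. a * F x y t + b * F x' y' t)" for a x y b x' y'
  proof -
    obtain M where M: "\<forall>t. cmod (a * F x y t) \<le> M"
      using bounded_continuousD[OF bc_scale] by blast
    obtain N where N: "\<forall>t. cmod (b * F x' y' t) \<le> N"
      using bounded_continuousD[OF bc_scale] by blast
    have "cmod (a * F x y t + b * F x' y' t) \<le> M + N" for t
      using M N by (intro order_trans[OF norm_triangle_ineq] add_mono) auto
    then show ?thesis
      by (intro bounded_continuousI[where M = "M + N"] continuous_on_add continuous_on_mult
          continuous_on_const cont)
  qed
  have \<Lambda>_add: "\<Lambda> (\<lambda>t. f t + h t) = \<Lambda> f + \<Lambda> h" if "bounded_continuous f" "bounded_continuous h" for f h
    using \<Lambda> that unfolding invariant_mean_def by blast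
  have \<Lambda>_scale: "\<Lambda> (\<lambda>t. a * f t) = a * \<Lambda> f" if "bounded_continuous f" for f a
    using \<Lambda> that unfolding invariant_mean_def by blast
  have "psd_form g"
  proof (rule psd_formI)
    show "g x (y + z) = g x y + g x z" for x y z
    proof -
      have "F x (y + z) = (\<lambda>t. F x y t + F x z t)"
        unfolding F_def by (simp add: e_add gs)
      then show ?thesis
        unfolding g_def by (simp add: \<Lambda>_add[OF bc bc])
    qed
    show "g x (a *\<^sub>C y) = a * g x y" for a x y
    proof -
      have "F x (a *\<^sub>C y) = (\<lambda>t. a * F x y t)"
        unfolding F_def by (simp add: e_scale gs)
      then show ?thesis
        unfolding g_def by (simp add: \<Lambda>_scale[OF bc])
    qed
    show "g x y = cnj (g y x)" for x y
    proof -
      have "F x y = (\<lambda>t. cnj (F y x t))"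
        unfolding F_def by (rule ext, rule psd_form_commute[OF g0])
      moreover have "\<Lambda> (\<lambda>t. cnj (F y x t)) = cnj (\<Lambda> (F y x))"
        using \<Lambda> bc unfolding invariant_mean_def by blast
      ultimately show ?thesis
        unfolding g_def by simp
    qed
    show "0 \<le> Re (g x x)" for x
    proof -
      have "\<forall>t. 0 \<le> Re (F x x t)"
        unfolding F_def by (intro allI psd_form_nonneg[OF g0])
      then show ?thesis
        unfolding g_def using \<Lambda> bc unfolding invariant_mean_def by blast
    qed
  qed
  moreover have "\<forall>x y. g (D x) y = g x (D y)"
  proof (intro allI)
    fix x y
    have "\<Lambda> (\<lambda>t. \<i> * F x (D y) t + - \<i> * F (D x) y t) = 0"
      using \<Lambda> bc[of x y] bc_sum[of \<i> x "D y" "- \<i>" "D x" y] F_deriv[of x y]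
      unfolding invariant_mean_def by blast
    then have "\<i> * g x (D y) + - \<i> * g (D x) y = 0"
      unfolding g_def by (simp only: \<Lambda>_add[OF bc_scale bc_scale] \<Lambda>_scale[OF bc])
    then have "\<i> * (g x (D y) - g (D x) y) = 0"
      by (simp add: algebra_simps)
    then show "g (D x) y = g x (D y)"
      by simp
  qed
  moreover have "g x y = g x' y'" if "\<forall>t. g0 (e t x) (e t y) = g0 (e t x') (e t y')" for x y x' y'
  proof -
    have "F x y = F x' y'"
      unfolding F_def using that by (intro ext) blast
    then show ?thesis
      unfolding g_def by simp
  qed
  moreover have "g x y = a" if "\<forall>t. g0 (e t x) (e t y) = a" for x y a
  proof -
    have "F x y = (\<lambda>_. a)"
      unfolding F_def using that by (intro ext) blast
    moreover have "\<Lambda> (\<lambda>_. a) = a"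
      using \<Lambda> unfolding invariant_mean_def by blast
    ultimately show ?thesis
      unfolding g_def by simp
  qed
  ultimately show ?thesis
    by (intro that[of g]) auto
qed

text \<open>
  An operator that is symmetric for a bounded form is bounded in the seminorm of the form (Krein,
  Lax): the numbers \<open>g (D\<^sup>n x) (D\<^sup>n x)\<close> are logarithmically convex in \<open>n\<close> and grow at most like
  \<open>M\<^sup>2\<^sup>n\<close>, so already their first quotient is at most \<open>M\<^sup>2\<close>.
\<close>

lemma symmetric_operator_form_bound:
  assumes g: "psd_form g" and C: "\<And>x. Re (g x x) \<le> C * (norm x)\<^sup>2"
    and sym: "\<forall>x y. g (D x) y = g x (D y)"
    and M: "\<And>x. norm (D x) \<le> M * norm x" "M > 0"
  shows "Re (g (D x) (D x)) \<le> M\<^sup>2 * Re (g x x)"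
proof (rule ccontr)
  assume "\<not> Re (g (D x) (D x)) \<le> M\<^sup>2 * Re (g x x)"
  define a where "a n = Re (g ((D ^^ n) x) ((D ^^ n) x))" for n
  have a0: "0 \<le> a n" for n
    unfolding a_def by (rule psd_form_nonneg[OF g])
  have conv: "(a (Suc n))\<^sup>2 \<le> a n * a (Suc (Suc n))" for n
  proof -
    let ?y = "(D ^^ n) x"
    have "g (D ?y) (D ?y) = g ?y (D (D ?y))"
      using sym by blast
    then have "a (Suc n) = Re (g ?y (D (D ?y)))"
      unfolding a_def by simp
    then have "\<bar>a (Suc n)\<bar> \<le> cmod (g ?y (D (D ?y)))"
      using abs_Re_le_cmod by simp
    then have "(a (Suc n))\<^sup>2 \<le> (cmod (g ?y (D (D ?y))))\<^sup>2"
      by (simp add: abs_le_square_iff[symmetric])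
    also have "\<dots> \<le> a n * a (Suc (Suc n))"
      unfolding a_def using psd_form_Cauchy_Schwarz[OF g, of ?y "D (D ?y)"] by simp
    finally show ?thesis .
  qed
  have lt: "M\<^sup>2 * a 0 < a 1"
    using \<open>\<not> _\<close> unfolding a_def by simp
  have "a 0 \<noteq> 0"
  proof
    assume "a 0 = 0"
    with conv[of 0] have "a 1 = 0" by simp
    with lt \<open>a 0 = 0\<close> show False by simp
  qed
  with a0[of 0] have pos0: "a 0 > 0" by simp
  define r where "r = a 1 / a 0"
  have r: "M\<^sup>2 < r" "a 1 = r * a 0"
    using lt pos0 by (simp_all add: r_def less_divide_eq)
  have r0: "r > 0"
    using r(1) by (rule order_le_less_trans[rotated]) simp
  have step: "0 < a n \<and> r * a n \<le> a (Suc n)" for n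
  proof (induction n)
    case 0
    then show ?case using pos0 r(2) by simp
  next
    case (Suc n)
    then have "0 < r * a n"
      using r0 by simp
    then have pos: "0 < a (Suc n)"
      using Suc by linarith
    have "a n * (r * a (Suc n)) \<le> a (Suc n) * a (Suc n)"
      using mult_right_mono[OF conjunct2[OF Suc], of "a (Suc n)"] pos by (simp add: mult_ac)
    also have "\<dots> \<le> a n * a (Suc (Suc n))"
      using conv[of n] by (simp add: power2_eq_square)
    finally have "r * a (Suc n) \<le> a (Suc (Suc n))"
      using Suc by simp
    with pos show ?case by simp
  qed
  have lower: "r ^ n * a 0 \<le> a n" for n
  proof (induction n)
    case (Suc n)
    have "r ^ Suc n * a 0 \<le> r * a n"
      using mult_left_mono[OF Suc, of r] r0 by (simp add: mult_ac)
    then show ?case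
      using step[of n] by linarith
  qed simp
  have upper: "a n \<le> (\<bar>C\<bar> * (norm x)\<^sup>2) * (M\<^sup>2) ^ n" for n
  proof -
    have "a n \<le> C * (norm ((D ^^ n) x))\<^sup>2"
      unfolding a_def by (rule C)
    also have "\<dots> \<le> \<bar>C\<bar> * (M ^ n * norm x)\<^sup>2"
      using norm_funpow_le[OF M(1), of n x] M(2)
      by (intro mult_mono power_mono) auto
    also have "\<dots> = (\<bar>C\<bar> * (norm x)\<^sup>2) * (M\<^sup>2) ^ n"
      by (simp add: power_mult_distrib power_mult[symmetric] mult.commute[of 2])
    finally show ?thesis .
  qed
  have q: "1 < r / M\<^sup>2"
    using r(1) M(2) by simp
  obtain n where n: "(\<bar>C\<bar> * (norm x)\<^sup>2) / a 0 < (r / M\<^sup>2) ^ n"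
    using real_arch_pow[OF q] by blast
  have Mn: "(M\<^sup>2) ^ n > 0"
    using M(2) by simp
  have "r ^ n * a 0 \<le> (\<bar>C\<bar> * (norm x)\<^sup>2) * (M\<^sup>2) ^ n"
    using lower[of n] upper[of n] by linarith
  moreover have "(\<bar>C\<bar> * (norm x)\<^sup>2) * (M\<^sup>2) ^ n < r ^ n * a 0"
    using n pos0 Mn by (simp add: power_divide field_simps)
  ultimately show False by linarith
qed

section \<open>The coefficients of a commuting 3-symmetric pair\<close>

lemma coefficient_index_set:
  "{(j :: nat, k :: nat). 0 < j + k \<and> j + k \<le> 2} = {(1, 0), (0, 1), (1, 1), (2, 0), (0, 2)}"
  by auto

text \<open>
  The operator identity for the exponentials is used through inner products of the orbits
  \<open>exp(\<i> s\<^sub>1 T\<^sub>1) exp(\<i> s\<^sub>2 T\<^sub>2) x\<close>; it says that they are quadratic polynomials in \<open>(s\<^sub>1, s\<^sub>2)\<close>.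
\<close>

locale symmetric_pair =
  fixes T1 T2 :: "'h::chilbert_space \<Rightarrow> 'h" and B :: "nat \<Rightarrow> nat \<Rightarrow> 'h \<Rightarrow> 'h"
  assumes symmetric: "commuting_3_symmetric T1 T2 B"
begin

lemma T1: "bounded_op T1" and T2: "bounded_op T2" and comm: "T1 (T2 x) = T2 (T1 x)"
  using symmetric unfolding commuting_3_symmetric_def by (auto dest: fun_cong[of _ _ x])

definition gram :: "real \<Rightarrow> real \<Rightarrow> 'h \<Rightarrow> 'h \<Rightarrow> complex" where
  "gram s1 s2 x y = cinner (exp_i s1 T1 (exp_i s2 T2 x)) (exp_i s1 T1 (exp_i s2 T2 y))"

lemma gram_eq:
  "gram s1 s2 x y = cinner x y + of_real s1 * cinner x (B 1 0 y) + of_real s2 * cinner x (B 0 1 y)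
     + of_real (s1 * s2) * cinner x (B 1 1 y) + of_real (s1\<^sup>2) * cinner x (B 2 0 y)
     + of_real (s2\<^sup>2) * cinner x (B 0 2 y)"
proof -
  note z1 = bounded_op_exp_i[OF T1, of s1] and z2 = bounded_op_exp_i[OF T2, of s2]
  have "gram s1 s2 x y = cinner x ((cadjoint (exp_i s2 T2) \<circ> cadjoint (exp_i s1 T1)
      \<circ> exp_i s1 T1 \<circ> exp_i s2 T2) y)"
    unfolding gram_def by (simp add: cadjoint[OF z1] cadjoint[OF z2])
  also have "cadjoint (exp_i s2 T2) \<circ> cadjoint (exp_i s1 T1) \<circ> exp_i s1 T1 \<circ> exp_i s2 T2
      = (\<lambda>x. x + (\<Sum>(j, k) \<in> {(j, k). 0 < j + k \<and> j + k \<le> 2}. (s1 ^ j * s2 ^ k) *\<^sub>R B j k x))"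
    using symmetric unfolding commuting_3_symmetric_def by blast
  finally show ?thesis
    unfolding coefficient_index_set by (simp add: cinner_simps)
qed

lemma gram_shift1: "gram (s1 + t) s2 x y = gram s1 s2 (exp_i t T1 x) (exp_i t T1 y)"
proof -
  have "T2 (exp_i t T1 x) = exp_i t T1 (T2 x)" for x
    by (rule exp_i_commute[OF T1 T2 comm[symmetric]])
  then have "exp_i t T1 (exp_i s2 T2 x) = exp_i s2 T2 (exp_i t T1 x)" for x
    by (intro exp_i_commute[OF T2 bounded_op_exp_i[OF T1]]) simp
  then show ?thesis
    unfolding gram_def by (simp add: exp_i_add[OF T1])
qed

lemma gram_shift2: "gram s1 (s2 + t) x y = gram s1 s2 (exp_i t T2 x) (exp_i t T2 y)"
  unfolding gram_def by (simp add: exp_i_add[OF T2])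

lemma bounded_bilinear_gram: "bounded_bilinear (gram s1 s2)"
proof -
  have "bounded_linear (\<lambda>x. exp_i s1 T1 (exp_i s2 T2 x))"
    by (rule bounded_linear_compose[OF bounded_op_bounded_linear[OF bounded_op_exp_i[OF T1]]
          bounded_op_bounded_linear[OF bounded_op_exp_i[OF T2]]])
  then show ?thesis
    unfolding gram_def[abs_def] by (intro bounded_bilinear.comp[OF bounded_bilinear_cinner])
qed

lemma gram_scaleC_left: "gram s1 s2 (a *\<^sub>C x) y = cnj a * gram s1 s2 x y"
  and gram_scaleC_right: "gram s1 s2 x (a *\<^sub>C y) = a * gram s1 s2 x y"
  unfolding gram_def
  by (simp_all add: bounded_op_scaleC[OF bounded_op_exp_i[OF T1]]
      bounded_op_scaleC[OF bounded_op_exp_i[OF T2]] cinner_simps)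

lemma gram_flow_derivative:
  assumes T: "bounded_op T"
  shows "((\<lambda>t. gram s1 s2 (exp_i t T x) (exp_i t T y)) has_vector_derivative
    \<i> * (gram s1 s2 x (T y) - gram s1 s2 (T x) y)) (at 0)"
proof -
  have "((\<lambda>t. gram s1 s2 (exp_i t T x) (exp_i t T y)) has_vector_derivative
    gram s1 s2 (exp_i 0 T x) (exp_i 0 T (\<i> *\<^sub>C T y)) + gram s1 s2 (exp_i 0 T (\<i> *\<^sub>C T x)) (exp_i 0 T y)) (at 0)"
    by (rule bounded_bilinear.has_vector_derivative[OF bounded_bilinear_gram
          exp_i_derivative[OF T] exp_i_derivative[OF T]])
  then show ?thesis
    by (simp add: exp_i_zero[OF T] gram_scaleC_left gram_scaleC_right algebra_simps)
qed

lemma gram_derivative1: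
  "cinner x (B 1 0 y) + of_real s2 * cinner x (B 1 1 y) + of_real (2 * s1) * cinner x (B 2 0 y)
    = \<i> * (gram s1 s2 x (T1 y) - gram s1 s2 (T1 x) y)"
proof (rule vector_derivative_unique_at)
  show "((\<lambda>t. gram (s1 + t) s2 x y) has_vector_derivative
      \<i> * (gram s1 s2 x (T1 y) - gram s1 s2 (T1 x) y)) (at 0)"
    unfolding gram_shift1 by (rule gram_flow_derivative[OF T1])
  show "((\<lambda>t. gram (s1 + t) s2 x y) has_vector_derivative
      cinner x (B 1 0 y) + of_real s2 * cinner x (B 1 1 y) + of_real (2 * s1) * cinner x (B 2 0 y)) (at 0)"
  proof -
    have "((\<lambda>z. cinner x y + (of_real s1 + z) * cinner x (B 1 0 y) + of_real s2 * cinner x (B 0 1 y)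
        + (of_real s1 + z) * of_real s2 * cinner x (B 1 1 y) + (of_real s1 + z)\<^sup>2 * cinner x (B 2 0 y)
        + of_real (s2\<^sup>2) * cinner x (B 0 2 y)) has_field_derivative
      cinner x (B 1 0 y) + of_real s2 * cinner x (B 1 1 y) + of_real (2 * s1) * cinner x (B 2 0 y))
      (at (of_real 0))"
      by (auto intro!: derivative_eq_intros)
    from has_vector_derivative_real_field[OF this] show ?thesis
      unfolding gram_eq by simp
  qed
qed

lemma gram_derivative2:
  "cinner x (B 0 1 y) + of_real s1 * cinner x (B 1 1 y) + of_real (2 * s2) * cinner x (B 0 2 y)
    = \<i> * (gram s1 s2 x (T2 y) - gram s1 s2 (T2 x) y)"
proof (rule vector_derivative_unique_at)
  show "((\<lambda>t. gram s1 (s2 + t) x y) has_vector_derivative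
      \<i> * (gram s1 s2 x (T2 y) - gram s1 s2 (T2 x) y)) (at 0)"
    unfolding gram_shift2 by (rule gram_flow_derivative[OF T2])
  show "((\<lambda>t. gram s1 (s2 + t) x y) has_vector_derivative
      cinner x (B 0 1 y) + of_real s1 * cinner x (B 1 1 y) + of_real (2 * s2) * cinner x (B 0 2 y)) (at 0)"
  proof -
    have "((\<lambda>z. cinner x y + of_real s1 * cinner x (B 1 0 y) + (of_real s2 + z) * cinner x (B 0 1 y)
        + of_real s1 * (of_real s2 + z) * cinner x (B 1 1 y) + of_real (s1\<^sup>2) * cinner x (B 2 0 y)
        + (of_real s2 + z)\<^sup>2 * cinner x (B 0 2 y)) has_field_derivative
      cinner x (B 0 1 y) + of_real s1 * cinner x (B 1 1 y) + of_real (2 * s2) * cinner x (B 0 2 y))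
      (at (of_real 0))"
      by (auto intro!: derivative_eq_intros)
    from has_vector_derivative_real_field[OF this] show ?thesis
      unfolding gram_eq by simp
  qed
qed

text \<open>
  Up to a factor \<open>2\<close>, the coefficients of order one and two arise from those of lower order by the
  derivation \<open>X \<mapsto> \<i> (X T - T\<^sup>* X)\<close> with \<open>T = T1\<close> or \<open>T = T2\<close>.  Both sides of the derivative formulas
  are polynomials in \<open>(s1, s2)\<close>.  The constant terms are compared at the origin, the linear terms
  through the difference of the values at \<open>1\<close> and \<open>- 1\<close> on one axis.
\<close>

lemma B10: "cinner x (B 1 0 y) = \<i> * (cinner x (T1 y) - cinner (T1 x) y)"
  using gram_derivative1[of x y 0 0] by (simp add: gram_eq)

lemma B01: "cinner x (B 0 1 y) = \<i> * (cinner x (T2 y) - cinner (T2 x) y)"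
  using gram_derivative2[of x y 0 0] by (simp add: gram_eq)

lemma B20: "2 * cinner x (B 2 0 y) = \<i> * (cinner x (B 1 0 (T1 y)) - cinner (T1 x) (B 1 0 y))"
  using gram_derivative1[of x y 0 1] gram_derivative1[of x y 0 "- 1"]
  by (simp add: gram_eq algebra_simps) algebra

lemma B02: "2 * cinner x (B 0 2 y) = \<i> * (cinner x (B 0 1 (T2 y)) - cinner (T2 x) (B 0 1 y))"
  using gram_derivative2[of x y 0 1] gram_derivative2[of x y 0 "- 1"]
  by (simp add: gram_eq algebra_simps) algebra

lemma B11: "cinner x (B 1 1 y) = \<i> * (cinner x (B 0 1 (T1 y)) - cinner (T1 x) (B 0 1 y))"
  using gram_derivative1[of x y 1 0] gram_derivative1[of x y "- 1" 0]
  by (simp add: gram_eq algebra_simps) algebra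

lemma cinner_Q_hat:
  "cinner x (Q_hat c d B \<alpha> \<beta> y) = gram \<alpha> \<beta> x y - cinner x (B 2 0 y) / of_real (c\<^sup>2) - cinner x (B 0 2 y) / of_real (d\<^sup>2)"
  unfolding Q_hat_def gram_eq by (simp add: cinner_simps field_simps)

section \<open>A lifting yields a factorization\<close>

lemma continuous_on_clinear:
  assumes "clinear_on UNIV f" "\<And>x. norm (f x) \<le> M * norm x"
  shows "continuous_on UNIV f"
proof -
  have "bounded_linear f"
    using assms(2) clinear_onD(1)[OF assms(1)] clinear_on_scaleR[OF assms(1) complex_vector.subspace_UNIV]
    by (intro bounded_linear_intro[where K = M]) (auto simp: mult.commute)
  then show ?thesis
    by (rule bounded_linear.continuous_on[OF _ continuous_on_id])
qed

text \<open>
  Let \<open>a\<close>, \<open>b\<close>, \<open>e\<close> be the components of the lifting isometry.  The derivation given by \<open>T1\<close>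
  sends \<open>a\<^sup>* a\<close> to \<open>c (a\<^sup>* b + b\<^sup>* a)\<close>, this to \<open>2 c\<^sup>2 b\<^sup>* b\<close>, and \<open>b\<^sup>* b\<close>, \<open>e\<^sup>* e\<close> to \<open>0\<close>; the one given
  by \<open>T2\<close> acts likewise with \<open>d\<close>, \<open>e\<close> in place of \<open>c\<close>, \<open>b\<close>.  Starting from
  \<open>1 = a\<^sup>* a + b\<^sup>* b + e\<^sup>* e\<close>, this determines all coefficients, and
  \<open>a + \<alpha> c b + \<beta> d e\<close> factors the polynomial.  It takes values in the model space, from which
  an isometry carries them back to \<open>H\<close>.
\<close>

lemma factorization_of_lifting:
  fixes F :: "'f::chilbert_space set"
  assumes F: "hilbert_subspace F" and lift: "lifts_to_model c d T1 T2 F" and c: "c > 0" and d: "d > 0"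
  shows "(\<forall>\<alpha> \<beta>. psd (Q_hat c d B \<alpha> \<beta>)) \<and> factors_linearly (Q_hat c d B)"
proof -
  obtain A1 A2 V where A: "self_adjoint_on F A1" "self_adjoint_on F A2"
    and V: "V \<in> UNIV \<rightarrow> F \<times> F \<times> F" "clinear_on UNIV V" "\<forall>x. norm (V x) = norm x"
    and VT: "\<forall>x. V (T1 x) = model1 c A1 (V x)" "\<forall>x. V (T2 x) = model2 d A2 (V x)"
    using lift unfolding lifts_to_model_def lifts_to_def by (elim exE conjE) (rule that)
  define a where "a x = fst (V x)" for x
  define b where "b x = fst (snd (V x))" for x
  define e where "e x = snd (snd (V x))" for x
  have V_eq: "V x = (a x, b x, e x)" for x
    unfolding a_def b_def e_def by simp
  have aF: "a x \<in> F" and bF: "b x \<in> F" and eF: "e x \<in> F" for x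
    using V(1) V_eq[of x] by (auto simp: Pi_iff dest!: spec[of _ x])
  have rel1: "a (T1 x) = A1 (a x) + (- \<i> * of_real c) *\<^sub>C b x" "b (T1 x) = A1 (b x)" "e (T1 x) = A1 (e x)" for x
    using VT(1) unfolding V_eq model1_def by simp_all
  have rel2: "a (T2 x) = A2 (a x) + (- \<i> * of_real d) *\<^sub>C e x" "b (T2 x) = A2 (b x)" "e (T2 x) = A2 (e x)" for x
    using VT(2) unfolding V_eq model2_def by simp_all
  have "V (x + y) = V x + V y" "V (s *\<^sub>C x) = s *\<^sub>C V x" for x y s
    using clinear_onD[OF V(2)] by simp_all
  then have lin: "clinear_on UNIV a" "clinear_on UNIV b" "clinear_on UNIV e"
    unfolding clinear_on_def V_eq by (simp_all add: scaleC_prod_def)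
  have sa1: "cinner (A1 u) v = cinner u (A1 v)" and sa2: "cinner (A2 u) v = cinner u (A2 v)"
    if "u \<in> F" "v \<in> F" for u v
    using A that unfolding self_adjoint_on_def by blast+
  have iso: "cinner x y = cinner (a x) (a y) + cinner (b x) (b y) + cinner (e x) (e y)" for x y
  proof -
    have "cinner (V x) (V y) = cinner x y"
      using V(3) by (intro clinear_isometry_cinner[OF V(2) complex_vector.subspace_UNIV]) auto
    then show ?thesis
      unfolding V_eq by (simp add: cinner_prod_def add.assoc)
  qed
  note rules = rel1 rel2 cinner_simps sa1[OF aF aF] sa1[OF aF bF] sa1[OF aF eF] sa1[OF bF aF]
    sa1[OF bF bF] sa1[OF bF eF] sa1[OF eF aF] sa1[OF eF bF] sa1[OF eF eF]
    sa2[OF aF aF] sa2[OF aF bF] sa2[OF aF eF] sa2[OF bF aF]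
    sa2[OF bF bF] sa2[OF bF eF] sa2[OF eF aF] sa2[OF eF bF] sa2[OF eF eF]
  have b10: "cinner x (B 1 0 y) = of_real c * (cinner (a x) (b y) + cinner (b x) (a y))" for x y
    unfolding B10 unfolding iso by (simp add: rules algebra_simps)
  have b01: "cinner x (B 0 1 y) = of_real d * (cinner (a x) (e y) + cinner (e x) (a y))" for x y
    unfolding B01 unfolding iso by (simp add: rules algebra_simps)
  have "2 * cinner x (B 2 0 y) = 2 * (of_real (c\<^sup>2) * cinner (b x) (b y))" for x y
    unfolding B20 b10 by (simp add: rules algebra_simps power2_eq_square)
  then have b20: "cinner x (B 2 0 y) = of_real (c\<^sup>2) * cinner (b x) (b y)" for x y
    by simp
  have "2 * cinner x (B 0 2 y) = 2 * (of_real (d\<^sup>2) * cinner (e x) (e y))" for x y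
    unfolding B02 b01 by (simp add: rules algebra_simps power2_eq_square)
  then have b02: "cinner x (B 0 2 y) = of_real (d\<^sup>2) * cinner (e x) (e y)" for x y
    by simp
  have b11: "cinner x (B 1 1 y) = of_real (c * d) * (cinner (b x) (e y) + cinner (e x) (b y))" for x y
    unfolding B11 b01 by (simp add: rules algebra_simps)
  define L where "L \<alpha> \<beta> x = a x + (\<alpha> * c) *\<^sub>R b x + (\<beta> * d) *\<^sub>R e x" for \<alpha> \<beta> x
  have Q: "cinner x (Q_hat c d B \<alpha> \<beta> y) = cinner (L \<alpha> \<beta> x) (L \<alpha> \<beta> y)" for \<alpha> \<beta> x y
  proof -
    have "cinner x (B 2 0 y) / of_real (c\<^sup>2) = cinner (b x) (b y)"
      "cinner x (B 0 2 y) / of_real (d\<^sup>2) = cinner (e x) (e y)"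
      using c d unfolding b20 b02 by simp_all
    then show ?thesis
      unfolding cinner_Q_hat gram_eq L_def b10 b01 b11 b20 b02 iso[of x y]
      by (simp add: cinner_simps algebra_simps power2_eq_square)
  qed
  have "psd (Q_hat c d B \<alpha> \<beta>)" for \<alpha> \<beta>
    unfolding psd_def Q cinner_self by simp
  moreover have "factors_linearly (Q_hat c d B)"
  proof -
    have norm_V: "norm (a x) \<le> 1 * norm x" "norm (b x) \<le> 1 * norm x" "norm (e x) \<le> 1 * norm x" for x
    proof -
      have "(norm x)\<^sup>2 = (norm (a x))\<^sup>2 + (norm (b x))\<^sup>2 + (norm (e x))\<^sup>2"
        using arg_cong[OF iso[of x x], of Re] by (simp add: Re_cinner_self)
      then have "(norm (a x))\<^sup>2 \<le> (norm x)\<^sup>2" "(norm (b x))\<^sup>2 \<le> (norm x)\<^sup>2" "(norm (e x))\<^sup>2 \<le> (norm x)\<^sup>2"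
        by simp_all
      then show "norm (a x) \<le> 1 * norm x" "norm (b x) \<le> 1 * norm x" "norm (e x) \<le> 1 * norm x"
        by simp_all
    qed
    note cont = continuous_on_clinear[OF lin(1) norm_V(1)] continuous_on_clinear[OF lin(2) norm_V(2)]
      continuous_on_clinear[OF lin(3) norm_V(3)]
    have ranges: "range a \<subseteq> F" "range b \<subseteq> F" "range e \<subseteq> F"
      using aF bF eF by blast+
    have cd: "c \<noteq> 0" "d \<noteq> 0"
      using c d by simp_all
    obtain W and h :: "'f \<Rightarrow> 'h" where W: "complex_vector.subspace W"
      "range a \<union> range b \<union> range e \<subseteq> W" and h: "clinear_on W h" "\<forall>x\<in>W. norm (h x) = norm x"
      by (rule ranges_embed_isometrically[OF lin(1) cont(1) ranges(1) lin(2) cont(2) ranges(2)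
            lin(3) cont(3) ranges(3) F A cd rel1(1,2) rel2(1,3)])
    have aW: "a x \<in> W" and bW: "b x \<in> W" and eW: "e x \<in> W" for x
      using W(2) by blast+
    have scW: "r *\<^sub>R u \<in> W" if "u \<in> W" for r u
      using complex_vector.subspace_scale[OF W(1) that] by (simp add: scaleR_eq_scaleC)
    have op: "bounded_op (\<lambda>x. r *\<^sub>R h (f x))"
      if f: "clinear_on UNIV f" "\<And>x. norm (f x) \<le> 1 * norm x" "\<And>x. f x \<in> W" for f r
    proof (rule bounded_opI)
      show "r *\<^sub>R h (f (x + y)) = r *\<^sub>R h (f x) + r *\<^sub>R h (f y)" for x y
        using f(3) by (simp add: clinear_onD(1)[OF f(1)] clinear_onD(1)[OF h(1)] scaleR_add_right)
      show "r *\<^sub>R h (f (s *\<^sub>C x)) = s *\<^sub>C r *\<^sub>R h (f x)" for s x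
        using f(3) by (simp add: clinear_onD(2)[OF f(1)] clinear_onD(2)[OF h(1)]
            scaleR_eq_scaleC[where ?'a = 'h] scaleC_scaleC mult.commute)
      show "norm (r *\<^sub>R h (f x)) \<le> \<bar>r\<bar> * norm x" for x
        using f(2)[of x] h(2) f(3)[of x] by (simp add: mult_left_mono)
    qed
    define V0 where "V0 x = 1 *\<^sub>R h (a x)" for x
    define V1 where "V1 x = c *\<^sub>R h (b x)" for x
    define V2 where "V2 x = d *\<^sub>R h (e x)" for x
    have ops: "bounded_op V0" "bounded_op V1" "bounded_op V2"
      unfolding V0_def[abs_def] V1_def[abs_def] V2_def[abs_def]
      by (rule op[OF lin(1) norm_V(1) aW], rule op[OF lin(2) norm_V(2) bW], rule op[OF lin(3) norm_V(3) eW])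
    have hL: "V0 x + \<alpha> *\<^sub>R V1 x + \<beta> *\<^sub>R V2 x = h (L \<alpha> \<beta> x)" and LW: "L \<alpha> \<beta> x \<in> W" for \<alpha> \<beta> x
      unfolding L_def V0_def V1_def V2_def using aW bW eW scW
      by (simp_all add: clinear_onD(1)[OF h(1)] clinear_on_scaleR[OF h(1) W(1)] complex_vector.subspace_add[OF W(1)])
    have "Q_hat c d B \<alpha> \<beta> = cadjoint (\<lambda>x. V0 x + \<alpha> *\<^sub>R V1 x + \<beta> *\<^sub>R V2 x) \<circ> (\<lambda>x. V0 x + \<alpha> *\<^sub>R V1 x + \<beta> *\<^sub>R V2 x)"
      for \<alpha> \<beta>
    proof
      fix y
      let ?L = "\<lambda>x. V0 x + \<alpha> *\<^sub>R V1 x + \<beta> *\<^sub>R V2 x"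
      have L: "bounded_op ?L"
        by (intro bounded_op_plus bounded_op_scaled ops)
      show "Q_hat c d B \<alpha> \<beta> y = (cadjoint ?L \<circ> ?L) y"
      proof (rule cinner_ext)
        fix x
        have "cinner x ((cadjoint ?L \<circ> ?L) y) = cinner (?L x) (?L y)"
          using cadjoint[OF L, of x "?L y"] by simp
        also have "\<dots> = cinner (L \<alpha> \<beta> x) (L \<alpha> \<beta> y)"
          unfolding hL using h(2) by (intro clinear_isometry_cinner[OF h(1) W(1)] LW) blast
        finally show "cinner x (Q_hat c d B \<alpha> \<beta> y) = cinner x ((cadjoint ?L \<circ> ?L) y)"
          unfolding Q ..
      qed
    qed
    with ops show ?thesis
      unfolding factors_linearly_def by blast
  qed
  ultimately show ?thesis
    by blast
qed

end

section \<open>Forms on the threefold sum\<close>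

text \<open>
  A row \<open>R = (V\<^sub>0, V\<^sub>1, V\<^sub>2)\<close> of operators satisfies the intertwining relations
  \<open>A V\<^sub>0 = V\<^sub>0 T + \<i> (p\<^sub>1 V\<^sub>1 + p\<^sub>2 V\<^sub>2)\<close>, \<open>A V\<^sub>1 = V\<^sub>1 T\<close>, \<open>A V\<^sub>2 = V\<^sub>2 T\<close> if and only if \<open>A R = R D\<close> for the
  operator \<open>D = generator T p\<^sub>1 p\<^sub>2\<close>.  Up to the factors \<open>c\<close> and \<open>d\<close>, these are the relations of the
  model, with \<open>p = (1, 0)\<close> for the first operator and \<open>p = (0, 1)\<close> for the second.  On \<^emph>\<open>pencils\<close>
  the row has the values \<open>V\<^sub>0 + s\<^sub>1 V\<^sub>1 + s\<^sub>2 V\<^sub>2\<close>.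
\<close>

definition pencil :: "real \<Rightarrow> real \<Rightarrow> 'h::complex_inner \<Rightarrow> 'h \<times> 'h \<times> 'h" where
  "pencil s1 s2 x = (x, s1 *\<^sub>R x, s2 *\<^sub>R x)"

definition generator :: "('h::chilbert_space \<Rightarrow> 'h) \<Rightarrow> real \<Rightarrow> real \<Rightarrow> 'h \<times> 'h \<times> 'h \<Rightarrow> 'h \<times> 'h \<times> 'h" where
  "generator T p1 p2 X =
     (T (fst X), T (fst (snd X)) + (\<i> * of_real p1) *\<^sub>C fst X, T (snd (snd X)) + (\<i> * of_real p2) *\<^sub>C fst X)"

text \<open>
  This is \<open>exp(\<i> t D)\<close> for the generator \<open>D\<close>.  The part of \<open>D\<close> off the diagonal has square zero, so the
  exponential is linear in it.
\<close>

definition flow :: "('h::chilbert_space \<Rightarrow> 'h) \<Rightarrow> real \<Rightarrow> real \<Rightarrow> real \<Rightarrow> 'h \<times> 'h \<times> 'h \<Rightarrow> 'h \<times> 'h \<times> 'h" where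
  "flow T p1 p2 t X =
     (exp_i t T (fst X), exp_i t T (fst (snd X)) - (t * p1) *\<^sub>R exp_i t T (fst X),
      exp_i t T (snd (snd X)) - (t * p2) *\<^sub>R exp_i t T (fst X))"

lemma bounded_op_generator:
  fixes T :: "'h::chilbert_space \<Rightarrow> 'h"
  assumes T: "bounded_op T"
  shows "bounded_op (generator T p1 p2)"
  unfolding bounded_op_iff_bounded_linear
proof (intro conjI allI)
  have s: "bounded_linear (\<lambda>x :: 'h. a *\<^sub>C x)" for a
    by (rule bounded_bilinear.bounded_linear_right[OF bounded_bilinear_scaleC])
  note comp = bounded_linear_compose[OF bounded_op_bounded_linear[OF T]] bounded_linear_compose[OF s]
  show "bounded_linear (generator T p1 p2)"
    unfolding generator_def[abs_def]
    by (intro bounded_linear_Pair bounded_linear_add comp bounded_linear_fst_comp bounded_linear_snd_comp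
        bounded_linear_ident)
  show "generator T p1 p2 (a *\<^sub>C X) = a *\<^sub>C generator T p1 p2 X" for a X
    unfolding generator_def
    by (simp add: scaleC_prod_def bounded_op_scaleC[OF T] scaleC_add_right scaleC_scaleC mult.commute)
qed

lemma flow_add:
  assumes T: "bounded_op T"
  shows "flow T p1 p2 t (X + Y) = flow T p1 p2 t X + flow T p1 p2 t Y"
  unfolding flow_def by (simp add: bounded_op_add[OF bounded_op_exp_i[OF T]] scaleR_add_right)

lemma flow_scaleC:
  assumes T: "bounded_op T"
  shows "flow T p1 p2 t (a *\<^sub>C X) = a *\<^sub>C flow T p1 p2 t X"
  unfolding flow_def
  by (simp add: scaleC_prod_def bounded_op_scaleC[OF bounded_op_exp_i[OF T]]
      complex_vector.scale_right_diff_distrib scaleR_scaleC_left_commute)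

lemma flow_pencil:
  assumes T: "bounded_op T"
  shows "flow T p1 p2 t (pencil s1 s2 x) = pencil (s1 - t * p1) (s2 - t * p2) (exp_i t T x)"
  unfolding flow_def pencil_def
  by (simp add: bounded_op_scaleR[OF bounded_op_exp_i[OF T]] scaleR_diff_left)

lemma flow_derivative:
  fixes T :: "'h::chilbert_space \<Rightarrow> 'h"
  assumes T: "bounded_op T"
  shows "((\<lambda>t. flow T p1 p2 t X) has_vector_derivative flow T p1 p2 t (\<i> *\<^sub>C generator T p1 p2 X)) (at t)"
proof -
  obtain x0 x1 x2 where X: "X = (x0, x1, x2)"
    by (cases X)
  note z = bounded_op_exp_i[OF T, of t]
  have comp: "((\<lambda>t. exp_i t T y - (t * p) *\<^sub>R exp_i t T x0) has_vector_derivative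
      exp_i t T (\<i> *\<^sub>C T y) - ((t * p) *\<^sub>R exp_i t T (\<i> *\<^sub>C T x0) + p *\<^sub>R exp_i t T x0)) (at t)" for y p
    by (intro has_vector_derivative_diff has_vector_derivative_scaleR exp_i_derivative[OF T])
      (auto intro!: derivative_eq_intros)
  have "((\<lambda>t. flow T p1 p2 t X) has_vector_derivative (exp_i t T (\<i> *\<^sub>C T x0),
      exp_i t T (\<i> *\<^sub>C T x1) - ((t * p1) *\<^sub>R exp_i t T (\<i> *\<^sub>C T x0) + p1 *\<^sub>R exp_i t T x0),
      exp_i t T (\<i> *\<^sub>C T x2) - ((t * p2) *\<^sub>R exp_i t T (\<i> *\<^sub>C T x0) + p2 *\<^sub>R exp_i t T x0))) (at t)"
    unfolding flow_def X fst_conv snd_conv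
    by (intro has_vector_derivative_Pair comp exp_i_derivative[OF T])
  moreover have "flow T p1 p2 t (\<i> *\<^sub>C generator T p1 p2 X) = (exp_i t T (\<i> *\<^sub>C T x0),
      exp_i t T (\<i> *\<^sub>C T x1) - ((t * p1) *\<^sub>R exp_i t T (\<i> *\<^sub>C T x0) + p1 *\<^sub>R exp_i t T x0),
      exp_i t T (\<i> *\<^sub>C T x2) - ((t * p2) *\<^sub>R exp_i t T (\<i> *\<^sub>C T x0) + p2 *\<^sub>R exp_i t T x0))"
    unfolding flow_def generator_def X
    by (simp add: scaleC_prod_def scaleC_add_right bounded_op_diff[OF z] bounded_op_scaleC[OF z]
        scaleR_eq_scaleC[where ?'a = 'h] algebra_simps)
  ultimately show ?thesis
    by simp
qed

lemma generator_flow_commute: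
  assumes S: "bounded_op S" and T: "bounded_op T" and comm: "\<And>x. S (T x) = T (S x)"
  shows "generator S q1 q2 (flow T p1 p2 t X) = flow T p1 p2 t (generator S q1 q2 X)"
proof -
  note z = bounded_op_exp_i[OF T, of t]
  have "S (exp_i t T x) = exp_i t T (S x)" for x
    by (rule exp_i_commute[OF T S comm])
  then show ?thesis
    unfolding generator_def flow_def
    by (simp add: bounded_op_add[OF z] bounded_op_scaleC[OF z] bounded_op_diff[OF S] bounded_op_scaleR[OF S]
        scaleR_scaleC_left_commute scaleR_add_right complex_vector.scale_right_diff_distrib)
qed

text \<open>Pencils span the threefold sum, so the values of a form on them bound it everywhere.\<close>

lemma pencil_decomposition: "(x0, x1, x2) = pencil 0 0 (x0 - x1 - x2) + (pencil 1 0 x1 + pencil 0 1 x2)"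
  unfolding pencil_def by simp

lemma form_decomposition_le:
  assumes g: "psd_form g" and add: "\<And>X Y. f (X + Y) = f X + f Y"
  shows "Re (g (f (x0, x1, x2)) (f (x0, x1, x2)))
    \<le> 2 * Re (g (f (pencil 0 0 (x0 - x1 - x2))) (f (pencil 0 0 (x0 - x1 - x2))))
      + 4 * Re (g (f (pencil 1 0 x1)) (f (pencil 1 0 x1))) + 4 * Re (g (f (pencil 0 1 x2)) (f (pencil 0 1 x2)))"
proof -
  let ?A = "f (pencil 0 0 (x0 - x1 - x2))" and ?B = "f (pencil 1 0 x1)" and ?C = "f (pencil 0 1 x2)"
  have "f (x0, x1, x2) = ?A + (?B + ?C)"
    by (subst pencil_decomposition) (simp only: add)
  moreover have "Re (g (?A + (?B + ?C)) (?A + (?B + ?C))) \<le> 2 * (Re (g ?A ?A) + Re (g (?B + ?C) (?B + ?C)))"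
    by (rule psd_form_triangle[OF g])
  moreover have "Re (g (?B + ?C) (?B + ?C)) \<le> 2 * (Re (g ?B ?B) + Re (g ?C ?C))"
    by (rule psd_form_triangle[OF g])
  ultimately show ?thesis
    by simp
qed

lemma form_bounded_of_pencil:
  fixes g :: "'h::complex_inner \<times> 'h \<times> 'h \<Rightarrow> 'h \<times> 'h \<times> 'h \<Rightarrow> complex"
  assumes g: "psd_form g"
    and bound: "\<And>s1 s2. \<exists>M. \<forall>x. Re (g (pencil s1 s2 x) (pencil s1 s2 x)) \<le> M * (norm x)\<^sup>2"
  obtains C where "C > 0" "\<forall>X. Re (g X X) \<le> C * (norm X)\<^sup>2"
proof -
  have ex: "\<exists>M\<ge>0. \<forall>x. Re (g (pencil s1 s2 x) (pencil s1 s2 x)) \<le> M * (norm x)\<^sup>2" for s1 s2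
  proof -
    obtain M where M: "\<forall>x. Re (g (pencil s1 s2 x) (pencil s1 s2 x)) \<le> M * (norm x)\<^sup>2"
      using bound by blast
    have "Re (g (pencil s1 s2 x) (pencil s1 s2 x)) \<le> \<bar>M\<bar> * (norm x)\<^sup>2" for x
      by (rule order_trans[OF M[rule_format]]) (simp add: mult_right_mono)
    then show ?thesis
      by (intro exI[of _ "\<bar>M\<bar>"]) simp
  qed
  obtain L where L: "L \<ge> 0" "\<forall>x. Re (g (pencil 0 0 x) (pencil 0 0 x)) \<le> L * (norm x)\<^sup>2"
    using ex by blast
  obtain M where M: "M \<ge> 0" "\<forall>x. Re (g (pencil 1 0 x) (pencil 1 0 x)) \<le> M * (norm x)\<^sup>2"
    using ex by blast
  obtain N where N: "N \<ge> 0" "\<forall>x. Re (g (pencil 0 1 x) (pencil 0 1 x)) \<le> N * (norm x)\<^sup>2"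
    using ex by blast
  \<comment> \<open>The \<open>18\<close> is \<open>2 * 3\<^sup>2\<close>, as \<open>x0 - x1 - x2\<close> has norm at most \<open>3 * norm X\<close>; the \<open>1\<close> makes the bound positive.\<close>
  have "Re (g X X) \<le> (18 * L + 4 * M + 4 * N + 1) * (norm X)\<^sup>2" for X
  proof -
    obtain x0 x1 x2 where X: "X = (x0, x1, x2)"
      by (cases X)
    have n1: "norm (snd X) \<le> norm X"
      by (cases X) (simp add: norm_Pair real_le_rsqrt)
    have n: "norm x0 \<le> norm X" "norm x1 \<le> norm X" "norm x2 \<le> norm X"
      using norm_fst_le[of x0 "(x1, x2)"] norm_fst_le[of x1 x2] norm_snd_le[of x2 x1] n1
      unfolding X by simp_all
    have "norm (x0 - x1 - x2) \<le> 3 * norm X"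
      using norm_triangle_ineq4[of "x0 - x1" x2] norm_triangle_ineq4[of x0 x1] n by linarith
    then have "(norm (x0 - x1 - x2))\<^sup>2 \<le> (3 * norm X)\<^sup>2"
      by (rule power_mono) simp
    then have "(norm (x0 - x1 - x2))\<^sup>2 \<le> 9 * (norm X)\<^sup>2"
      by (simp add: power_mult_distrib)
    then have "L * (norm (x0 - x1 - x2))\<^sup>2 \<le> L * (9 * (norm X)\<^sup>2)"
      using L(1) by (rule mult_left_mono)
    then have "L * (norm (x0 - x1 - x2))\<^sup>2 \<le> 9 * (L * (norm X)\<^sup>2)"
      by simp
    moreover have "M * (norm x1)\<^sup>2 \<le> M * (norm X)\<^sup>2" "N * (norm x2)\<^sup>2 \<le> N * (norm X)\<^sup>2"
      using M(1) N(1) n by (auto intro!: mult_left_mono power_mono)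
    moreover have "Re (g X X) \<le> 2 * Re (g (pencil 0 0 (x0 - x1 - x2)) (pencil 0 0 (x0 - x1 - x2)))
        + 4 * Re (g (pencil 1 0 x1) (pencil 1 0 x1)) + 4 * Re (g (pencil 0 1 x2) (pencil 0 1 x2))"
      unfolding X by (rule form_decomposition_le[OF g, of "\<lambda>X. X"]) (rule refl)
    moreover have "0 \<le> (norm X)\<^sup>2"
      by simp
    moreover have "(18 * L + 4 * M + 4 * N + 1) * (norm X)\<^sup>2
        = 18 * (L * (norm X)\<^sup>2) + 4 * (M * (norm X)\<^sup>2) + 4 * (N * (norm X)\<^sup>2) + (norm X)\<^sup>2"
      by (simp add: algebra_simps)
    ultimately show ?thesis
      using L(2)[rule_format, of "x0 - x1 - x2"] M(2)[rule_format, of x1] N(2)[rule_format, of x2]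
      by linarith
  qed
  with L(1) M(1) N(1) show ?thesis
    by (intro that[of "18 * L + 4 * M + 4 * N + 1"]) auto
qed

text \<open>
  The flow acts on pencils by a translation of the parameters.  A form whose values on pencils are
  invariant under this action thus stays bounded along the flow, and its average has the same values
  on pencils.  Other symmetric operators that commute with the flow remain symmetric, so averages
  over commuting flows can be taken one after the other.
\<close>

lemma symmetrized_form:
  fixes T :: "'h::chilbert_space \<Rightarrow> 'h" and q :: "real \<Rightarrow> real \<Rightarrow> 'h \<Rightarrow> complex"
  assumes T: "bounded_op T" and g: "psd_form g"
    and gq: "\<forall>s1 s2 x. g (pencil s1 s2 x) (pencil s1 s2 x) = q s1 s2 x"
    and bound: "\<And>s1 s2. \<exists>M. \<forall>x. Re (q s1 s2 x) \<le> M * (norm x)\<^sup>2"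
    and inv: "\<And>t s1 s2 x. q (s1 - t * p1) (s2 - t * p2) (exp_i t T x) = q s1 s2 x"
  obtains g' where "psd_form g'"
    "\<forall>s1 s2 x. g' (pencil s1 s2 x) (pencil s1 s2 x) = q s1 s2 x"
    "\<forall>X Y. g' (generator T p1 p2 X) Y = g' X (generator T p1 p2 Y)"
    "\<forall>S. (\<forall>t X. S (flow T p1 p2 t X) = flow T p1 p2 t (S X)) \<longrightarrow> (\<forall>X Y. g (S X) Y = g X (S Y))
      \<longrightarrow> (\<forall>X Y. g' (S X) Y = g' X (S Y))"
proof -
  let ?e = "flow T p1 p2"
  have e_pencil: "g (?e t (pencil s1 s2 x)) (?e t (pencil s1 s2 x)) = q s1 s2 x" for t s1 s2 x
    unfolding flow_pencil[OF T] using gq inv by simp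
  have gb: "\<exists>M. \<forall>x. Re (g (pencil s1 s2 x) (pencil s1 s2 x)) \<le> M * (norm x)\<^sup>2" for s1 s2
    using gq bound by simp
  obtain C where C: "C > 0" "\<forall>X. Re (g X X) \<le> C * (norm X)\<^sup>2"
    by (rule form_bounded_of_pencil[OF g gb])
  have orbit: "\<exists>M. \<forall>t. Re (g (?e t X) (?e t X)) \<le> M" for X
  proof -
    obtain x0 x1 x2 where X: "X = (x0, x1, x2)"
      by (cases X)
    have "Re (g (?e t X) (?e t X)) \<le> 2 * Re (q 0 0 (x0 - x1 - x2)) + 4 * Re (q 1 0 x1) + 4 * Re (q 0 1 x2)" for t
      using form_decomposition_le[OF g, of "?e t" x0 x1 x2, OF flow_add[OF T]]
      unfolding X e_pencil .
    then show ?thesis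
      by blast
  qed
  obtain g' where g': "psd_form g'" "\<forall>X Y. g' (generator T p1 p2 X) Y = g' X (generator T p1 p2 Y)"
    and inherit: "\<forall>X Y X' Y'. (\<forall>t. g (?e t X) (?e t Y) = g (?e t X') (?e t Y')) \<longrightarrow> g' X Y = g' X' Y'"
    and const: "\<forall>X Y a. (\<forall>t. g (?e t X) (?e t Y) = a) \<longrightarrow> g' X Y = a"
    by (rule psd_form_average[OF g C(2)[rule_format] less_imp_le[OF C(1)] flow_add[OF T] flow_scaleC[OF T]
          flow_derivative[OF T] orbit])
  have pencil': "\<forall>s1 s2 x. g' (pencil s1 s2 x) (pencil s1 s2 x) = q s1 s2 x"
  proof (intro allI)
    fix s1 s2 x
    show "g' (pencil s1 s2 x) (pencil s1 s2 x) = q s1 s2 x"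
      by (rule const[rule_format]) (rule e_pencil)
  qed
  have other: "\<forall>S. (\<forall>t X. S (?e t X) = ?e t (S X)) \<longrightarrow> (\<forall>X Y. g (S X) Y = g X (S Y))
      \<longrightarrow> (\<forall>X Y. g' (S X) Y = g' X (S Y))"
  proof (intro allI impI)
    fix S X Y
    assume S: "\<forall>t X. S (?e t X) = ?e t (S X)" "\<forall>X Y. g (S X) Y = g X (S Y)"
    show "g' (S X) Y = g' X (S Y)"
    proof (rule inherit[rule_format])
      fix t
      have "g (?e t (S X)) (?e t Y) = g (S (?e t X)) (?e t Y)"
        by (simp only: S(1)[rule_format])
      also have "\<dots> = g (?e t X) (S (?e t Y))"
        using S(2) by blast
      also have "\<dots> = g (?e t X) (?e t (S Y))"
        by (simp only: S(1)[rule_format])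
      finally show "g (?e t (S X)) (?e t Y) = g (?e t X) (?e t (S Y))" .
    qed
  qed
  show ?thesis
    by (rule that[OF g'(1) pencil' g'(2) other])
qed

section \<open>Self-adjoint operators from symmetric ones\<close>

lemma eq_on_closure:
  fixes f h :: "'a::topological_space \<Rightarrow> 'b::real_normed_vector"
  assumes "continuous_on (closure S) f" "continuous_on (closure S) h" "\<And>x. x \<in> S \<Longrightarrow> f x = h x"
    and "x \<in> closure S"
  shows "f x = h x"
proof -
  have "f x - h x = 0"
    by (rule continuous_constant_on_closure[OF continuous_on_diff[OF assms(1,2)] _ assms(4)])
      (simp add: assms(3))
  then show ?thesis by simp
qed

text \<open>The bound makes \<open>R x \<mapsto> R (D x)\<close> well defined and continuous.\<close>

lemma transported_operator:
  fixes R D :: "'a::chilbert_space \<Rightarrow> 'a"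
  assumes R: "bounded_op R" and D: "bounded_op D" and M: "\<And>x. norm (R (D x)) \<le> M * norm (R x)"
  obtains A where "bounded_op_on (closure (range R)) A" "continuous_on (closure (range R)) A"
    "\<forall>x. A (R x) = R (D x)"
proof -
  have lin_R: "clinear_on UNIV R"
    using R unfolding bounded_op_on_def by blast
  note sub = subspace_range[OF lin_R]
  define f where "f y = R (D (SOME x. R x = y))" for y
  have fR: "f (R x) = R (D x)" for x
  proof -
    define x' where "x' = (SOME x'. R x' = R x)"
    have "R x' = R x"
      unfolding x'_def by (rule someI) (rule refl)
    then have "norm (R (D (x' - x))) \<le> 0"
      using M[of "x' - x"] by (simp add: bounded_op_diff[OF R])
    then show ?thesis
      unfolding f_def x'_def[symmetric] by (simp add: bounded_op_diff[OF R] bounded_op_diff[OF D])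
  qed
  have "clinear_on (range R) f"
    unfolding clinear_on_def
  proof (intro conjI ballI allI)
    fix u v assume "u \<in> range R" "v \<in> range R"
    then obtain x y where uv: "u = R x" "v = R y"
      by blast
    have "f (R (x + y)) = f (R x) + f (R y)"
      unfolding fR by (simp add: bounded_op_add[OF R] bounded_op_add[OF D])
    then show "f (u + v) = f u + f v"
      unfolding uv by (simp add: bounded_op_add[OF R])
  next
    fix a u assume "u \<in> range R"
    then obtain x where u: "u = R x"
      by blast
    have "f (R (a *\<^sub>C x)) = a *\<^sub>C f (R x)"
      unfolding fR by (simp add: bounded_op_scaleC[OF R] bounded_op_scaleC[OF D])
    then show "f (a *\<^sub>C u) = a *\<^sub>C f u"
      unfolding u by (simp add: bounded_op_scaleC[OF R])
  qed
  moreover have "norm (f u) \<le> M * norm u" if "u \<in> range R" for u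
    using that M by (auto simp: fR)
  ultimately obtain A where A: "clinear_on (closure (range R)) A" "\<forall>u\<in>range R. A u = f u"
    "continuous_on (closure (range R)) A" "\<forall>u\<in>closure (range R). norm (A u) \<le> M * norm u"
    by (rule clinear_extend_closure[OF sub])
  have AR: "A (R x) = R (D x)" for x
    using A(2) fR by simp
  have "A ` closure (range R) \<subseteq> closure (range R)"
  proof (rule image_closure_subset[OF A(3) closed_closure])
    show "A ` range R \<subseteq> closure (range R)"
      using AR closure_subset[of "range R"] by auto
  qed
  then have "bounded_op_on (closure (range R)) A"
    unfolding bounded_op_on_def using A(1,4) by blast
  then show ?thesis
    using A(3) AR by (intro that[of A]) auto
qed

lemma self_adjoint_transported:
  assumes A: "bounded_op_on (closure (range R)) A" and cont: "continuous_on (closure (range R)) A"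
    and AR: "\<forall>x. A (R x) = R (D x)"
    and sym: "\<And>x y. cinner (R (D x)) (R y) = cinner (R x) (R (D y))"
  shows "self_adjoint_on (closure (range R)) A"
proof -
  have id: "continuous_on (closure (range R)) (\<lambda>u. u)"
    by (rule continuous_on_id)
  have 1: "cinner (A (R x)) v = cinner (R x) (A v)" if "v \<in> closure (range R)" for x v
  proof (rule eq_on_closure[OF _ _ _ that])
    show "continuous_on (closure (range R)) (\<lambda>v. cinner (A (R x)) v)"
      by (intro continuous_on_cinner continuous_on_const id)
    show "continuous_on (closure (range R)) (\<lambda>v. cinner (R x) (A v))"
      by (intro continuous_on_cinner continuous_on_const cont)
    show "cinner (A (R x)) v = cinner (R x) (A v)" if "v \<in> range R" for v
      using that sym AR by auto
  qed
  have "cinner (A u) v = cinner u (A v)" if u: "u \<in> closure (range R)" and v: "v \<in> closure (range R)" for u v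
  proof (rule eq_on_closure[OF _ _ _ u])
    show "continuous_on (closure (range R)) (\<lambda>u. cinner (A u) v)"
      by (intro continuous_on_cinner continuous_on_const cont)
    show "continuous_on (closure (range R)) (\<lambda>u. cinner u (A v))"
      by (intro continuous_on_cinner continuous_on_const id)
    show "cinner (A u) v = cinner u (A v)" if "u \<in> range R" for u
      using that 1[OF v] by auto
  qed
  with A show ?thesis
    unfolding self_adjoint_on_def by blast
qed

lemma transported_commute:
  assumes A1: "bounded_op_on (closure (range R)) A1" "continuous_on (closure (range R)) A1"
      "\<forall>x. A1 (R x) = R (D1 x)"
    and A2: "bounded_op_on (closure (range R)) A2" "continuous_on (closure (range R)) A2"
      "\<forall>x. A2 (R x) = R (D2 x)"
    and comm: "\<And>x. D1 (D2 x) = D2 (D1 x)" and u: "u \<in> closure (range R)"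
  shows "A1 (A2 u) = A2 (A1 u)"
proof (rule eq_on_closure[OF _ _ _ u])
  have "A1 ` closure (range R) \<subseteq> closure (range R)" "A2 ` closure (range R) \<subseteq> closure (range R)"
    using A1(1) A2(1) unfolding bounded_op_on_def by blast+
  then show "continuous_on (closure (range R)) (\<lambda>u. A1 (A2 u))" "continuous_on (closure (range R)) (\<lambda>u. A2 (A1 u))"
    using A1(2) A2(2) by (auto intro: continuous_on_compose2)
  show "A1 (A2 u) = A2 (A1 u)" if "u \<in> range R" for u
    using that A1(3) A2(3) comm by auto
qed

section \<open>A factorization yields a lifting\<close>

context symmetric_pair
begin

definition qhat :: "real \<Rightarrow> real \<Rightarrow> real \<Rightarrow> real \<Rightarrow> 'h \<Rightarrow> complex" where
  "qhat c d s1 s2 x = cinner x (Q_hat c d B s1 s2 x)"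

text \<open>The pure second-order coefficients are second differences of \<^const>\<open>gram\<close>, which the flow translates.\<close>

lemma flow_invariant_B:
  "cinner (exp_i t T1 x) (B 2 0 (exp_i t T1 x)) = cinner x (B 2 0 x)"
  "cinner (exp_i t T1 x) (B 0 2 (exp_i t T1 x)) = cinner x (B 0 2 x)"
  "cinner (exp_i t T2 x) (B 2 0 (exp_i t T2 x)) = cinner x (B 2 0 x)"
  "cinner (exp_i t T2 x) (B 0 2 (exp_i t T2 x)) = cinner x (B 0 2 x)"
proof -
  have d20: "2 * cinner x (B 2 0 x) = gram (r + 1) s x x + gram (r - 1) s x x - 2 * gram r s x x" for r s x
    unfolding gram_eq by (simp add: algebra_simps power2_eq_square)
  have d02: "2 * cinner x (B 0 2 x) = gram r (s + 1) x x + gram r (s - 1) x x - 2 * gram r s x x" for r s x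
    unfolding gram_eq by (simp add: algebra_simps power2_eq_square)
  let ?y = "exp_i t T1 x" and ?z = "exp_i t T2 x"
  have "2 * cinner ?y (B 2 0 ?y) = 2 * cinner x (B 2 0 x)"
    unfolding d20[of ?y 0 0] d20[of x t 0]
    using gram_shift1[of 1 t 0 x x] gram_shift1[of "- 1" t 0 x x] gram_shift1[of 0 t 0 x x]
    by (simp add: add.commute)
  then show "cinner ?y (B 2 0 ?y) = cinner x (B 2 0 x)"
    by simp
  have "2 * cinner ?y (B 0 2 ?y) = 2 * cinner x (B 0 2 x)"
    unfolding d02[of ?y 0 0] d02[of x t 0]
    using gram_shift1[of 0 t 1 x x] gram_shift1[of 0 t "- 1" x x] gram_shift1[of 0 t 0 x x]
    by simp
  then show "cinner ?y (B 0 2 ?y) = cinner x (B 0 2 x)"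
    by simp
  have "2 * cinner ?z (B 2 0 ?z) = 2 * cinner x (B 2 0 x)"
    unfolding d20[of ?z 0 0] d20[of x 0 t]
    using gram_shift2[of 1 0 t x x] gram_shift2[of "- 1" 0 t x x] gram_shift2[of 0 0 t x x]
    by simp
  then show "cinner ?z (B 2 0 ?z) = cinner x (B 2 0 x)"
    by simp
  have "2 * cinner ?z (B 0 2 ?z) = 2 * cinner x (B 0 2 x)"
    unfolding d02[of ?z 0 0] d02[of x 0 t]
    using gram_shift2[of 0 1 t x x] gram_shift2[of 0 "- 1" t x x] gram_shift2[of 0 0 t x x]
    by (simp add: add.commute)
  then show "cinner ?z (B 0 2 ?z) = cinner x (B 0 2 x)"
    by simp
qed

lemma qhat_flow1: "qhat c d (s1 - t * 1) (s2 - t * 0) (exp_i t T1 x) = qhat c d s1 s2 x"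
  unfolding qhat_def cinner_Q_hat flow_invariant_B gram_shift1[symmetric] by simp

lemma qhat_flow2: "qhat c d (s1 - t * 0) (s2 - t * 1) (exp_i t T2 x) = qhat c d s1 s2 x"
  unfolding qhat_def cinner_Q_hat flow_invariant_B gram_shift2[symmetric] by simp

text \<open>
  The given factor defines a form with the right values on pencils.  Off the pencils the form is not
  determined by the polynomial, which sees \<open>V\<^sub>i\<^sup>* V\<^sub>j + V\<^sub>j\<^sup>* V\<^sub>i\<close> only, and the generators need not be
  symmetric for it.  Averaging over both flows repairs this.
\<close>

lemma symmetric_form_exists:
  assumes fac: "factors_linearly (Q_hat c d B)"
  obtains g :: "'h \<times> 'h \<times> 'h \<Rightarrow> 'h \<times> 'h \<times> 'h \<Rightarrow> complex" and C where "psd_form g"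
    "\<forall>s1 s2 x. g (pencil s1 s2 x) (pencil s1 s2 x) = qhat c d s1 s2 x"
    "C > 0" "\<forall>X. Re (g X X) \<le> C * (norm X)\<^sup>2"
    "\<forall>X Y. g (generator T1 1 0 X) Y = g X (generator T1 1 0 Y)"
    "\<forall>X Y. g (generator T2 0 1 X) Y = g X (generator T2 0 1 Y)"
proof -
  obtain V0 V1 V2 where V: "bounded_op V0" "bounded_op V1" "bounded_op V2"
    and Q: "\<forall>\<alpha> \<beta>. Q_hat c d B \<alpha> \<beta> = cadjoint (\<lambda>x. V0 x + \<alpha> *\<^sub>R V1 x + \<beta> *\<^sub>R V2 x)
      \<circ> (\<lambda>x. V0 x + \<alpha> *\<^sub>R V1 x + \<beta> *\<^sub>R V2 x)"
    using fac unfolding factors_linearly_def by (elim exE conjE) (rule that)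
  define L where "L s1 s2 x = V0 x + s1 *\<^sub>R V1 x + s2 *\<^sub>R V2 x" for s1 s2 x
  have L: "bounded_op (L s1 s2)" for s1 s2
    unfolding L_def[abs_def] by (intro bounded_op_plus bounded_op_scaled V)
  have qL: "qhat c d s1 s2 x = cinner (L s1 s2 x) (L s1 s2 x)" for s1 s2 x
  proof -
    have "Q_hat c d B s1 s2 = cadjoint (L s1 s2) \<circ> L s1 s2"
      using Q unfolding L_def[abs_def] by blast
    then show ?thesis
      unfolding qhat_def by (simp add: cadjoint[OF L])
  qed
  have bound: "\<exists>M. \<forall>x. Re (qhat c d s1 s2 x) \<le> M * (norm x)\<^sup>2" for s1 s2
  proof -
    obtain M where M: "\<And>x. norm (L s1 s2 x) \<le> M * norm x"
      using bounded_op_bound[OF L] by blast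
    have "Re (qhat c d s1 s2 x) \<le> M\<^sup>2 * (norm x)\<^sup>2" for x
      unfolding qL Re_cinner_self power_mult_distrib[symmetric] by (rule power_mono[OF M]) simp
    then show ?thesis
      by blast
  qed
  define R0 where "R0 X = V0 (fst X) + V1 (fst (snd X)) + V2 (snd (snd X))" for X :: "'h \<times> 'h \<times> 'h"
  define g0 where "g0 X Y = cinner (R0 X) (R0 Y)" for X Y
  have R0_add: "R0 (X + Y) = R0 X + R0 Y" and R0_scale: "R0 (a *\<^sub>C X) = a *\<^sub>C R0 X" for X Y a
    unfolding R0_def
    by (simp_all add: bounded_op_add[OF V(1)] bounded_op_add[OF V(2)] bounded_op_add[OF V(3)]
        scaleC_prod_def bounded_op_scaleC[OF V(1)] bounded_op_scaleC[OF V(2)] bounded_op_scaleC[OF V(3)]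
        scaleC_add_right)
  have g0: "psd_form g0"
  proof (rule psd_formI)
    show "g0 X Y = cnj (g0 Y X)" for X Y
      unfolding g0_def by (rule cinner_commute)
    show "0 \<le> Re (g0 X X)" for X
      unfolding g0_def Re_cinner_self by simp
  qed (simp_all add: g0_def R0_add R0_scale cinner_simps)
  have g0q: "\<forall>s1 s2 x. g0 (pencil s1 s2 x) (pencil s1 s2 x) = qhat c d s1 s2 x"
    unfolding qL g0_def R0_def pencil_def L_def
    by (simp add: bounded_op_scaleR[OF V(2)] bounded_op_scaleR[OF V(3)])
  obtain g1 where g1: "psd_form g1" "\<forall>s1 s2 x. g1 (pencil s1 s2 x) (pencil s1 s2 x) = qhat c d s1 s2 x"
    "\<forall>X Y. g1 (generator T1 1 0 X) Y = g1 X (generator T1 1 0 Y)"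
    "\<forall>S. (\<forall>t X. S (flow T1 1 0 t X) = flow T1 1 0 t (S X)) \<longrightarrow> (\<forall>X Y. g0 (S X) Y = g0 X (S Y))
      \<longrightarrow> (\<forall>X Y. g1 (S X) Y = g1 X (S Y))"
    by (rule symmetrized_form[OF T1 g0 g0q bound qhat_flow1])
  obtain g2 where g2: "psd_form g2" "\<forall>s1 s2 x. g2 (pencil s1 s2 x) (pencil s1 s2 x) = qhat c d s1 s2 x"
    "\<forall>X Y. g2 (generator T2 0 1 X) Y = g2 X (generator T2 0 1 Y)"
    "\<forall>S. (\<forall>t X. S (flow T2 0 1 t X) = flow T2 0 1 t (S X)) \<longrightarrow> (\<forall>X Y. g1 (S X) Y = g1 X (S Y))
      \<longrightarrow> (\<forall>X Y. g2 (S X) Y = g2 X (S Y))"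
    by (rule symmetrized_form[OF T2 g1(1,2) bound qhat_flow2])
  have "\<forall>t X. generator T1 1 0 (flow T2 0 1 t X) = flow T2 0 1 t (generator T1 1 0 X)"
    by (intro allI generator_flow_commute[OF T1 T2 comm])
  with g2(4) g1(3) have sym1: "\<forall>X Y. g2 (generator T1 1 0 X) Y = g2 X (generator T1 1 0 Y)"
    by blast
  have gb: "\<exists>M. \<forall>x. Re (g2 (pencil s1 s2 x) (pencil s1 s2 x)) \<le> M * (norm x)\<^sup>2" for s1 s2
    using g2(2) bound by simp
  obtain C where C: "C > 0" "\<forall>X. Re (g2 X X) \<le> C * (norm X)\<^sup>2"
    by (rule form_bounded_of_pencil[OF g2(1) gb])
  show ?thesis
    by (rule that[OF g2(1,2) C sym1 g2(3)])
qed

text \<open>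
  Let \<open>R\<close> factor the symmetric form.  The generators descend to commuting self-adjoint operators on
  the closure of the range of \<open>R\<close>, and the columns of \<open>R\<close>, scaled by \<open>1\<close>, \<open>1 / c\<close>, \<open>1 / d\<close>, form the lifting.
  It is an isometry because \<open>1 / c\<^sup>2 B\<^sub>2\<^sub>0\<close> and \<open>1 / d\<^sup>2 B\<^sub>0\<^sub>2\<close> are subtracted in the polynomial.
\<close>

lemma lifting_of_factorization:
  assumes fac: "factors_linearly (Q_hat c d B)" and c: "c > 0" and d: "d > 0"
  shows "\<exists>F :: ('h \<times> 'h \<times> 'h) set. hilbert_subspace F \<and> lifts_to_model c d T1 T2 F"
proof -
  obtain g :: "'h \<times> 'h \<times> 'h \<Rightarrow> 'h \<times> 'h \<times> 'h \<Rightarrow> complex" and C where g: "psd_form g"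
    "\<forall>s1 s2 x. g (pencil s1 s2 x) (pencil s1 s2 x) = qhat c d s1 s2 x"
    and C: "C > 0" "\<forall>X. Re (g X X) \<le> C * (norm X)\<^sup>2"
    and sym1: "\<forall>X Y. g (generator T1 1 0 X) Y = g X (generator T1 1 0 Y)"
    and sym2: "\<forall>X Y. g (generator T2 0 1 X) Y = g X (generator T2 0 1 Y)"
    by (rule symmetric_form_exists[OF fac])
  obtain R where R: "bounded_op R" and gR: "\<And>X Y. g X Y = cinner (R X) (R Y)"
    using psd_form_factors[OF g(1) C(2)[rule_format] C(1)] by blast
  let ?F = "closure (range R)"
  have "clinear_on UNIV R"
    using R unfolding bounded_op_on_def by blast
  then have F: "hilbert_subspace ?F"
    by (simp add: hilbert_subspace_iff subspace_closure subspace_range)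
  have transport: "\<exists>A. bounded_op_on ?F A \<and> continuous_on ?F A \<and> (\<forall>X. A (R X) = R (D X)) \<and> self_adjoint_on ?F A"
    if D: "bounded_op D" and sym: "\<forall>X Y. g (D X) Y = g X (D Y)" for D
  proof -
    obtain M where M: "M > 0" "\<And>X. norm (D X) \<le> M * norm X"
      using bounded_op_bound[OF D] by blast
    have "norm (R (D X)) \<le> M * norm (R X)" for X
    proof (rule power2_le_imp_le)
      show "(norm (R (D X)))\<^sup>2 \<le> (M * norm (R X))\<^sup>2"
        using symmetric_operator_form_bound[OF g(1) C(2)[rule_format] sym M(2,1), of X]
        unfolding gR Re_cinner_self power_mult_distrib .
    qed (use M(1) in simp)
    then obtain A where A: "bounded_op_on ?F A" "continuous_on ?F A" "\<forall>X. A (R X) = R (D X)"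
      by (rule transported_operator[OF R D])
    moreover have "self_adjoint_on ?F A"
      using sym unfolding gR by (intro self_adjoint_transported[OF A]) blast
    ultimately show ?thesis
      by blast
  qed
  let ?D1 = "generator T1 1 0" and ?D2 = "generator T2 0 1"
  obtain A1 where A1: "bounded_op_on ?F A1" "continuous_on ?F A1" "\<forall>X. A1 (R X) = R (?D1 X)"
    and sa1: "self_adjoint_on ?F A1"
    using transport[OF bounded_op_generator[OF T1] sym1] by blast
  obtain A2 where A2: "bounded_op_on ?F A2" "continuous_on ?F A2" "\<forall>X. A2 (R X) = R (?D2 X)"
    and sa2: "self_adjoint_on ?F A2"
    using transport[OF bounded_op_generator[OF T2] sym2] by blast
  have "?D1 (?D2 X) = ?D2 (?D1 X)" for X
    unfolding generator_def
    by (simp add: comm bounded_op_add[OF T1] bounded_op_add[OF T2] bounded_op_scaleC[OF T1] bounded_op_scaleC[OF T2])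
  then have A12: "A1 (A2 u) = A2 (A1 u)" if "u \<in> ?F" for u
    by (rule transported_commute[OF A1 A2 _ that])
  define i0 :: "'h \<Rightarrow> 'h \<times> 'h \<times> 'h" where "i0 x = (x, 0, 0)" for x
  define i1 :: "'h \<Rightarrow> 'h \<times> 'h \<times> 'h" where "i1 x = (0, x, 0)" for x
  define i2 :: "'h \<Rightarrow> 'h \<times> 'h \<times> 'h" where "i2 x = (0, 0, x)" for x
  have pencil_eq: "pencil s1 s2 x = i0 x + s1 *\<^sub>R i1 x + s2 *\<^sub>R i2 x" for s1 s2 x
    unfolding pencil_def i0_def i1_def i2_def by simp
  note gs = psd_form_simps[OF g(1)]
  have g00: "g (i0 x) (i0 x) = cinner x x - cinner x (B 2 0 x) / of_real (c\<^sup>2) - cinner x (B 0 2 x) / of_real (d\<^sup>2)" for x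
    using g(2)[rule_format, of 0 0 x] unfolding qhat_def cinner_Q_hat gram_eq pencil_eq by simp
  have g11: "g (i1 x) (i1 x) = cinner x (B 2 0 x)" for x
  proof -
    have "2 * g (i1 x) (i1 x) = g (pencil 1 0 x) (pencil 1 0 x) + g (pencil (- 1) 0 x) (pencil (- 1) 0 x)
        - 2 * g (pencil 0 0 x) (pencil 0 0 x)"
      unfolding pencil_eq by (simp add: gs)
    also have "\<dots> = 2 * cinner x (B 2 0 x)"
      unfolding g(2)[rule_format] qhat_def cinner_Q_hat gram_eq by simp
    finally show ?thesis by simp
  qed
  have g22: "g (i2 x) (i2 x) = cinner x (B 0 2 x)" for x
  proof -
    have "2 * g (i2 x) (i2 x) = g (pencil 0 1 x) (pencil 0 1 x) + g (pencil 0 (- 1) x) (pencil 0 (- 1) x)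
        - 2 * g (pencil 0 0 x) (pencil 0 0 x)"
      unfolding pencil_eq by (simp add: gs)
    also have "\<dots> = 2 * cinner x (B 0 2 x)"
      unfolding g(2)[rule_format] qhat_def cinner_Q_hat gram_eq by simp
    finally show ?thesis by simp
  qed
  define V where "V x = (R (i0 x), (1 / c) *\<^sub>R R (i1 x), (1 / d) *\<^sub>R R (i2 x))" for x
  have RF: "R X \<in> ?F" for X
    using closure_subset[of "range R"] by blast
  have RF': "r *\<^sub>R R X \<in> ?F" for r X
    using F RF[of X] unfolding hilbert_subspace_def by (simp add: scaleR_eq_scaleC)
  have "norm (V x) = norm x" for x
  proof -
    have "cinner (V x) (V x) = g (i0 x) (i0 x) + of_real (1 / c\<^sup>2) * g (i1 x) (i1 x) + of_real (1 / d\<^sup>2) * g (i2 x) (i2 x)"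
      unfolding V_def gR by (simp add: cinner_Pair cinner_simps power2_eq_square)
    also have "\<dots> = cinner x x"
      unfolding g00 g11 g22 by simp
    finally have "(norm (V x))\<^sup>2 = (norm x)\<^sup>2"
      by (metis Re_cinner_self)
    then show ?thesis
      by simp
  qed
  moreover have "V \<in> UNIV \<rightarrow> ?F \<times> ?F \<times> ?F"
    unfolding V_def using RF RF' by auto
  moreover have "clinear_on UNIV V"
  proof -
    have "i0 (x + y) = i0 x + i0 y" "i1 (x + y) = i1 x + i1 y" "i2 (x + y) = i2 x + i2 y"
      "i0 (a *\<^sub>C x) = a *\<^sub>C i0 x" "i1 (a *\<^sub>C x) = a *\<^sub>C i1 x" "i2 (a *\<^sub>C x) = a *\<^sub>C i2 x" for x y a
      unfolding i0_def i1_def i2_def by (simp_all add: scaleC_Pair)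
    then show ?thesis
      unfolding clinear_on_def V_def
      by (simp add: bounded_op_add[OF R] bounded_op_scaleC[OF R] scaleC_Pair scaleR_add_right
          scaleR_scaleC_left_commute)
  qed
  moreover have "V (T1 x) = model1 c A1 (V x)" for x
  proof -
    have "?D1 (i0 x) = i0 (T1 x) + \<i> *\<^sub>C i1 x" "?D1 (i1 x) = i1 (T1 x)" "?D1 (i2 x) = i2 (T1 x)"
      unfolding generator_def i0_def i1_def i2_def by (simp_all add: bounded_op_zero[OF T1] scaleC_Pair)
    moreover have "A1 (r *\<^sub>R R X) = r *\<^sub>R R (?D1 X)" for r X
      using A1(3)[rule_format, of "r *\<^sub>R X"]
      by (simp add: bounded_op_scaleR[OF R] bounded_op_scaleR[OF bounded_op_generator[OF T1]])
    moreover have "(- \<i> * of_real c) *\<^sub>C (1 / c) *\<^sub>R u = - (\<i> *\<^sub>C u)" for u :: "'h \<times> 'h \<times> 'h"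
      using c by (simp add: scaleR_eq_scaleC scaleC_scaleC)
    ultimately show ?thesis
      unfolding V_def model1_def
      by (simp add: A1(3) bounded_op_add[OF R] bounded_op_scaleC[OF R])
  qed
  moreover have "V (T2 x) = model2 d A2 (V x)" for x
  proof -
    have "?D2 (i0 x) = i0 (T2 x) + \<i> *\<^sub>C i2 x" "?D2 (i1 x) = i1 (T2 x)" "?D2 (i2 x) = i2 (T2 x)"
      unfolding generator_def i0_def i1_def i2_def by (simp_all add: bounded_op_zero[OF T2] scaleC_Pair)
    moreover have "A2 (r *\<^sub>R R X) = r *\<^sub>R R (?D2 X)" for r X
      using A2(3)[rule_format, of "r *\<^sub>R X"]
      by (simp add: bounded_op_scaleR[OF R] bounded_op_scaleR[OF bounded_op_generator[OF T2]])
    moreover have "(- \<i> * of_real d) *\<^sub>C (1 / d) *\<^sub>R u = - (\<i> *\<^sub>C u)" for u :: "'h \<times> 'h \<times> 'h"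
      using d by (simp add: scaleR_eq_scaleC scaleC_scaleC)
    ultimately show ?thesis
      unfolding V_def model2_def
      by (simp add: A2(3) bounded_op_add[OF R] bounded_op_scaleC[OF R])
  qed
  ultimately have "lifts_to T1 T2 (?F \<times> ?F \<times> ?F) (model1 c A1) (model2 d A2)"
    unfolding lifts_to_def by blast
  with sa1 sa2 A12 have "lifts_to_model c d T1 T2 ?F"
    unfolding lifts_to_model_def by blast
  with F show ?thesis
    by blast
qed

end

(* A single formula cannot bind the type of the Hilbert space F.  The equivalence is stated with F
   inside the type of H^3, and the forward implication also for F inside an arbitrary type 'f. *)
theorem theorem9:
  fixes T1 T2 :: "'h::chilbert_space \<Rightarrow> 'h" and B :: "nat \<Rightarrow> nat \<Rightarrow> 'h \<Rightarrow> 'h" and c d :: real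
  assumes "c > 0" and "d > 0"
    and "commuting_3_symmetric T1 T2 B"
  shows "((\<exists>F :: ('h \<times> 'h \<times> 'h) set. hilbert_subspace F \<and> lifts_to_model c d T1 T2 F) \<longleftrightarrow>
            (\<forall>\<alpha> \<beta>. psd (Q_hat c d B \<alpha> \<beta>)) \<and> factors_linearly (Q_hat c d B)) \<and>
         ((\<exists>F :: 'f::chilbert_space set. hilbert_subspace F \<and> lifts_to_model c d T1 T2 F) \<longrightarrow>
            (\<forall>\<alpha> \<beta>. psd (Q_hat c d B \<alpha> \<beta>)) \<and> factors_linearly (Q_hat c d B))"
proof -
  interpret symmetric_pair T1 T2 B
    by standard (rule assms(3))
  have fac: "(\<forall>\<alpha> \<beta>. psd (Q_hat c d B \<alpha> \<beta>)) \<and> factors_linearly (Q_hat c d B)"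
    if "\<exists>F :: 'g::chilbert_space set. hilbert_subspace F \<and> lifts_to_model c d T1 T2 F"
    using that factorization_of_lifting[OF _ _ assms(1,2)] by blast
  show ?thesis
    using fac fac[where ?'g = 'f] lifting_of_factorization[OF _ assms(1,2)] by blast
qed

end
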